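(* Let $K$ be a differential field, $n\ge 1$, and let $L=a_nD^n+\dots+a_1D+a_0$, with $a_i\in K$, $a_n\ne 0$, be a linear differential operator of order $n$ over $K$. All solutions of the homogeneous equation $L(y)=a_ny^{(n)}+\dots+a_1y'+a_0y=0$ belong to some admissible extension $E\supset K$ if and only if the following two conditions hold simultaneously: (1) there is a sequence of nonzero elements $z_1,\dots,z_n$ (of some differential extension of $K$) which are exponentials of integrals over $K$, i.e. $z_1'=p_1z_1,\dots,z_n'=p_nz_n$ with $p_1,\dots,p_n\in K$, such that the operator $L$ is representable in the form $$L=a_nL_n\circ\dots\circ L_1,$$ where $L_i=D-p_i$ for each $i$; (2) for these elements, let $G$ be the multiplicative group generated by $z_1,\dots,z_n$ and let $G_0=G\cap K$; then the factor group $G/G_0$ is torsion free.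
   Context: A differential field is a field with an additive map $a\mapsto a'$ satisfying $(ab)'=a'b+ab'$. A constant is an element $c$ with $c'=0$. Throughout, all differential fields have characteristic $0$ and all have the same fixed field of constants (so no extension of differential fields contains new constants). A linear differential operator $L=a_nD^n+\dots+a_0$ over $K$ acts on elements $y$ of differential extensions of $K$ by $L(y)=a_ny^{(n)}+\dots+a_0y$; the product $\circ$ of operators is composition. An element $y$ of a differential extension of $K$ is a special transcendental element over $K$ if $y$ is transcendental over $K$ and $y'=\mathcal R(y)$, where $\mathcal R$ is a rational function over $K$ representable in the form $\mathcal R=\frac{yP}{Q}$ with $P,Q\in K[y]$ and the polynomials $yP$ and $Q$ relatively prime. An extension $K\subset E$ of differential fields is admissible if there is a chain of differential fields $K=K_0\subset\dots\subset K_r=E$ such that each $K_{i+1}$ is obtained from $K_i$ by adjoining a special transcendental element over $K_i$. "All solutions belong to $E$" means that $E$ contains $n$ solutions of $L(y)=0$ that are linearly independent over the field of constants. *)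

theory Defs
  imports "HOL-Algebra.Algebra"
begin

section \<open>Differential fields and their extensions\<close>

record 'a differential_ring = "'a ring" +
  der :: "'a \<Rightarrow> 'a" ("\<partial>\<index>")

locale differential_field = field K
  for K :: "('a, 'm) differential_ring_scheme" (structure) +
  assumes der_closed: "a \<in> carrier K \<Longrightarrow> \<partial> a \<in> carrier K"
    and der_add: "\<lbrakk> a \<in> carrier K; b \<in> carrier K \<rbrakk> \<Longrightarrow> \<partial> (a \<oplus> b) = \<partial> a \<oplus> \<partial> b"
    and der_mult: "\<lbrakk> a \<in> carrier K; b \<in> carrier K \<rbrakk> \<Longrightarrow>
      \<partial> (a \<otimes> b) = (\<partial> a \<otimes> b) \<oplus> (a \<otimes> \<partial> b)"
    and char_zero: "0 < (m :: nat) \<Longrightarrow> [m] \<cdot> \<one> \<noteq> \<zero>"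

definition constants :: "('a, 'm) differential_ring_scheme \<Rightarrow> 'a set"
  where "constants K = {c \<in> carrier K. \<partial>\<^bsub>K\<^esub> c = \<zero>\<^bsub>K\<^esub>}"

text \<open>
  An extension of \<open>K\<close> is a differential field \<open>E\<close> with a (necessarily injective) homomorphism
  \<open>\<phi>\<close> identifying \<open>K\<close> with a differential subfield of \<open>E\<close>. The standing convention that all
  differential fields have the same constants is part of the notion.

  HOL cannot quantify existentially over types, so ``some extension of \<open>K\<close>'' ranges over structures
  on a fixed but arbitrary type \<open>'b\<close> that has room for a copy of \<open>K\<close>. As \<open>K\<close> is infinite,
  extensions of \<open>K\<close> generated by finitely many elements and their derivatives have the same
  cardinality as \<open>K\<close>, so such a type (for instance that of \<open>K\<close> itself) accommodates all of them up
  to isomorphism.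
\<close>

locale differential_extension =
  K: differential_field K + E: differential_field E
  for K :: "('a, 'm) differential_ring_scheme"
    and E :: "('b, 'n) differential_ring_scheme"
    and \<phi> :: "'a \<Rightarrow> 'b" +
  assumes hom: "\<phi> \<in> ring_hom K E"
    and hom_der: "a \<in> carrier K \<Longrightarrow> \<phi> (\<partial>\<^bsub>K\<^esub> a) = \<partial>\<^bsub>E\<^esub> (\<phi> a)"
    and no_new_constants: "constants E = \<phi> ` constants K"

definition differential_subfield :: "'a set \<Rightarrow> ('a, 'm) differential_ring_scheme \<Rightarrow> bool"
  where "differential_subfield F E \<longleftrightarrow> subfield F E \<and> (\<forall>x\<in>F. \<partial>\<^bsub>E\<^esub> x \<in> F)"


section \<open>Special transcendental elements and admissible extensions\<close>

definition relatively_prime :: "('a, 'm) monoid_scheme \<Rightarrow> 'a \<Rightarrow> 'a \<Rightarrow> bool"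
  where "relatively_prime M a b \<longleftrightarrow>
    (\<forall>d\<in>carrier M. d divides\<^bsub>M\<^esub> a \<longrightarrow> d divides\<^bsub>M\<^esub> b \<longrightarrow> d \<in> Units M)"

text \<open>
  Relative primality with \<open>X P\<close> forces \<open>Q \<noteq> 0\<close>, hence \<open>Q(y) \<noteq> 0\<close> for transcendental \<open>y\<close>.
\<close>

definition special_transcendental ::
    "('a, 'm) differential_ring_scheme \<Rightarrow> 'a set \<Rightarrow> 'a \<Rightarrow> bool"
  where "special_transcendental E F y \<longleftrightarrow>
    y \<in> carrier E \<and> ring.transcendental E F y \<and>
    (\<exists>P \<in> carrier (F[X]\<^bsub>E\<^esub>). \<exists>Q \<in> carrier (F[X]\<^bsub>E\<^esub>).
       relatively_prime (F[X]\<^bsub>E\<^esub>) (X\<^bsub>E\<^esub> \<otimes>\<^bsub>F[X]\<^bsub>E\<^esub>\<^esub> P) Q \<and>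
       \<partial>\<^bsub>E\<^esub> y = (y \<otimes>\<^bsub>E\<^esub> ring.eval E P y) \<otimes>\<^bsub>E\<^esub> inv\<^bsub>E\<^esub> (ring.eval E Q y))"

definition admissible_extension ::
    "('a, 'm) differential_ring_scheme \<Rightarrow> ('b, 'n) differential_ring_scheme \<Rightarrow> ('a \<Rightarrow> 'b) \<Rightarrow> bool"
  where "admissible_extension K E \<phi> \<longleftrightarrow>
    differential_extension K E \<phi> \<and>
    (\<exists>r :: nat. \<exists>F :: nat \<Rightarrow> 'b set.
       F 0 = \<phi> ` carrier K \<and> F r = carrier E \<and>
       (\<forall>i\<le>r. differential_subfield (F i) E) \<and>
       (\<forall>i<r. \<exists>y. special_transcendental E (F i) y \<and>
          F (Suc i) = generate_field E (insert y (F i))))"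


section \<open>Linear differential operators\<close>

text \<open>
  The operator \<open>\<Sum>i. A i D^i\<close> is represented by its finitely supported coefficient sequence \<open>A\<close>.
\<close>

definition diffop_of_order ::
    "('a, 'm) differential_ring_scheme \<Rightarrow> nat \<Rightarrow> (nat \<Rightarrow> 'a) \<Rightarrow> bool"
  where "diffop_of_order K n A \<longleftrightarrow>
    (\<forall>i. A i \<in> carrier K) \<and> A n \<noteq> \<zero>\<^bsub>K\<^esub> \<and> (\<forall>i>n. A i = \<zero>\<^bsub>K\<^esub>)"

definition diffop_apply ::
    "('a, 'm) differential_ring_scheme \<Rightarrow> (nat \<Rightarrow> 'a) \<Rightarrow> 'a \<Rightarrow> 'a"
  where "diffop_apply K A y =
    (\<Oplus>\<^bsub>K\<^esub> i \<in> {i. A i \<noteq> \<zero>\<^bsub>K\<^esub>}. A i \<otimes>\<^bsub>K\<^esub> (der K ^^ i) y)"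

text \<open>
  Composition from the left with \<open>D\<close>, by \<open>D \<circ> b D^k = b' D^k + b D^(k+1)\<close>.
\<close>

definition D_comp ::
    "('a, 'm) differential_ring_scheme \<Rightarrow> (nat \<Rightarrow> 'a) \<Rightarrow> nat \<Rightarrow> 'a"
  where "D_comp K B k =
    \<partial>\<^bsub>K\<^esub> (B k) \<oplus>\<^bsub>K\<^esub> (case k of 0 \<Rightarrow> \<zero>\<^bsub>K\<^esub> | Suc j \<Rightarrow> B j)"

text \<open>
  Composition is \<open>A \<circ> B = \<Sum>i. A i (D^i \<circ> B)\<close>; see \<open>diffop_apply_comp\<close> below.
\<close>

definition diffop_comp ::
    "('a, 'm) differential_ring_scheme \<Rightarrow> (nat \<Rightarrow> 'a) \<Rightarrow> (nat \<Rightarrow> 'a) \<Rightarrow> nat \<Rightarrow> 'a"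
  where "diffop_comp K A B k =
    (\<Oplus>\<^bsub>K\<^esub> i \<in> {i. A i \<noteq> \<zero>\<^bsub>K\<^esub>}. A i \<otimes>\<^bsub>K\<^esub> (D_comp K ^^ i) B k)"

definition D_minus :: "('a, 'm) differential_ring_scheme \<Rightarrow> 'a \<Rightarrow> nat \<Rightarrow> 'a"
  where "D_minus K p k =
    (if k = 0 then \<ominus>\<^bsub>K\<^esub> p else if k = 1 then \<one>\<^bsub>K\<^esub> else \<zero>\<^bsub>K\<^esub>)"

text \<open>\<open>D_minus_prod K p n\<close> is \<open>(D - p n) \<circ> \<dots> \<circ> (D - p 1)\<close>.\<close>

primrec D_minus_prod ::
    "('a, 'm) differential_ring_scheme \<Rightarrow> (nat \<Rightarrow> 'a) \<Rightarrow> nat \<Rightarrow> nat \<Rightarrow> 'a"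
  where
    "D_minus_prod K p 0 = (\<lambda>k. if k = 0 then \<one>\<^bsub>K\<^esub> else \<zero>\<^bsub>K\<^esub>)"
  | "D_minus_prod K p (Suc i) = diffop_comp K (D_minus K (p (Suc i))) (D_minus_prod K p i)"

definition contains_all_solutions ::
    "('b, 'n) differential_ring_scheme \<Rightarrow> ('a \<Rightarrow> 'b) \<Rightarrow> nat \<Rightarrow> (nat \<Rightarrow> 'a) \<Rightarrow> bool"
  where "contains_all_solutions E \<phi> n L \<longleftrightarrow>
    (\<exists>ys. length ys = n \<and> ring.independent E (constants E) ys \<and>
       (\<forall>y \<in> set ys. y \<in> carrier E \<and> diffop_apply E (\<phi> \<circ> L) y = \<zero>\<^bsub>E\<^esub>))"

context differential_field
begin

lemma der_zero: "\<partial> \<zero> = \<zero>"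
  using der_add[of \<zero> \<zero>] der_closed[of \<zero>] by (metis add.l_cancel_one' l_zero zero_closed)

lemma der_funpow_closed: "y \<in> carrier K \<Longrightarrow> (der K ^^ i) y \<in> carrier K"
  by (induction i) (auto intro: der_closed)

lemma der_finsum:
  assumes "finite S" "f \<in> S \<rightarrow> carrier K"
  shows "\<partial> (\<Oplus>i\<in>S. f i) = (\<Oplus>i\<in>S. \<partial> (f i))"
  using assms
proof (induction S rule: finite_induct)
  case empty
  then show ?case by (simp add: der_zero)
next
  case (insert x S)
  have "(\<lambda>i. \<partial> (f i)) \<in> S \<rightarrow> carrier K" "\<partial> (f x) \<in> carrier K"
    using insert.prems by (auto intro: der_closed)
  with insert show ?case by (simp add: der_add)
qed

lemma finsum_swap:
  assumes "finite S" "finite T" "\<And>i j. f i j \<in> carrier K"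
  shows "(\<Oplus>i\<in>S. \<Oplus>j\<in>T. f i j) = (\<Oplus>j\<in>T. \<Oplus>i\<in>S. f i j)"
  using assms(1)
proof (induction S rule: finite_induct)
  case empty
  then show ?case by simp
next
  case (insert x S)
  have "(\<Oplus>i\<in>insert x S. \<Oplus>j\<in>T. f i j) = (\<Oplus>j\<in>T. f x j) \<oplus> (\<Oplus>j\<in>T. \<Oplus>i\<in>S. f i j)"
    using insert assms(3) by simp
  also have "\<dots> = (\<Oplus>j\<in>T. f x j \<oplus> (\<Oplus>i\<in>S. f i j))"
    using assms(3) by (intro finsum_addf[symmetric]) auto
  finally show ?case
    using insert assms(3) by simp
qed

lemma diffop_apply_eq:
  assumes "A \<in> UNIV \<rightarrow> carrier K" "\<forall>i>n. A i = \<zero>" "y \<in> carrier K"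
  shows "diffop_apply K A y = (\<Oplus>i\<in>{..n}. A i \<otimes> (der K ^^ i) y)"
  unfolding diffop_apply_def
  using assms der_funpow_closed[OF assms(3)]
  by (intro add.finprod_mono_neutral_cong_left) (auto simp: Pi_iff not_less[symmetric])

lemma diffop_comp_eq:
  assumes "A \<in> UNIV \<rightarrow> carrier K" "\<forall>i>n. A i = \<zero>" "\<And>i k. (D_comp K ^^ i) B k \<in> carrier K"
  shows "diffop_comp K A B k = (\<Oplus>i\<in>{..n}. A i \<otimes> (D_comp K ^^ i) B k)"
  unfolding diffop_comp_def
  using assms
  by (intro add.finprod_mono_neutral_cong_left) (auto simp: Pi_iff not_less[symmetric])

lemma diffop_apply_D_comp:
  assumes B: "B \<in> UNIV \<rightarrow> carrier K" "\<forall>i>n. B i = \<zero>" and y: "y \<in> carrier K"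
  shows "D_comp K B \<in> UNIV \<rightarrow> carrier K" "\<forall>i>Suc n. D_comp K B i = \<zero>"
    "diffop_apply K (D_comp K B) y = \<partial> (diffop_apply K B y)"
proof -
  show 1: "D_comp K B \<in> UNIV \<rightarrow> carrier K"
    using B(1) by (auto simp: D_comp_def Pi_iff intro!: der_closed split: nat.split)
  show 2: "\<forall>i>Suc n. D_comp K B i = \<zero>"
    using B(2) by (auto simp: D_comp_def der_zero split: nat.split)
  have [simp]: "B i \<in> carrier K" "\<partial> (B i) \<in> carrier K" "(der K ^^ i) y \<in> carrier K"
      "\<partial> ((der K ^^ i) y) \<in> carrier K" for i
    using B(1) der_closed der_funpow_closed[OF y] by auto
  have "diffop_apply K (D_comp K B) y =
      (\<Oplus>i\<in>{..Suc n}. (\<partial> (B i) \<otimes> (der K ^^ i) y) \<oplus>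
        ((case i of 0 \<Rightarrow> \<zero> | Suc j \<Rightarrow> B j) \<otimes> (der K ^^ i) y))"
    unfolding diffop_apply_eq[OF 1 2 y]
    by (intro finsum_cong') (auto simp: D_comp_def l_distr split: nat.split)
  also have "\<dots> = (\<Oplus>i\<in>{..Suc n}. \<partial> (B i) \<otimes> (der K ^^ i) y) \<oplus>
      (\<Oplus>i\<in>{..Suc n}. (case i of 0 \<Rightarrow> \<zero> | Suc j \<Rightarrow> B j) \<otimes> (der K ^^ i) y)"
    by (intro finsum_addf) (auto split: nat.split)
  also have "(\<Oplus>i\<in>{..Suc n}. \<partial> (B i) \<otimes> (der K ^^ i) y) = (\<Oplus>i\<in>{..n}. \<partial> (B i) \<otimes> (der K ^^ i) y)"
    using B(2) finsum_Suc[of "\<lambda>i. \<partial> (B i) \<otimes> (der K ^^ i) y" n] der_zero by (simp add: Pi_iff)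
  also have "(\<Oplus>i\<in>{..Suc n}. (case i of 0 \<Rightarrow> \<zero> | Suc j \<Rightarrow> B j) \<otimes> (der K ^^ i) y) =
      (\<Oplus>i\<in>{..n}. B i \<otimes> (der K ^^ Suc i) y)"
    by (subst finsum_Suc2) (auto simp: Pi_iff y split: nat.split)
  also have "(\<Oplus>i\<in>{..n}. \<partial> (B i) \<otimes> (der K ^^ i) y) \<oplus> (\<Oplus>i\<in>{..n}. B i \<otimes> (der K ^^ Suc i) y) =
      (\<Oplus>i\<in>{..n}. (\<partial> (B i) \<otimes> (der K ^^ i) y) \<oplus> (B i \<otimes> (der K ^^ Suc i) y))"
    by (intro finsum_addf[symmetric]) auto
  also have "\<dots> = (\<Oplus>i\<in>{..n}. \<partial> (B i \<otimes> (der K ^^ i) y))"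
    by (intro finsum_cong') (auto simp: der_mult)
  also have "\<dots> = \<partial> (diffop_apply K B y)"
    unfolding diffop_apply_eq[OF B y] by (intro der_finsum[symmetric]) auto
  finally show "diffop_apply K (D_comp K B) y = \<partial> (diffop_apply K B y)" .
qed

lemma diffop_apply_D_comp_funpow:
  assumes B: "B \<in> UNIV \<rightarrow> carrier K" "\<forall>i>n. B i = \<zero>" and y: "y \<in> carrier K"
  shows "(D_comp K ^^ j) B \<in> UNIV \<rightarrow> carrier K \<and> (\<forall>i>n + j. (D_comp K ^^ j) B i = \<zero>) \<and>
    diffop_apply K ((D_comp K ^^ j) B) y = (der K ^^ j) (diffop_apply K B y)"
proof (induction j)
  case 0
  then show ?case using B by simp
next
  case (Suc j)
  then show ?case
    using diffop_apply_D_comp[of "(D_comp K ^^ j) B" "n + j" y] y by simp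
qed

lemma diffop_apply_comp:
  assumes A: "A \<in> UNIV \<rightarrow> carrier K" "\<forall>i>m. A i = \<zero>"
    and B: "B \<in> UNIV \<rightarrow> carrier K" "\<forall>i>n. B i = \<zero>" and y: "y \<in> carrier K"
  shows "diffop_apply K (diffop_comp K A B) y = diffop_apply K A (diffop_apply K B y)"
proof -
  let ?S = "\<lambda>i. (D_comp K ^^ i) B"
  have S: "?S i k \<in> carrier K" "n + i < k \<Longrightarrow> ?S i k = \<zero>" for i k
    using diffop_apply_D_comp_funpow[OF B y, of i] by auto
  have [simp]: "A i \<in> carrier K" "(der K ^^ i) y \<in> carrier K" "?S i k \<in> carrier K" for i k
    using A(1) der_funpow_closed[OF y] S by auto
  have By: "diffop_apply K B y \<in> carrier K"
    unfolding diffop_apply_eq[OF B y] using B(1) der_funpow_closed[OF y]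
    by (intro finsum_closed) (auto simp: Pi_iff)
  have c: "diffop_comp K A B k = (\<Oplus>i\<in>{..m}. A i \<otimes> ?S i k)" for k
    by (rule diffop_comp_eq[OF A]) simp
  have 1: "diffop_comp K A B \<in> UNIV \<rightarrow> carrier K"
    by (auto simp: c intro!: finsum_closed)
  have 2: "\<forall>k>n + m. diffop_comp K A B k = \<zero>"
    by (auto simp: c S(2) intro!: add.finprod_one_eqI)
  have s: "(\<Oplus>k\<in>{..n + m}. ?S i k \<otimes> (der K ^^ k) y) = (der K ^^ i) (diffop_apply K B y)"
    if "i \<le> m" for i
  proof -
    have "(\<Oplus>k\<in>{..n + m}. ?S i k \<otimes> (der K ^^ k) y) = diffop_apply K (?S i) y"
      using that by (intro diffop_apply_eq[symmetric] y) (auto simp: S(2))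
    then show ?thesis using diffop_apply_D_comp_funpow[OF B y, of i] by simp
  qed
  have "diffop_apply K (diffop_comp K A B) y =
      (\<Oplus>k\<in>{..n + m}. \<Oplus>i\<in>{..m}. A i \<otimes> ?S i k \<otimes> (der K ^^ k) y)"
    unfolding diffop_apply_eq[OF 1 2 y] c
    by (intro finsum_cong') (auto simp: finsum_ldistr intro!: finsum_closed)
  also have "\<dots> = (\<Oplus>i\<in>{..m}. \<Oplus>k\<in>{..n + m}. A i \<otimes> ?S i k \<otimes> (der K ^^ k) y)"
    by (intro finsum_swap) auto
  also have "\<dots> = (\<Oplus>i\<in>{..m}. A i \<otimes> (\<Oplus>k\<in>{..n + m}. ?S i k \<otimes> (der K ^^ k) y))"
    by (intro finsum_cong') (auto simp: finsum_rdistr m_assoc intro!: finsum_closed)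
  also have "\<dots> = diffop_apply K A (diffop_apply K B y)"
    unfolding diffop_apply_eq[OF A By] using der_funpow_closed[OF By]
    by (intro finsum_cong') (auto simp: s)
  finally show ?thesis .
qed

end


section \<open>Exponentials of integrals and the group they generate\<close>

definition exponentials_of_integrals ::
    "('a, 'm) differential_ring_scheme \<Rightarrow> ('b, 'n) differential_ring_scheme \<Rightarrow> ('a \<Rightarrow> 'b) \<Rightarrow>
     nat \<Rightarrow> (nat \<Rightarrow> 'b) \<Rightarrow> (nat \<Rightarrow> 'a) \<Rightarrow> bool"
  where "exponentials_of_integrals K F \<phi> n z p \<longleftrightarrow>
    (\<forall>i\<in>{1..n}. z i \<in> carrier F \<and> z i \<noteq> \<zero>\<^bsub>F\<^esub> \<and> p i \<in> carrier K \<and>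
       \<partial>\<^bsub>F\<^esub> (z i) = \<phi> (p i) \<otimes>\<^bsub>F\<^esub> z i)"

definition torsion_free :: "('a, 'm) monoid_scheme \<Rightarrow> bool"
  where "torsion_free G \<longleftrightarrow>
    (\<forall>x\<in>carrier G. \<forall>m::nat. 0 < m \<longrightarrow> x [^]\<^bsub>G\<^esub> m = \<one>\<^bsub>G\<^esub> \<longrightarrow> x = \<one>\<^bsub>G\<^esub>)"

end

theory Submission
  imports Defs
begin

text \<open>
  A special transcendental element \<open>w\<close> over \<open>F\<close> gives a place of \<open>F(w)\<close> at \<open>w = 0\<close>, with residue field \<open>F\<close>,
  whose valuation ring is closed under the derivation and on which taking residues is a differential
  homomorphism. If \<open>L\<close> has a solution \<open>u\<close> in an admissible extension, its logarithmic derivative solves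
  the Riccati equation of \<open>L\<close>; such a solution has no pole at \<open>w = 0\<close>, so its residue is a solution one
  step lower in the chain. Descending to \<open>K\<close>, one gets \<open>p \<in> K\<close> such that \<open>D - p\<close> divides \<open>L\<close> on the right.
  Counting solutions shows that the corresponding exponentials \<open>z\<^sub>i\<close> lie in the extension. If \<open>g\<close> is a
  product of powers of them with \<open>g\<^sup>m \<in> K\<close>, then \<open>g\<close> is a constant times its residue, so \<open>g \<in> K\<close>.

  Conversely, a minimal set of generators of \<open>G\<close> modulo \<open>G\<^sub>0\<close> is free because \<open>G/G\<^sub>0\<close> is torsion free, hence
  algebraically independent over \<open>K\<close> by the Kolchin-Ostrowski theorem. Each generator \<open>t\<close> is special
  because \<open>t' = q t\<close>. The remaining solutions are found by variation of constants: an integral \<open>y\<close> of \<open>f\<close>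
  without antiderivative in the field is adjoined through \<open>w = 1/y\<close>, which is special because
  \<open>w' = - f w\<^sup>2\<close>.
\<close>

section \<open>Differential fields\<close>

text \<open>An integral \<open>y\<close> of \<open>f \<noteq> 0\<close> is not itself special: in
  any representation \<open>f = y P / Q\<close> the polynomial \<open>Q\<close> is divisible by
  \<open>y\<close>, against relative primality with \<open>y P\<close>. That same primality gives
  \<open>Q(0) \<noteq> 0\<close>, hence \<open>w' / w\<close> is regular at \<open>w = 0\<close>;
  this is the only reason why the place is compatible with the derivation.

  The count of solutions has to be finer than one per factor: a factor \<open>D - p\<close>
  contributes only if \<open>z' = p z\<close> has a nonzero solution in the field at hand. This
  refinement is what puts all exponentials into \<open>E\<close>.

  In the converse, each new field must have no new constants, which is why an integral is adjoined
  only if none is present, and must live in the prescribed type \<open>'b\<close>. The second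
  condition is met by coding polynomials and their fractions back into the infinite carrier of the
  field being extended. As every integration changes the field, solutions, independence and
  operators are carried along embeddings, and the towers are limited to two kinds of steps that are
  stable under transport and composition.\<close>

context differential_field
begin

lemma eq_add_imp:
  assumes "a = b \<oplus> c" "b \<in> carrier K" "c \<in> carrier K"
  shows "c = a \<ominus> b"
  unfolding assms(1) using assms(2,3) by algebra

lemma der_one: "\<partial> \<one> = \<zero>"
proof -
  have "\<partial> \<one> \<oplus> \<zero> = \<partial> \<one> \<oplus> \<partial> \<one>"
    using der_mult[of \<one> \<one>] der_closed[of \<one>] by simp
  then show ?thesis
    using der_closed[of \<one>] by (metis add.l_cancel one_closed zero_closed)
qed

lemma der_a_inv:
  assumes "a \<in> carrier K"
  shows "\<partial> (\<ominus> a) = \<ominus> \<partial> a"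
proof -
  have "\<partial> a \<oplus> \<partial> (\<ominus> a) = \<zero>"
    using der_add[of a "\<ominus> a"] assms by (simp add: r_neg der_zero)
  then show ?thesis
    using assms der_closed by (metis a_inv_closed add.inv_equality add.m_comm)
qed

lemma der_minus:
  "a \<in> carrier K \<Longrightarrow> b \<in> carrier K \<Longrightarrow> \<partial> (a \<ominus> b) = \<partial> a \<ominus> \<partial> b"
  by (simp add: minus_eq der_add der_a_inv)

lemma der_pow:
  assumes "a \<in> carrier K"
  shows "\<partial> (a [^] Suc n) = [Suc n] \<cdot> (a [^] n \<otimes> \<partial> a)"
proof (induction n)
  case 0
  then show ?case using assms der_closed by simp
next
  case (Suc n)
  have c: "a \<in> carrier K" "\<partial> a \<in> carrier K" "a [^] n \<in> carrier K"
      "[Suc n] \<cdot> (a [^] n \<otimes> \<partial> a) \<in> carrier K"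
    using assms der_closed by auto
  have "\<partial> (a [^] Suc (Suc n)) = \<partial> (a [^] Suc n \<otimes> a)" by simp
  also have "\<dots> = [Suc n] \<cdot> (a [^] n \<otimes> \<partial> a) \<otimes> a \<oplus> a [^] Suc n \<otimes> \<partial> a"
    using Suc c by (subst der_mult) auto
  also have "[Suc n] \<cdot> (a [^] n \<otimes> \<partial> a) \<otimes> a = [Suc n] \<cdot> (a [^] Suc n \<otimes> \<partial> a)"
    using c by (subst add_pow_ldistr) (auto simp add: m_assoc m_comm[of "\<partial> a" a] simp del: add.nat_pow_Suc)
  finally show ?case using c by (simp add: add.nat_pow_Suc)
qed

lemma add_pow_eq_zero:
  assumes "0 < (m::nat)" "a \<in> carrier K" "[m] \<cdot> a = \<zero>"
  shows "a = \<zero>"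
proof -
  have "([m] \<cdot> \<one>) \<otimes> a = \<zero>"
    using assms by (simp add: add_pow_ldistr)
  then show ?thesis
    using char_zero[OF assms(1)] assms(2) integral[of "[m] \<cdot> \<one>" a] by auto
qed

lemma inverse_facts:
  assumes "a \<in> carrier K" "a \<noteq> \<zero>"
  shows "inv a \<in> carrier K" "a \<otimes> inv a = \<one>" "inv a \<otimes> a = \<one>" "inv a \<noteq> \<zero>"
proof -
  have a: "a \<in> Units K" using assms by (simp add: field_Units)
  show "inv a \<in> carrier K" "a \<otimes> inv a = \<one>" "inv a \<otimes> a = \<one>" using a by auto
  then show "inv a \<noteq> \<zero>" using assms by (metis r_null zero_not_one)
qed

lemma pow_nonzero: "a \<in> carrier K \<Longrightarrow> a \<noteq> \<zero> \<Longrightarrow> a [^] (m::nat) \<noteq> \<zero>"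
  by (induction m) (auto simp: integral_iff)

text \<open>Differentiating \<open>a^m = 1\<close> gives \<open>m a^(m-1) a' = 0\<close>, and in
  characteristic zero both \<open>m\<close> and \<open>a\<close> can be cancelled. Roots of unity
  are thus constants, which is how roots are brought down to the base field.\<close>

lemma der_eq_zero_of_pow_one:
  assumes "a \<in> carrier K" "0 < (m::nat)" "a [^] m = \<one>"
  shows "\<partial> a = \<zero>"
proof -
  obtain n where m: "m = Suc n" using assms(2) by (cases m) auto
  have "a \<noteq> \<zero>" using assms(3) m assms(1) by auto
  have *: "[Suc n] \<cdot> (a [^] n \<otimes> \<partial> a) = \<zero>"
    using der_pow[OF assms(1), of n] assms(3) m by (simp add: der_one)
  have "a [^] n \<otimes> \<partial> a \<in> carrier K" using assms(1) der_closed by simp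
  then have "a [^] n \<otimes> \<partial> a = \<zero>"
    by (rule add_pow_eq_zero[OF zero_less_Suc _ *])
  then show ?thesis
    using integral assms(1) pow_nonzero[OF assms(1) \<open>a \<noteq> \<zero>\<close>, of n] der_closed
    by (meson nat_pow_closed)
qed

lemma cross_mult_divide:
  assumes "a \<in> carrier K" "b \<in> carrier K" "x \<in> carrier K" "b \<noteq> \<zero>" "x \<otimes> b = a"
  shows "x = a \<otimes> inv b"
  using inverse_facts[OF assms(2,4)] assms by (auto simp: m_assoc)

text \<open>Equal logarithmic derivatives leave a constant quotient: the product rule is applied to
  \<open>(a / b) b = a\<close>, which avoids the quotient rule and allows \<open>a\<close> to
  vanish.\<close>

lemma der_quotient_zero:
  assumes "a \<in> carrier K" "b \<in> carrier K" "s \<in> carrier K" "b \<noteq> \<zero>"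
    and "\<partial> a = s \<otimes> a" "\<partial> b = s \<otimes> b"
  shows "a \<otimes> inv b \<in> constants K"
proof -
  let ?q = "a \<otimes> inv b"
  have q: "?q \<in> carrier K" "?q \<otimes> b = a"
    using assms inverse_facts[OF assms(2,4)] by (auto simp: m_assoc)
  have "\<partial> a = (\<partial> ?q \<otimes> b) \<oplus> (?q \<otimes> \<partial> b)"
    using der_mult[OF q(1) assms(2)] q(2) by simp
  also have "?q \<otimes> \<partial> b = s \<otimes> a"
    using assms q by (metis m_assoc m_comm)
  finally have "\<zero> \<oplus> s \<otimes> a = (\<partial> ?q \<otimes> b) \<oplus> s \<otimes> a"
    using assms by simp
  then have "\<partial> ?q \<otimes> b = \<zero>"
    using assms q der_closed by (metis add.r_cancel m_closed zero_closed)
  then show ?thesis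
    using integral q assms der_closed by (auto simp: constants_def)
qed

text \<open>The order of these closure facts matters, since later proofs select them by position:
  derivation at 4, negatives at 7, sums at 8, products at 9, inverses at 10, natural powers and
  multiples at 11 and 12.\<close>

lemma differential_subfieldD:
  assumes "differential_subfield F K"
  shows "subfield F K" "subring F K" "F \<subseteq> carrier K" "\<And>x. x \<in> F \<Longrightarrow> \<partial> x \<in> F"
    "\<zero> \<in> F" "\<one> \<in> F" "\<And>x. x \<in> F \<Longrightarrow> \<ominus> x \<in> F" "\<And>x y. x \<in> F \<Longrightarrow> y \<in> F \<Longrightarrow> x \<oplus> y \<in> F"
    "\<And>x y. x \<in> F \<Longrightarrow> y \<in> F \<Longrightarrow> x \<otimes> y \<in> F" "\<And>x. x \<in> F \<Longrightarrow> x \<noteq> \<zero> \<Longrightarrow> inv x \<in> F"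
    "\<And>x m. x \<in> F \<Longrightarrow> x [^] (m::nat) \<in> F" "\<And>x m. x \<in> F \<Longrightarrow> [(m::nat)] \<cdot> x \<in> F"
proof -
  show f: "subfield F K" using assms by (simp add: differential_subfield_def)
  show s: "subring F K" using subfieldE(1)[OF f] .
  show "F \<subseteq> carrier K" "\<And>x. x \<in> F \<Longrightarrow> \<ominus> x \<in> F" "\<And>x y. x \<in> F \<Longrightarrow> y \<in> F \<Longrightarrow> x \<otimes> y \<in> F"
    and z: "\<zero> \<in> F" "\<one> \<in> F"
    and a: "\<And>x y. x \<in> F \<Longrightarrow> y \<in> F \<Longrightarrow> x \<oplus> y \<in> F" 
    using subringE[OF s] by auto
  then show "x [^] (m::nat) \<in> F" if "x \<in> F" for x m
    using that by (induction m) auto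
  show "\<And>x m. x \<in> F \<Longrightarrow> [(m::nat)] \<cdot> x \<in> F"
  proof -
    fix x m assume "x \<in> F" then show "[(m::nat)] \<cdot> x \<in> F"
      by (induction m) (auto simp: z a)
  qed
  show "\<And>x. x \<in> F \<Longrightarrow> \<partial> x \<in> F" using assms by (simp add: differential_subfield_def)
  show "\<And>x. x \<in> F \<Longrightarrow> x \<noteq> \<zero> \<Longrightarrow> inv x \<in> F" using subfield_m_inv[OF f] by auto
qed

end


section \<open>Places\<close>

text \<open>
  \<open>V\<close> plays the role of a valuation ring of \<open>F(w)\<close> over \<open>F\<close> with uniformizer \<open>w\<close>, closed under the
  derivation. For a special transcendental element \<open>w\<close> it is the localization of \<open>F[w]\<close> at \<open>w = 0\<close>.
\<close>

locale differential_place = differential_field K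
  for K :: "('a, 'm) differential_ring_scheme" (structure) +
  fixes F V :: "'a set" and w :: 'a
  assumes F: "differential_subfield F K"
    and V: "subring V K"
    and F_subset_V: "F \<subseteq> V"
    and w_in_V: "w \<in> V"
    and w_nonzero: "w \<noteq> \<zero>"
    and residue_ex: "x \<in> V \<Longrightarrow> \<exists>c\<in>F. \<exists>v\<in>V. x = c \<oplus> w \<otimes> v"
    and uniformizer_inter: "v \<in> V \<Longrightarrow> w \<otimes> v \<in> F \<Longrightarrow> v = \<zero>"
    and der_in_V: "x \<in> V \<Longrightarrow> \<partial> x \<in> V"
    and der_w: "\<exists>r\<in>V. \<partial> w = w \<otimes> r"
    and factorization_ex: "x \<in> generate_field K (insert w F) \<Longrightarrow> x \<noteq> \<zero> \<Longrightarrow>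
      \<exists>u\<in>V. \<exists>c\<in>F. \<exists>v\<in>V. \<exists>e::nat. c \<noteq> \<zero> \<and> u = c \<oplus> w \<otimes> v \<and> (x = w [^] e \<otimes> u \<or> x \<otimes> w [^] e = u)"
begin

text \<open>A relation rather than a function, so that the residue of a composite expression is
  found by introduction rules alone; \<open>residue_unique\<close> makes it single-valued.\<close>

definition residue :: "'a \<Rightarrow> 'a \<Rightarrow> bool"
  where "residue x c \<longleftrightarrow> c \<in> F \<and> (\<exists>v\<in>V. x = c \<oplus> w \<otimes> v)"

lemmas F_facts = differential_subfieldD[OF F]

lemma V_facts:
  "\<zero> \<in> V" "\<one> \<in> V" "\<And>x. x \<in> V \<Longrightarrow> x \<in> carrier K" "\<And>x. x \<in> V \<Longrightarrow> \<ominus> x \<in> V"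
  "\<And>x y. x \<in> V \<Longrightarrow> y \<in> V \<Longrightarrow> x \<oplus> y \<in> V" "\<And>x y. x \<in> V \<Longrightarrow> y \<in> V \<Longrightarrow> x \<otimes> y \<in> V"
  using subringE[OF V] by auto

lemma V_pow: "x \<in> V \<Longrightarrow> x [^] (m::nat) \<in> V"
  by (induction m) (auto intro: V_facts)

lemma F_carrier: "x \<in> F \<Longrightarrow> x \<in> carrier K"
  using F_facts(3) by auto

lemma residueI: "c \<in> F \<Longrightarrow> v \<in> V \<Longrightarrow> x = c \<oplus> w \<otimes> v \<Longrightarrow> residue x c"
  by (auto simp: residue_def)

lemma residueE:
  assumes "residue x c"
  obtains v where "c \<in> F" "v \<in> V" "x = c \<oplus> w \<otimes> v"
  using assms by (auto simp: residue_def)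

lemma residue_closed:
  assumes "residue x c"
  shows "c \<in> F" "c \<in> carrier K" "x \<in> V" "x \<in> carrier K"
  using assms F_subset_V V_facts w_in_V F_carrier by (auto elim!: residueE)

lemma ex_residue: "x \<in> V \<Longrightarrow> \<exists>c. residue x c"
  unfolding residue_def using residue_ex by blast

lemma residue_const: "c \<in> F \<Longrightarrow> residue c c"
  by (rule residueI[OF _ V_facts(1)]) (use F_carrier w_in_V V_facts in auto)

lemma residue_uniformizer: "v \<in> V \<Longrightarrow> residue (w \<otimes> v) \<zero>"
  by (rule residueI) (use F_facts w_in_V V_facts in auto)

lemma residue_add:
  assumes "residue x c" "residue y d"
  shows "residue (x \<oplus> y) (c \<oplus> d)"
proof -
  obtain u where u: "c \<in> F" "u \<in> V" "x = c \<oplus> w \<otimes> u" using assms(1) by (rule residueE)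
  obtain v where v: "d \<in> F" "v \<in> V" "y = d \<oplus> w \<otimes> v" using assms(2) by (rule residueE)
  have [simp]: "c \<in> carrier K" "d \<in> carrier K" "u \<in> carrier K" "v \<in> carrier K" "w \<in> carrier K"
    using u v F_carrier V_facts w_in_V by auto
  have "x \<oplus> y = (c \<oplus> d) \<oplus> w \<otimes> (u \<oplus> v)" unfolding u v by (simp add: r_distr a_ac)
  then show ?thesis using u v F_facts V_facts by (intro residueI[of _ "u \<oplus> v"]) auto
qed

lemma residue_mult:
  assumes "residue x c" "residue y d"
  shows "residue (x \<otimes> y) (c \<otimes> d)"
proof -
  obtain u where u: "c \<in> F" "u \<in> V" "x = c \<oplus> w \<otimes> u" using assms(1) by (rule residueE)
  obtain v where v: "d \<in> F" "v \<in> V" "y = d \<oplus> w \<otimes> v" using assms(2) by (rule residueE)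
  have *: "c \<in> carrier K" "d \<in> carrier K" "u \<in> carrier K" "v \<in> carrier K" "w \<in> carrier K"
    using u v F_carrier V_facts w_in_V by auto
  have "x \<otimes> y = (c \<otimes> d) \<oplus> w \<otimes> (c \<otimes> v \<oplus> u \<otimes> y)"
    unfolding u v using * by algebra
  moreover have "c \<otimes> v \<oplus> u \<otimes> y \<in> V"
    using u v F_facts V_facts residue_closed[OF assms(1)] residue_closed[OF assms(2)] F_subset_V by auto
  ultimately show ?thesis using u v F_facts by (intro residueI) auto
qed

text \<open>The difference of two candidates is both in \<open>F\<close> and of the form
  \<open>w v\<close> with \<open>v\<close> in \<open>V\<close>; only zero is, since a nonzero
  element of \<open>F\<close> cannot vanish at \<open>w = 0\<close>.\<close>

lemma residue_unique:
  assumes "residue x c" "residue x d"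
  shows "c = d"
proof -
  obtain u where u: "c \<in> F" "u \<in> V" "x = c \<oplus> w \<otimes> u" using assms(1) by (rule residueE)
  obtain v where v: "d \<in> F" "v \<in> V" "x = d \<oplus> w \<otimes> v" using assms(2) by (rule residueE)
  have *: "c \<in> carrier K" "d \<in> carrier K" "u \<in> carrier K" "v \<in> carrier K" "w \<in> carrier K"
    using u v F_carrier V_facts w_in_V by auto
  have "w \<otimes> (u \<ominus> v) = (c \<oplus> w \<otimes> u) \<ominus> (d \<oplus> w \<otimes> v) \<oplus> (d \<ominus> c)" using * by algebra
  also have "\<dots> = d \<ominus> c" using u v * by (simp add: r_neg minus_eq)
  finally have e: "w \<otimes> (u \<ominus> v) = d \<ominus> c" .
  moreover have "d \<ominus> c \<in> F" "u \<ominus> v \<in> V"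
    using u v F_facts V_facts by (auto simp: minus_eq)
  ultimately have "u \<ominus> v = \<zero>" using uniformizer_inter by auto
  then have "d \<ominus> c = \<zero>" using e * by (metis r_null)
  then show ?thesis using * by (metis r_right_minus_eq)
qed

text \<open>\<open>w'\<close> is itself a multiple of \<open>w\<close> in \<open>V\<close>, so
  differentiating the part \<open>w v\<close> produces again a multiple of \<open>w\<close>: the
  derivation acts on residues.\<close>

lemma residue_der:
  assumes "residue x c"
  shows "residue (\<partial> x) (\<partial> c)"
proof -
  obtain u where u: "c \<in> F" "u \<in> V" "x = c \<oplus> w \<otimes> u" using assms(1) by (rule residueE)
  obtain r where r: "r \<in> V" "\<partial> w = w \<otimes> r" using der_w by auto
  have *: "c \<in> carrier K" "u \<in> carrier K" "w \<in> carrier K" "r \<in> carrier K" "\<partial> u \<in> carrier K"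
      "\<partial> c \<in> carrier K"
    using u r F_carrier V_facts w_in_V der_closed by auto
  have "\<partial> x = \<partial> c \<oplus> (w \<otimes> r \<otimes> u \<oplus> w \<otimes> \<partial> u)"
    unfolding u using * r(2) by (simp add: der_add der_mult)
  also have "\<dots> = \<partial> c \<oplus> w \<otimes> (r \<otimes> u \<oplus> \<partial> u)" using * by algebra
  finally show ?thesis
    using u r F_facts V_facts der_in_V by (intro residueI) auto
qed

lemma residue_pow: "residue x c \<Longrightarrow> residue (x [^] (m::nat)) (c [^] m)"
  by (induction m) (auto intro: residue_mult residue_const F_facts)

lemma residue_finsum:
  assumes "finite S" "\<And>i. i \<in> S \<Longrightarrow> residue (f i) (g i)"
  shows "residue (\<Oplus>i\<in>S. f i) (\<Oplus>i\<in>S. g i)"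
  using assms
proof (induction S rule: finite_induct)
  case empty
  then show ?case by (simp add: residue_const F_facts)
next
  case (insert i S)
  moreover have "f \<in> insert i S \<rightarrow> carrier K" "g \<in> insert i S \<rightarrow> carrier K"
    using residue_closed[OF insert.prems] by auto
  ultimately show ?case by (simp add: residue_add)
qed

text \<open>The disjunction distinguishes the sign of the order of \<open>x\<close> at
  \<open>w = 0\<close>; a pole is expressed as \<open>x w^e = u\<close> so that all exponents stay
  natural.\<close>

lemma factorization:
  assumes "x \<in> generate_field K (insert w F)" "x \<noteq> \<zero>"
  obtains u c e where "residue u c" "c \<noteq> \<zero>" "x = w [^] (e::nat) \<otimes> u \<or> x \<otimes> w [^] e = u"
  using factorization_ex[OF assms] residueI by metis

lemma residue_w_pow: "residue (w [^] (e::nat)) (if e = 0 then \<one> else \<zero>)"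
proof (cases e)
  case 0
  then show ?thesis by (simp add: residue_const F_facts)
next
  case (Suc k)
  have "w [^] e = w \<otimes> w [^] k"
    using Suc w_in_V V_facts by (simp add: m_comm)
  then show ?thesis using Suc residue_uniformizer[OF V_pow[OF w_in_V, of k]] by simp
qed

text \<open>Elements of \<open>F(w)\<close> algebraic over \<open>F\<close> through an equation \<open>g\<^sup>m = a\<close>: the residue \<open>c\<close> of \<open>g\<close>
  satisfies the same equation, so that \<open>g / c\<close> is a root of unity, hence a constant.\<close>

lemma root_in_base_field:
  assumes g: "g \<in> generate_field K (insert w F)" and m: "0 < (m::nat)" and a: "g [^] m \<in> F"
    and constants: "constants K \<subseteq> F"
  shows "g \<in> F"
proof (cases "g = \<zero>")
  case True
  then show ?thesis using F_facts by simp
next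
  case False
  have gc: "g \<in> carrier K" and wc: "w \<in> carrier K"
    using g generate_field_in_carrier[of "insert w F"] F_facts w_in_V V_facts by auto
  obtain u c e where u: "residue u c" "c \<noteq> \<zero>" "g = w [^] (e::nat) \<otimes> u \<or> g \<otimes> w [^] e = u"
    using factorization[OF g False] by metis
  have uc: "u \<in> carrier K" "c \<in> carrier K" using residue_closed[OF u(1)] by auto
  have ra: "residue (g [^] m) (g [^] m)" using a by (rule residue_const)
  \<comment> \<open>The nonzero element \<open>g^m\<close> of \<open>F\<close> has order zero: a
    positive order would give it residue zero, and a pole would force
    \<open>c^m = 0\<close>.\<close>
  have e0: "e = 0"
  proof (rule ccontr)
    assume "e \<noteq> 0"
    then have em: "residue ((w [^] e) [^] m) \<zero>"
      using residue_w_pow[of "e * m"] m wc by (simp add: nat_pow_pow)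
    from u(3) show False
    proof
      assume "g = w [^] e \<otimes> u"
      then have "g [^] m = (w [^] e) [^] m \<otimes> u [^] m"
        using uc wc by (simp add: nat_pow_distrib)
      then have "residue (g [^] m) (\<zero> \<otimes> c [^] m)"
        using residue_mult[OF em residue_pow[OF u(1)]] by simp
      then have "g [^] m = \<zero>" using residue_unique[OF ra] uc by simp
      then show False using pow_nonzero[OF gc False, of m] by blast
    next
      assume "g \<otimes> w [^] e = u"
      then have "g [^] m \<otimes> (w [^] e) [^] m = u [^] m"
        using gc wc by (metis nat_pow_closed nat_pow_distrib)
      then have "residue (u [^] m) (g [^] m \<otimes> \<zero>)"
        using residue_mult[OF ra em] by simp
      then have "c [^] m = \<zero>" using residue_unique[OF residue_pow[OF u(1)]] gc by simp
      then show False using pow_nonzero[OF uc(2) u(2), of m] by blast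
    qed
  qed
  then have "g = u" using u(3) uc gc by auto
  then have cm: "c [^] m = g [^] m" using residue_unique[OF residue_pow[OF u(1)] ] ra by auto
  have ic: "inv c \<in> carrier K" "c \<otimes> inv c = \<one>" using inverse_facts[OF uc(2) u(2)] by auto
  have "(g \<otimes> inv c) [^] m = c [^] m \<otimes> inv c [^] m"
    using gc ic cm by (simp add: nat_pow_distrib)
  also have "\<dots> = \<one>" using ic uc by (metis nat_pow_distrib nat_pow_one)
  finally have "\<partial> (g \<otimes> inv c) = \<zero>"
    using gc ic m by (intro der_eq_zero_of_pow_one[of _ m]) auto
  then have "g \<otimes> inv c \<in> F" using constants gc ic by (auto simp: constants_def)
  then have "(g \<otimes> inv c) \<otimes> c \<in> F" using residue_closed[OF u(1)] F_facts by auto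
  moreover have "(g \<otimes> inv c) \<otimes> c = g"
    using gc uc inverse_facts[OF uc(2) u(2)] by (simp add: m_assoc)
  ultimately show ?thesis by simp
qed

text \<open>Write \<open>x = w\<^sup>e u\<close> with residue \<open>c \<noteq> 0\<close> of \<open>u\<close>; then \<open>u\<close> and \<open>c\<close> have the same logarithmic
  derivative, and \<open>u / c\<close> is a constant.\<close>

lemma exponential_in_extension:
  assumes x: "x \<in> generate_field K (insert w F)" "x \<noteq> \<zero>"
    and p: "p \<in> F" "\<partial> x = p \<otimes> x" and q: "q \<in> F" "\<partial> w = q \<otimes> w"
    and constants: "constants K \<subseteq> F"
  shows "\<exists>a\<in>F. \<exists>e::nat. a \<noteq> \<zero> \<and> (x = a \<otimes> w [^] e \<or> x \<otimes> w [^] e = a)"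
proof -
  have xc: "x \<in> carrier K" and wc: "w \<in> carrier K"
    using x generate_field_in_carrier[of "insert w F"] F_facts w_in_V V_facts by auto
  obtain u c e where u: "residue u c" "c \<noteq> \<zero>" "x = w [^] (e::nat) \<otimes> u \<or> x \<otimes> w [^] e = u"
    using factorization[OF x] by metis
  have uc: "u \<in> carrier K" "c \<in> carrier K" "c \<in> F" using residue_closed[OF u(1)] by auto
  have pc: "p \<in> carrier K" "q \<in> carrier K" using p q F_carrier by auto
  \<comment> \<open>\<open>E = e q\<close> is the logarithmic derivative of \<open>w^e\<close>; that
    of \<open>u\<close> will be \<open>p - E\<close> or \<open>p + E\<close>, in either case an
    element of \<open>F\<close> and so its own residue.\<close>
  define E where "E = [e] \<cdot> q"
  have Ec: "E \<in> F" "E \<in> carrier K" using q F_facts F_carrier unfolding E_def by auto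
  let ?t = "w [^] e"
  have tc: "?t \<in> carrier K" "?t \<noteq> \<zero>" using wc pow_nonzero w_nonzero by auto
  have dt: "\<partial> ?t = E \<otimes> ?t"
  proof (cases e)
    case 0
    then show ?thesis by (simp add: E_def der_one)
  next
    case (Suc k)
    have "\<partial> ?t = [e] \<cdot> (w [^] k \<otimes> (q \<otimes> w))"
      using Suc der_pow[OF wc] q by simp
    also have "w [^] k \<otimes> (q \<otimes> w) = q \<otimes> ?t"
      using Suc wc pc by (simp add: m_ac)
    finally show ?thesis
      unfolding E_def using add_pow_ldistr[OF pc(2) tc(1), of e] by (rule trans[OF _ sym])
  qed
  have "\<exists>s\<in>F. \<partial> u = s \<otimes> u"
    using u(3)
  proof
    assume e: "x = ?t \<otimes> u"
    have d: "\<partial> u \<in> carrier K" using der_closed uc by auto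
    have "p \<otimes> (?t \<otimes> u) = (E \<otimes> ?t) \<otimes> u \<oplus> ?t \<otimes> \<partial> u"
      using p(2) dt uc tc unfolding e by (simp add: der_mult)
    then have "?t \<otimes> \<partial> u = p \<otimes> (?t \<otimes> u) \<ominus> (E \<otimes> ?t) \<otimes> u"
      using tc uc d Ec pc by (intro eq_add_imp) auto
    also have "\<dots> = ?t \<otimes> ((p \<ominus> E) \<otimes> u)" using tc(1) uc(1) Ec(2) pc(1) by algebra
    finally have "\<partial> u = (p \<ominus> E) \<otimes> u" using tc uc d Ec pc m_lcancel[of ?t] by auto
    then show ?thesis using F_facts(7,8) p Ec by (auto simp: minus_eq)
  next
    assume e: "x \<otimes> ?t = u"
    have "\<partial> u = (p \<otimes> x) \<otimes> ?t \<oplus> x \<otimes> (E \<otimes> ?t)"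
      unfolding e[symmetric] using dt xc tc p(2) by (simp add: der_mult)
    also have "\<dots> = (p \<oplus> E) \<otimes> (x \<otimes> ?t)" using tc(1) xc Ec(2) pc(1) by algebra
    finally have "\<partial> u = (p \<oplus> E) \<otimes> u" using e by simp
    then show ?thesis using F_facts(8) p Ec by auto
  qed
  then obtain s where s: "s \<in> F" "\<partial> u = s \<otimes> u" by auto
  have "\<partial> c = s \<otimes> c"
    using residue_unique[OF residue_der[OF u(1)]] residue_mult[OF residue_const[OF s(1)] u(1)] s(2)
    by simp
  then have "u \<otimes> inv c \<in> F"
    using der_quotient_zero[of u c s] uc s F_carrier u(2) constants by auto
  then have "(u \<otimes> inv c) \<otimes> c \<in> F" using uc F_facts by auto
  moreover have "(u \<otimes> inv c) \<otimes> c = u"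
    using uc inverse_facts[OF uc(2) u(2)] by (simp add: m_assoc)
  ultimately have uF: "u \<in> F" by simp
  have "u \<noteq> \<zero>" using u(3) x(2) xc tc integral[of x ?t] by auto
  then show ?thesis using u(3) uF uc tc m_comm by metis
qed

end

section \<open>The place attached to a special transcendental element\<close>

context differential_field
begin

lemma normalize_eq_Nil_imp: "normalize p = [] \<Longrightarrow> set p \<subseteq> {\<zero>}"
  by (induction p) (auto split: if_splits)

text \<open>Transcendence speaks of normalized polynomials, while the arguments below evaluate
  arbitrary coefficient lists. Normalizing drops only leading zeros, so an empty result means that
  all entries were zero.\<close>

lemma transcendental_eval_zero:
  assumes "transcendental F w" "set p \<subseteq> F" "F \<subseteq> carrier K" "w \<in> carrier K" "eval p w = \<zero>"
  shows "set p \<subseteq> {\<zero>}"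
proof -
  have "normalize p \<in> carrier (F[X])"
    using normalize_gives_polynomial[OF assms(2)] by (simp add: univ_poly_def)
  moreover have "eval (normalize p) w = \<zero>"
    using eval_normalize[of p w] assms by auto
  ultimately have "normalize p = []"
    using eval_transcendental assms(1) unfolding over_def by blast
  then show ?thesis by (rule normalize_eq_Nil_imp)
qed

lemma univ_poly_set: "subring F K \<Longrightarrow> p \<in> carrier (F[X]) \<Longrightarrow> set p \<subseteq> F"
  by (auto simp: univ_poly_def polynomial_def)

text \<open>\<open>X\<close> divides \<open>X P\<close> and is not a unit, so it cannot divide
  \<open>Q\<close>. Coefficient lists end with the constant term, hence the conclusion says
  \<open>Q(0) \<noteq> 0\<close>.\<close>

lemma relatively_prime_var:
  assumes F: "subfield F K" and P: "P \<in> carrier (F[X])" and Q: "Q \<in> carrier (F[X])"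
    and rp: "relatively_prime (F[X]) (X \<otimes>\<^bsub>F[X]\<^esub> P) Q"
  obtains q c where "Q = q @ [c]" "c \<in> F" "c \<noteq> \<zero>" "set q \<subseteq> F"
proof -
  have s: "subring F K" using subfieldE(1)[OF F] .
  interpret FX: domain "F[X]" using univ_poly_is_domain[OF s] .
  have X: "X \<in> carrier (F[X])" using var_closed[OF s] by simp
  have nu: "X \<notin> Units (F[X])" using univ_poly_units[OF F] by (auto simp: var_def)
  have "X divides\<^bsub>F[X]\<^esub> (X \<otimes>\<^bsub>F[X]\<^esub> P)" using P by (auto simp: factor_def)
  then have nd: "\<not> X divides\<^bsub>F[X]\<^esub> Q"
    using rp X nu by (auto simp: relatively_prime_def)
  have ne: "Q \<noteq> []"
  proof
    assume "Q = []"
    then have "Q = X \<otimes>\<^bsub>F[X]\<^esub> \<zero>\<^bsub>F[X]\<^esub>" using FX.r_null[OF X] by (simp add: univ_poly_zero)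
    then show False using nd FX.zero_closed by (auto simp: factor_def)
  qed
  then obtain q c where qc: "Q = q @ [c]" by (metis append_butlast_last_id)
  have set: "set q \<subseteq> F" "c \<in> F" using univ_poly_set[OF s Q] qc by auto
  have "c \<noteq> \<zero>"
  proof
    assume c: "c = \<zero>"
    have "q \<noteq> []" using Q qc c by (auto simp: univ_poly_def polynomial_def)
    then have q: "q \<in> carrier (F[X])" using Q qc by (auto simp: univ_poly_def polynomial_def)
    have "Q = q \<otimes>\<^bsub>F[X]\<^esub> X" using poly_mult_var[OF s q] \<open>q \<noteq> []\<close> qc c by simp
    then have "Q = X \<otimes>\<^bsub>F[X]\<^esub> q" using FX.m_comm[OF q X] by simp
    then show False using nd q by (auto simp: factor_def)
  qed
  then show ?thesis using that qc set by auto
qed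

text \<open>Write \<open>w' = w P(w) / Q(w)\<close>. Because \<open>Q(0) \<noteq> 0\<close>, the
  denominator \<open>Q(w)\<close> is invertible at \<open>w = 0\<close>, so \<open>w' / w\<close> is
  regular there and differentiation does not leave the local ring. Membership in the local ring is
  phrased by clearing a denominator instead of forming fractions.\<close>

lemma place_of_special:
  assumes F: "differential_subfield F K" and sp: "special_transcendental K F w"
  shows "\<exists>V. differential_place K F V w"
proof -
  note Ff = differential_subfieldD[OF F]
  have wc: "w \<in> carrier K" and tr: "transcendental F w"
    using sp by (auto simp: special_transcendental_def)
  obtain P Q where P: "P \<in> carrier (F[X])" and Q: "Q \<in> carrier (F[X])"
    and rp: "relatively_prime (F[X]) (X \<otimes>\<^bsub>F[X]\<^esub> P) Q"
    and dw: "\<partial> w = (w \<otimes> eval P w) \<otimes> inv (eval Q w)"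
    using sp by (auto simp: special_transcendental_def)
  define R where "R = (\<lambda>p. eval p w) ` carrier (F[X])"
  have R: "subring R K"
    unfolding R_def
    by (rule ring_hom_ring.img_is_subring[OF eval_ring_hom[OF Ff(2) wc]
          ring.carrier_is_subring[OF univ_poly_is_ring[OF Ff(2)]]])
  note Rf = subringE[OF R]
  have Rc: "x \<in> carrier K" if "x \<in> R" for x using Rf(1) that by auto
  have Fc: "x \<in> carrier K" if "x \<in> F" for x using Ff(3) that by auto
  have evR: "eval p w \<in> R" if "set p \<subseteq> F" for p
  proof -
    have "normalize p \<in> carrier (F[X])"
      using normalize_gives_polynomial[OF that] by (simp add: univ_poly_def)
    moreover have "eval (normalize p) w = eval p w"
      using eval_normalize[of p w] that wc Ff(3) by auto
    ultimately show ?thesis unfolding R_def by (metis imageI)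
  qed
  have R_ev: "\<exists>p. set p \<subseteq> F \<and> x = eval p w" if "x \<in> R" for x
    using that univ_poly_set[OF Ff(2)] by (auto simp: R_def)
  have eval_snoc: "eval (p @ [c]) w = c \<oplus> w \<otimes> eval p w" if "set p \<subseteq> F" "c \<in> F" for p c
  proof -
    have "set p \<subseteq> carrier K" "c \<in> carrier K" using that Ff(3) by auto
    then show ?thesis
      using eval_append_aux[of p c w] wc eval_in_carrier[of p w] by (simp add: m_comm a_comm)
  qed
  have FR: "F \<subseteq> R"
  proof
    fix c assume "c \<in> F"
    then show "c \<in> R" using evR[of "[] @ [c]"] Fc by simp
  qed
  have wR: "w \<in> R"
    using evR[of "[\<one>, \<zero>]"] Ff(5,6) wc by simp
  have R2: "\<exists>c\<in>F. \<exists>v\<in>R. x = c \<oplus> w \<otimes> v" if "x \<in> R" for x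
  proof -
    obtain p where p: "set p \<subseteq> F" "x = eval p w" using R_ev[OF \<open>x \<in> R\<close>] by auto
    show ?thesis
    proof (cases p rule: rev_cases)
      case Nil
      then show ?thesis using p Ff(5) Rf(2) wc by (intro bexI[of _ \<zero>]) auto
    next
      case (snoc q c)
      then show ?thesis using p eval_snoc[of q c] evR[of q] by auto
    qed
  qed
  \<comment> \<open>If \<open>w v\<close> equals \<open>c\<close> in \<open>F\<close>, then
    appending the constant term \<open>-c\<close> to the coefficients of \<open>v\<close> gives a
    polynomial that vanishes at \<open>w\<close>; transcendence kills every coefficient.\<close>
  have R3: "v = \<zero>" if "v \<in> R" "w \<otimes> v \<in> F" for v
  proof -
    obtain p where p: "set p \<subseteq> F" "v = eval p w" using R_ev[OF \<open>v \<in> R\<close>] by auto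
    define c where "c = w \<otimes> v"
    have c: "c \<in> F" "c \<in> carrier K" "\<ominus> c \<in> F" using that Fc Ff(7) by (auto simp: c_def)
    have "eval (p @ [\<ominus> c]) w = \<ominus> c \<oplus> c"
      using eval_snoc[OF p(1) c(3)] p(2) by (simp add: c_def)
    also have "\<dots> = \<zero>" using c by (simp add: l_neg)
    finally have "set (p @ [\<ominus> c]) \<subseteq> {\<zero>}"
      using transcendental_eval_zero[OF tr _ Ff(3) wc, of "p @ [\<ominus> c]"] p c by auto
    then have "set p \<subseteq> {\<zero>}" by auto
    then have "eval p w = \<zero>"
      using wc by (induction p) auto
    then show ?thesis using p by simp
  qed
  have w0: "w \<noteq> \<zero>" using R3[OF Rf(3)] wc Ff(5) by auto
  \<comment> \<open>A nonzero polynomial expression is a power of \<open>w\<close> times one with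
    nonzero constant term: trailing zeros of the list are stripped, which is why the induction runs
    from its end.\<close>
  have R4: "\<exists>k::nat. \<exists>c\<in>F. \<exists>v\<in>R. c \<noteq> \<zero> \<and> eval p w = w [^] k \<otimes> (c \<oplus> w \<otimes> v)"
    if "set p \<subseteq> F" "eval p w \<noteq> \<zero>" for p
    using that
  proof (induction p rule: rev_induct)
    case Nil
    then show ?case by simp
  next
    case (snoc c q)
    then have q: "set q \<subseteq> F" "c \<in> F" by auto
    have qR: "eval q w \<in> R" using evR[OF q(1)] .
    show ?case
    proof (cases "c = \<zero>")
      case True
      have e: "eval (q @ [c]) w = w \<otimes> eval q w"
        using eval_snoc[OF q] True Rc[OF qR] wc by simp
      then have "eval q w \<noteq> \<zero>" using snoc.prems(2) wc by auto
      then obtain k c' v where k: "c' \<in> F" "v \<in> R" "c' \<noteq> \<zero>"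
          "eval q w = w [^] (k::nat) \<otimes> (c' \<oplus> w \<otimes> v)"
        using snoc.IH q by auto
      have "eval (q @ [c]) w = w [^] (Suc k) \<otimes> (c' \<oplus> w \<otimes> v)"
        unfolding e k(4) using wc Fc[OF k(1)] Rc[OF k(2)] by (simp add: m_ac)
      then show ?thesis using k by blast
    next
      case False
      have "eval (q @ [c]) w = w [^] (0::nat) \<otimes> (c \<oplus> w \<otimes> eval q w)"
        using eval_snoc[OF q] Rc[OF qR] wc Fc[OF q(2)] by simp
      then show ?thesis using False q qR by blast
    qed
  qed
  \<comment> \<open>The denominators allowed at \<open>w = 0\<close>: polynomial expressions in
    \<open>w\<close> with nonzero constant term.\<close>
  define S where "S = {b. \<exists>c\<in>F. \<exists>v\<in>R. c \<noteq> \<zero> \<and> b = c \<oplus> w \<otimes> v}"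
  have SI: "c \<oplus> w \<otimes> v \<in> S" if "c \<in> F" "v \<in> R" "c \<noteq> \<zero>" for c v
    using that by (auto simp: S_def)
  have SR: "b \<in> R" if "b \<in> S" for b
    using that FR wR Rf(6,7) by (auto simp: S_def)
  have Sc: "b \<in> carrier K" if "b \<in> S" for b using Rc SR that by auto
  have S_mult: "a \<otimes> b \<in> S" if "a \<in> S" "b \<in> S" for a b
  proof -
    obtain c u where u: "c \<in> F" "u \<in> R" "c \<noteq> \<zero>" "a = c \<oplus> w \<otimes> u" using \<open>a \<in> S\<close> by (auto simp: S_def)
    obtain d v where v: "d \<in> F" "v \<in> R" "d \<noteq> \<zero>" "b = d \<oplus> w \<otimes> v" using \<open>b \<in> S\<close> by (auto simp: S_def)
    have *: "c \<in> carrier K" "d \<in> carrier K" "u \<in> carrier K" "v \<in> carrier K" 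
      using u v Fc Rc by auto
    have "a \<otimes> b = (c \<otimes> d) \<oplus> w \<otimes> (c \<otimes> v \<oplus> u \<otimes> b)"
      unfolding u v using * wc by algebra
    moreover have "c \<otimes> v \<oplus> u \<otimes> b \<in> R" using u v FR SR[OF \<open>b \<in> S\<close>] Rf by auto
    moreover have "c \<otimes> d \<noteq> \<zero>" using u v * integral by auto
    ultimately show ?thesis using SI[of "c \<otimes> d"] u v Ff by auto
  qed
  have S_one: "\<one> \<in> S"
    using SI[OF Ff(6) Rf(2)] wc by simp
  have S_nz: "b \<noteq> \<zero>" if "b \<in> S" for b
  proof
    assume "b = \<zero>"
    then obtain c u where u: "c \<in> F" "u \<in> R" "c \<noteq> \<zero>" "\<zero> = c \<oplus> w \<otimes> u"
      using \<open>b \<in> S\<close> by (auto simp: S_def)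
    then have "w \<otimes> u = \<ominus> c" using Fc Rc wc 
      by (metis a_comm m_closed minus_equality)
    then have "u = \<zero>" using R3[OF u(2)] u Ff(7) by auto
    then show False using u Fc wc by auto
  qed
  define V where "V = {x \<in> carrier K. \<exists>b\<in>S. b \<otimes> x \<in> R}"
  have VI: "x \<in> V" if "x \<in> carrier K" "b \<in> S" "b \<otimes> x \<in> R" for x b
    using that by (auto simp: V_def)
  have RV: "x \<in> V" if "x \<in> R" for x
    using VI[OF Rc[OF that] S_one] that Rc by auto
  have Vs: "subring V K"
  proof (rule subringI)
    show "V \<subseteq> carrier K" by (auto simp: V_def)
    show "\<one> \<in> V" using RV Rf by auto
    show "\<ominus> x \<in> V" if "x \<in> V" for x
    proof -
      obtain b where b: "x \<in> carrier K" "b \<in> S" "b \<otimes> x \<in> R" using \<open>x \<in> V\<close> by (auto simp: V_def)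
      then show ?thesis using Rf(5)[OF b(3)] Sc by (intro VI[of _ b]) (auto simp: r_minus)
    qed
    fix x y assume "x \<in> V" "y \<in> V"
    obtain b where b: "x \<in> carrier K" "b \<in> S" "b \<otimes> x \<in> R" using \<open>x \<in> V\<close> by (auto simp: V_def)
    obtain d where d: "y \<in> carrier K" "d \<in> S" "d \<otimes> y \<in> R" using \<open>y \<in> V\<close> by (auto simp: V_def)
    have bd: "b \<in> carrier K" "d \<in> carrier K" using b d Sc by auto
    have "(b \<otimes> d) \<otimes> (x \<otimes> y) = (b \<otimes> x) \<otimes> (d \<otimes> y)"
      using b(1) d(1) bd by algebra
    then show "x \<otimes> y \<in> V" using b d bd S_mult Rf by (intro VI[of _ "b \<otimes> d"]) auto
    have "(b \<otimes> d) \<otimes> (x \<oplus> y) = d \<otimes> (b \<otimes> x) \<oplus> b \<otimes> (d \<otimes> y)"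
      using b(1) d(1) bd by algebra
    then show "x \<oplus> y \<in> V" using b d bd S_mult Rf SR by (intro VI[of _ "b \<otimes> d"]) auto
  qed
  obtain q0 c0 where Q0: "Q = q0 @ [c0]" "c0 \<in> F" "c0 \<noteq> \<zero>" "set q0 \<subseteq> F"
    using relatively_prime_var[OF Ff(1) P Q rp] by metis
  define q where "q = eval Q w"
  have qS: "q \<in> S" using SI[OF Q0(2) evR[OF Q0(4)] Q0(3)] eval_snoc[OF Q0(4,2)] Q0(1) by (simp add: q_def)
  have PR: "eval P w \<in> R" using evR[OF univ_poly_set[OF Ff(2) P]] .
  have qdw: "q \<otimes> \<partial> w = w \<otimes> eval P w"
    unfolding dw q_def[symmetric] using inverse_facts[OF Sc[OF qS] S_nz[OF qS]] Sc[OF qS] wc Rc[OF PR]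
    by (simp add: m_lcomm[of q])
  \<comment> \<open>A single factor \<open>q = Q(w)\<close> clears the denominators of the
    derivative of any polynomial in \<open>w\<close>, whatever its degree, as \<open>w'\<close>
    enters that derivative linearly.\<close>
  have dR: "q \<otimes> \<partial> (eval p w) \<in> R" if "set p \<subseteq> F" for p
    using that
  proof (induction p rule: rev_induct)
    case Nil
    then show ?case using Sc[OF qS] Rf by (simp add: der_zero)
  next
    case (snoc c p)
    then have p: "set p \<subseteq> F" "c \<in> F" by auto
    define e where "e = eval p w"
    have eR: "e \<in> R" "q \<otimes> \<partial> e \<in> R" using evR[OF p(1)] snoc.IH[OF p(1)] by (auto simp: e_def)
    have *: "q \<in> carrier K" "e \<in> carrier K" "\<partial> e \<in> carrier K" "\<partial> c \<in> carrier K" "c \<in> carrier K"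
      "\<partial> w \<in> carrier K"
      using qS Sc eR Rc der_closed Fc p wc by auto
    have "q \<otimes> \<partial> (eval (p @ [c]) w) = q \<otimes> (\<partial> c \<oplus> (\<partial> w \<otimes> e \<oplus> w \<otimes> \<partial> e))"
      using * wc by (simp add: eval_snoc[OF p] e_def[symmetric] der_add der_mult)
    also have "\<dots> = q \<otimes> \<partial> c \<oplus> ((q \<otimes> \<partial> w) \<otimes> e \<oplus> w \<otimes> (q \<otimes> \<partial> e))"
      using * wc by algebra
    also have "\<dots> \<in> R"
      unfolding qdw using eR wR PR SR[OF qS] FR Ff(4)[OF p(2)] Rf by auto
    finally show ?case .
  qed
  have place: "differential_place K F V w"
  proof (intro differential_place.intro differential_place_axioms.intro)
    show "differential_field K" ..
    show "differential_subfield F K" by fact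
    show "subring V K" by fact
    show "F \<subseteq> V" using FR RV by auto
    show wV: "w \<in> V" using wR RV by auto
    show "w \<noteq> \<zero>" by fact
    show "\<exists>c\<in>F. \<exists>v\<in>V. x = c \<oplus> w \<otimes> v" if "x \<in> V" for x
    proof -
      obtain b where b: "x \<in> carrier K" "b \<in> S" "b \<otimes> x \<in> R" using \<open>x \<in> V\<close> by (auto simp: V_def)
      obtain b0 b1 where b0: "b0 \<in> F" "b1 \<in> R" "b0 \<noteq> \<zero>" "b = b0 \<oplus> w \<otimes> b1" using b(2) by (auto simp: S_def)
      obtain a0 a1 where a0: "a0 \<in> F" "a1 \<in> R" "b \<otimes> x = a0 \<oplus> w \<otimes> a1" using R2[OF b(3)] by auto
      \<comment> \<open>For a fraction the residue is the quotient of the constant terms, here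
        \<open>a0\<close> of the numerator \<open>b x\<close> and \<open>b0\<close> of the
        denominator \<open>b\<close>.\<close>
      define c where "c = inv b0 \<otimes> a0"
      have c: "c \<in> F" using a0 b0 Ff by (auto simp: c_def)
      have *: "a0 \<in> carrier K" "b0 \<in> carrier K" "a1 \<in> carrier K" "b1 \<in> carrier K" "c \<in> carrier K"
        using a0 b0 c Fc Rc by auto
      have bc: "b0 \<otimes> c = a0"
        unfolding c_def using inverse_facts[OF *(2) b0(3)] * by (simp add: m_assoc[symmetric])
      define v where "v = inv w \<otimes> (x \<ominus> c)"
      note iw = inverse_facts[OF wc w0]
      have v: "v \<in> carrier K" using iw b * by (auto simp: v_def)
      have wv: "w \<otimes> v = x \<ominus> c"
        unfolding v_def using iw b * wc by (simp add: m_assoc[symmetric])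
      have x: "x = c \<oplus> w \<otimes> v"
        unfolding wv using b * by (simp add: minus_eq a_lcomm[of c] r_neg)
      have "w \<otimes> (b \<otimes> v) = b \<otimes> (w \<otimes> v)" using wc Sc[OF b(2)] v by algebra
      also have "\<dots> = (b \<otimes> x) \<ominus> b \<otimes> c" unfolding wv using b(1) * Sc[OF b(2)] by algebra
      also have "\<dots> = (b0 \<otimes> c \<oplus> w \<otimes> a1) \<ominus> (b0 \<oplus> w \<otimes> b1) \<otimes> c"
        unfolding a0(3) bc by (simp add: b0(4))
      also have "\<dots> = w \<otimes> (a1 \<ominus> b1 \<otimes> c)" using * wc by algebra
      finally have "b \<otimes> v = a1 \<ominus> b1 \<otimes> c"
        using m_lcancel[OF w0 wc] Sc[OF b(2)] v * by auto
      moreover have "a1 \<ominus> b1 \<otimes> c \<in> R" using a0 b0 c FR Rf(5-7) by (auto simp: minus_eq)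
      ultimately have "v \<in> V" using VI[OF v b(2)] by simp
      then show ?thesis using x c by auto
    qed
    show "v = \<zero>" if "v \<in> V" "w \<otimes> v \<in> F" for v
    proof -
      obtain b where b: "v \<in> carrier K" "b \<in> S" "b \<otimes> v \<in> R" using \<open>v \<in> V\<close> by (auto simp: V_def)
      obtain b0 b1 where b0: "b0 \<in> F" "b1 \<in> R" "b0 \<noteq> \<zero>" "b = b0 \<oplus> w \<otimes> b1" using b(2) by (auto simp: S_def)
      define c where "c = w \<otimes> v"
      have c: "c \<in> F" using that by (simp add: c_def)
      have *: "b0 \<in> carrier K" "b1 \<in> carrier K" "c \<in> carrier K" "b \<in> carrier K"
        using b b0 c Fc Rc Sc by auto
      \<comment> \<open>Clearing the denominator of \<open>v\<close> turns \<open>w v = c\<close>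
        into a condition on polynomials: \<open>b v - b1 c\<close> is in \<open>R\<close>, and
        \<open>w\<close> times it is \<open>b0 c\<close> in \<open>F\<close>, so the polynomial case
        \<open>R3\<close> applies.\<close>
      have "w \<otimes> (b \<otimes> v \<ominus> b1 \<otimes> c) = b \<otimes> (w \<otimes> v) \<ominus> w \<otimes> b1 \<otimes> c"
        using wc * b(1) by algebra
      also have "\<dots> = (b0 \<oplus> w \<otimes> b1) \<otimes> c \<ominus> w \<otimes> b1 \<otimes> c"
        by (simp add: b0(4) c_def)
      also have "\<dots> = b0 \<otimes> c" using * wc by algebra
      finally have e: "w \<otimes> (b \<otimes> v \<ominus> b1 \<otimes> c) = b0 \<otimes> c" .
      have "b \<otimes> v \<ominus> b1 \<otimes> c \<in> R" using b b0 c FR Rf(5-7) by (auto simp: minus_eq)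
      then have "b \<otimes> v \<ominus> b1 \<otimes> c = \<zero>" using R3 e b0 c Ff by auto
      then have "b0 \<otimes> c = \<zero>" using e wc by simp
      then have "w \<otimes> v = \<zero>" using integral * b0(3) by (auto simp: c_def)
      then show ?thesis using integral wc w0 b by auto
    qed
    show "\<partial> x \<in> V" if "x \<in> V" for x
    proof -
      obtain b where b: "x \<in> carrier K" "b \<in> S" "b \<otimes> x \<in> R" using \<open>x \<in> V\<close> by (auto simp: V_def)
      have bx: "q \<otimes> \<partial> (b \<otimes> x) \<in> R" "q \<otimes> \<partial> b \<in> R"
        using R_ev[OF b(3)] R_ev[OF SR[OF b(2)]] dR by auto
      have *: "b \<in> carrier K" "q \<in> carrier K" "\<partial> x \<in> carrier K" "\<partial> b \<in> carrier K"
        using Sc b qS der_closed by auto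
      \<comment> \<open>The quotient rule with all denominators cleared: \<open>q b^2\<close> is an
        allowed denominator for \<open>x'\<close>.\<close>
      have "q \<otimes> b \<otimes> b \<otimes> \<partial> x = b \<otimes> (q \<otimes> (\<partial> b \<otimes> x \<oplus> b \<otimes> \<partial> x)) \<ominus> (q \<otimes> \<partial> b) \<otimes> (b \<otimes> x)"
        using * b(1) by algebra
      also have "\<dots> = b \<otimes> (q \<otimes> \<partial> (b \<otimes> x)) \<ominus> (q \<otimes> \<partial> b) \<otimes> (b \<otimes> x)"
        using * b(1) by (simp add: der_mult)
      also have "\<dots> \<in> R" using bx b SR Rf(5-7) by (auto simp: minus_eq)
      finally show ?thesis using qS b(2) S_mult * by (intro VI[of _ "q \<otimes> b \<otimes> b"]) auto
    qed
    show "\<exists>r\<in>V. \<partial> w = w \<otimes> r"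
    proof
      note iq = inverse_facts[OF Sc[OF qS] S_nz[OF qS]]
      show "\<partial> w = w \<otimes> (eval P w \<otimes> inv q)"
        unfolding dw q_def[symmetric] using iq wc Rc[OF PR] by (simp add: m_assoc)
      have "q \<otimes> (eval P w \<otimes> inv q) = eval P w"
        using iq Sc[OF qS] Rc[OF PR] by (simp add: m_lcomm[of q])
      then show "eval P w \<otimes> inv q \<in> V"
        using PR Rc iq by (intro VI[OF _ qS]) auto
    qed
    have frac: "\<exists>a\<in>R. \<exists>b\<in>R. b \<noteq> \<zero> \<and> b \<otimes> x = a" if "x \<in> generate_field K (insert w F)" for x
    proof -
      have gc: "h \<in> carrier K" if "h \<in> generate_field K (insert w F)" for h
        using generate_field_in_carrier[OF _ that] Ff(3) wc by auto
      have base: "\<exists>a\<in>R. \<exists>b\<in>R. b \<noteq> \<zero> \<and> b \<otimes> x = a" if "x \<in> R" for x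
        using Rf that Rc by (intro bexI[of _ x] bexI[of _ \<one>]) auto
      show ?thesis using that
      proof (induction rule: generate_field.induct)
        case one
        then show ?case by (rule base[OF Rf(3)])
      next
        case (incl h)
        then show ?case using base FR wR by auto
      next
        case (a_inv h)
        then obtain a b where "a \<in> R" "b \<in> R" "b \<noteq> \<zero>" "b \<otimes> h = a" by auto
        then show ?case using Rf(5)[of a] r_minus[OF Rc[of b] gc[OF a_inv.hyps]]
          by (intro bexI[of _ "\<ominus> a"] bexI[of _ b]) auto
      next
        case (m_inv h)
        then obtain a b where ab: "a \<in> R" "b \<in> R" "b \<noteq> \<zero>" "b \<otimes> h = a" by auto
        note h = gc[OF m_inv.hyps(1)] and ih = inverse_facts[OF gc[OF m_inv.hyps(1)] m_inv.hyps(2)]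
        have "a \<noteq> \<zero>" using ab integral h m_inv.hyps(2) Rc by auto
        moreover have "a \<otimes> inv h = b"
          unfolding ab(4)[symmetric] using ih h Rc[OF ab(2)] by (simp add: m_assoc)
        ultimately show ?case using ab by auto
      next
        case (eng_add h1 h2)
        then obtain a b c d where ab: "a \<in> R" "b \<in> R" "b \<noteq> \<zero>" "b \<otimes> h1 = a"
            "c \<in> R" "d \<in> R" "d \<noteq> \<zero>" "d \<otimes> h2 = c" by blast
        have h: "h1 \<in> carrier K" "h2 \<in> carrier K" "b \<in> carrier K" "d \<in> carrier K"
          using gc eng_add.hyps ab Rc by auto
        have "(b \<otimes> d) \<otimes> (h1 \<oplus> h2) = d \<otimes> (b \<otimes> h1) \<oplus> b \<otimes> (d \<otimes> h2)"
          using h by algebra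
        moreover have "b \<otimes> d \<noteq> \<zero>" using integral h ab by auto
        ultimately show ?case using Rf(6,7) ab 
          by (intro bexI[of _ "d \<otimes> (b \<otimes> h1) \<oplus> b \<otimes> (d \<otimes> h2)"] bexI[of _ "b \<otimes> d"]) auto
      next
        case (eng_mult h1 h2)
        then obtain a b c d where ab: "a \<in> R" "b \<in> R" "b \<noteq> \<zero>" "b \<otimes> h1 = a"
            "c \<in> R" "d \<in> R" "d \<noteq> \<zero>" "d \<otimes> h2 = c" by blast
        have h: "h1 \<in> carrier K" "h2 \<in> carrier K" "b \<in> carrier K" "d \<in> carrier K"
          using gc eng_mult.hyps ab Rc by auto
        have "(b \<otimes> d) \<otimes> (h1 \<otimes> h2) = (b \<otimes> h1) \<otimes> (d \<otimes> h2)"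
          using h by algebra
        moreover have "b \<otimes> d \<noteq> \<zero>" using integral h ab by auto
        ultimately show ?case using Rf(6,7) ab 
          by (intro bexI[of _ "(b \<otimes> h1) \<otimes> (d \<otimes> h2)"] bexI[of _ "b \<otimes> d"]) auto
      qed
    qed
    show "\<exists>u\<in>V. \<exists>c\<in>F. \<exists>v\<in>V. \<exists>e::nat. c \<noteq> \<zero> \<and> u = c \<oplus> w \<otimes> v \<and> (x = w [^] e \<otimes> u \<or> x \<otimes> w [^] e = u)"
      if x: "x \<in> generate_field K (insert w F)" and x0: "x \<noteq> \<zero>" for x
    proof -
      have xc: "x \<in> carrier K"
        using generate_field_in_carrier[OF _ x] Ff(3) wc by auto
      obtain a b where ab: "a \<in> R" "b \<in> R" "b \<noteq> \<zero>" "b \<otimes> x = a" using frac[OF x] by auto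
      have "a \<noteq> \<zero>" using ab integral xc x0 Rc by auto
      then obtain k c u where a: "c \<in> F" "u \<in> R" "c \<noteq> \<zero>" "a = w [^] (k::nat) \<otimes> (c \<oplus> w \<otimes> u)"
        using R_ev[OF ab(1)] R4 by metis
      obtain l d v where b: "d \<in> F" "v \<in> R" "d \<noteq> \<zero>" "b = w [^] (l::nat) \<otimes> (d \<oplus> w \<otimes> v)"
        using R_ev[OF ab(2)] R4 ab(3) by metis
      define s where "s = c \<oplus> w \<otimes> u"
      define t where "t = d \<oplus> w \<otimes> v"
      have st: "s \<in> S" "t \<in> S" using SI a b by (auto simp: s_def t_def)
      note it = inverse_facts[OF Sc[OF st(2)] S_nz[OF st(2)]]
      have *: "s \<in> carrier K" "t \<in> carrier K" "w [^] (l::nat) \<in> carrier K" "w [^] (k::nat) \<in> carrier K"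
          "w [^] (l - k) \<in> carrier K" "w [^] (k - l) \<in> carrier K"
        using st Sc wc by auto
      define y where "y = s \<otimes> inv t"
      have ty: "y \<in> carrier K" "t \<otimes> y = s" using it * by (auto simp: y_def m_lcomm[of t])
      have yV: "y \<in> V" using VI[OF ty(1) st(2)] ty SR[OF st(1)] by auto
      have eq: "w [^] l \<otimes> x = w [^] k \<otimes> y"
      proof -
        have "t \<otimes> (w [^] l \<otimes> x) = b \<otimes> x"
          unfolding b t_def[symmetric] using * xc by algebra
        also have "\<dots> = w [^] k \<otimes> s" unfolding ab(4) a s_def[symmetric] ..
        also have "\<dots> = t \<otimes> (w [^] k \<otimes> y)"
          unfolding ty(2)[symmetric] using * ty(1) by algebra
        finally show ?thesis
          using m_lcancel[OF S_nz[OF st(2)] *(2)] * ty xc by auto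
      qed
      have "\<exists>c'\<in>F. \<exists>v'\<in>V. c' \<noteq> \<zero> \<and> y = c' \<oplus> w \<otimes> v'"
      proof -
        have idR: "inv d \<in> F" "inv d \<noteq> \<zero>" "inv d \<in> carrier K" "d \<otimes> inv d = \<one>" "d \<in> carrier K"
          using inverse_facts[OF Fc[OF b(1)] b(3)] Ff b Fc by auto
        have **: "c \<in> carrier K" "u \<in> carrier K" "v \<in> carrier K" using a b Fc Rc by auto
        \<comment> \<open>\<open>c'\<close> is the quotient of the constant terms of
          \<open>s\<close> and \<open>t\<close>; \<open>v'\<close> is then forced by
          \<open>t (c' + w v') = s\<close>.\<close>
        define c' where "c' = c \<otimes> inv d"
        have c': "c' \<in> F" "c' \<noteq> \<zero>" "c' \<in> carrier K" "d \<otimes> c' = c"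
          using a idR Ff Fc integral[of c "inv d"] ** by (auto simp: c'_def m_lcomm[of d])
        define v' where "v' = (u \<ominus> v \<otimes> c') \<otimes> inv t"
        have v'c: "v' \<in> carrier K" using ** c' it by (simp add: v'_def)
        have tv: "t \<otimes> v' = u \<ominus> v \<otimes> c'"
          using it ** c' *(2) by (simp add: v'_def m_lcomm[of t])
        have "u \<ominus> v \<otimes> c' \<in> R" using a b c' FR Rf(5-7) by (auto simp: minus_eq)
        then have v'V: "v' \<in> V" using VI[OF v'c st(2)] tv by simp
        have "t \<otimes> (c' \<oplus> w \<otimes> v') = t \<otimes> c' \<oplus> w \<otimes> (t \<otimes> v')"
          using *(2) c'(3) v'c wc by algebra
        also have "\<dots> = t \<otimes> c' \<oplus> w \<otimes> (u \<ominus> v \<otimes> c')" unfolding tv ..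
        also have "\<dots> = d \<otimes> c' \<oplus> w \<otimes> u"
          unfolding t_def using ** c'(3) wc idR(5) by algebra
        also have "\<dots> = t \<otimes> y" unfolding c'(4) ty s_def ..
        finally have "c' \<oplus> w \<otimes> v' = y"
          using m_lcancel[OF S_nz[OF st(2)] *(2)] ty(1) c'(3) v'c wc by auto
        then show ?thesis using c' v'V by auto
      qed
      then obtain c' v' where cv: "c' \<in> F" "v' \<in> V" "c' \<noteq> \<zero>" "y = c' \<oplus> w \<otimes> v'" by auto
      have "\<exists>e::nat. x = w [^] e \<otimes> y \<or> x \<otimes> w [^] e = y"
      proof (cases "l \<le> k")
        case True
        then have "w [^] k = w [^] l \<otimes> w [^] (k - l)" using wc by (simp add: nat_pow_mult)
        then have "w [^] l \<otimes> x = w [^] l \<otimes> (w [^] (k - l) \<otimes> y)"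
          using eq * ty by (simp add: m_assoc)
        then have "x = w [^] (k - l) \<otimes> y"
          using m_lcancel[OF pow_nonzero[OF wc w0, of l] *(3)] xc ty * by auto
        then show ?thesis by blast
      next
        case False
        then have "w [^] l = w [^] k \<otimes> w [^] (l - k)" using wc by (simp add: nat_pow_mult)
        then have "w [^] k \<otimes> (w [^] (l - k) \<otimes> x) = w [^] k \<otimes> y"
          using eq * ty xc by (simp add: m_assoc)
        then have "w [^] (l - k) \<otimes> x = y"
          using m_lcancel[OF pow_nonzero[OF wc w0, of k] *(4)] xc ty * by auto
        then show ?thesis using m_comm[OF xc *(5)] by blast
      qed
      then show ?thesis using cv yV by blast
    qed
  qed
  then show ?thesis by blast
qed

end

section \<open>Composition and division of differential operators\<close>

context differential_field
begin

lemma finsum_upto_Suc_0: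
  assumes "f 0 \<in> carrier K" "f (Suc 0) \<in> carrier K"
  shows "(\<Oplus>i\<in>{..Suc 0}. f i) = f (Suc 0) \<oplus> f 0"
proof -
  have "f \<in> {..Suc 0} \<rightarrow> carrier K" using assms by (auto simp: le_Suc_eq)
  then show ?thesis using assms finsum_Suc[of f 0] by simp
qed

lemma D_comp_closed: "B \<in> UNIV \<rightarrow> carrier K \<Longrightarrow> D_comp K B \<in> UNIV \<rightarrow> carrier K"
  by (auto simp: D_comp_def Pi_iff intro!: der_closed split: nat.split)

lemma D_comp_funpow_closed: "B \<in> UNIV \<rightarrow> carrier K \<Longrightarrow> (D_comp K ^^ i) B \<in> UNIV \<rightarrow> carrier K"
  by (induction i) (simp_all add: D_comp_closed)

lemma D_comp_funpow_bound:
  assumes "\<forall>i>n. B i = \<zero>"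
  shows "\<forall>i>n + j. (D_comp K ^^ j) B i = \<zero>"
proof (induction j)
  case 0
  then show ?case using assms by simp
next
  case (Suc j)
  then show ?case by (auto simp: D_comp_def der_zero split: nat.split)
qed

lemma D_comp_smult:
  assumes "a \<in> carrier K" "C \<in> UNIV \<rightarrow> carrier K"
  shows "D_comp K (\<lambda>k. a \<otimes> C k) k = \<partial> a \<otimes> C k \<oplus> a \<otimes> D_comp K C k"
proof -
  have *: "C j \<in> carrier K" "\<partial> (C j) \<in> carrier K" "\<partial> a \<in> carrier K" for j
    using assms der_closed by auto
  show ?thesis
    by (cases k) (use * assms(1) in \<open>auto simp: D_comp_def der_mult r_distr a_assoc\<close>)
qed

lemma D_comp_finsum:
  assumes "finite I" "\<And>i. i \<in> I \<Longrightarrow> f i \<in> UNIV \<rightarrow> carrier K"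
  shows "D_comp K (\<lambda>k. \<Oplus>i\<in>I. f i k) k = (\<Oplus>i\<in>I. D_comp K (f i) k)"
proof -
  have *: "f i j \<in> carrier K" "\<partial> (f i j) \<in> carrier K" if "i \<in> I" for i j
    using assms(2)[OF that] der_closed by auto
  have d: "\<partial> (\<Oplus>i\<in>I. f i k) = (\<Oplus>i\<in>I. \<partial> (f i k))" for k
    using * by (intro der_finsum[OF assms(1)]) auto
  show ?thesis
  proof (cases k)
    case 0
    have "(\<Oplus>i\<in>I. \<partial> (f i 0)) = (\<Oplus>i\<in>I. D_comp K (f i) 0)"
      using * by (intro finsum_cong') (auto simp: D_comp_def)
    moreover have "(\<Oplus>i\<in>I. D_comp K (f i) 0) \<in> carrier K"
      using D_comp_closed[OF assms(2)] by (intro finsum_closed) auto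
    ultimately show ?thesis using * 0 by (simp add: D_comp_def[of K "\<lambda>k. \<Oplus>i\<in>I. f i k"] d)
  next
    case (Suc j)
    then show ?thesis using * by (simp add: D_comp_def d finsum_addf Pi_iff)
  qed
qed

lemma diffop_comp_closed:
  assumes "A \<in> UNIV \<rightarrow> carrier K" "\<forall>i>m. A i = \<zero>" "C \<in> UNIV \<rightarrow> carrier K"
  shows "diffop_comp K A C \<in> UNIV \<rightarrow> carrier K"
proof -
  have "(D_comp K ^^ i) C k \<in> carrier K" for i k using D_comp_funpow_closed[OF assms(3)] by auto
  moreover have "A i \<in> carrier K" for i using assms(1) by auto
  ultimately show ?thesis by (auto simp: diffop_comp_eq[OF assms(1,2)] intro!: finsum_closed)
qed

lemma diffop_comp_bound:
  assumes "A \<in> UNIV \<rightarrow> carrier K" "\<forall>i>m. A i = \<zero>" "C \<in> UNIV \<rightarrow> carrier K" "\<forall>i>n. C i = \<zero>"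
  shows "\<forall>i>m + n. diffop_comp K A C i = \<zero>"
proof -
  have *: "(D_comp K ^^ i) C k \<in> carrier K" for i k using D_comp_funpow_closed[OF assms(3)] by auto
  show ?thesis
    using assms(1) D_comp_funpow_bound[OF assms(4)]
    by (auto simp: diffop_comp_eq[OF assms(1,2) *] Pi_iff intro!: add.finprod_one_eqI)
qed

text \<open>Composition is left \<open>K\<close>-linear. The common bound \<open>m\<close> on the
  orders of the \<open>Y i\<close> puts both summations over fixed finite ranges, so that they can
  be exchanged; the value zero outside \<open>I\<close> only serves the exchange, which wants every
  term in the carrier.\<close>

lemma diffop_comp_finsum_left:
  assumes "finite I" "\<And>i. i \<in> I \<Longrightarrow> a i \<in> carrier K" "\<And>i. i \<in> I \<Longrightarrow> Y i \<in> UNIV \<rightarrow> carrier K"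
    and "\<And>i k. i \<in> I \<Longrightarrow> m < k \<Longrightarrow> Y i k = \<zero>" and C: "C \<in> UNIV \<rightarrow> carrier K"
  shows "diffop_comp K (\<lambda>k. \<Oplus>i\<in>I. a i \<otimes> Y i k) C k = (\<Oplus>i\<in>I. a i \<otimes> diffop_comp K (Y i) C k)"
proof -
  have DC: "(D_comp K ^^ i) C k \<in> carrier K" for i k using D_comp_funpow_closed[OF C] by auto
  have Y: "Y i k \<in> carrier K" if "i \<in> I" for i k using assms(3)[OF that] by auto
  let ?f = "\<lambda>i j. if i \<in> I then a i \<otimes> Y i j \<otimes> (D_comp K ^^ j) C k else \<zero>"
  have f: "?f i j \<in> carrier K" for i j using Y DC assms(2) by auto
  have 1: "(\<lambda>k. \<Oplus>i\<in>I. a i \<otimes> Y i k) \<in> UNIV \<rightarrow> carrier K"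
    using Y assms(2) by (auto intro!: finsum_closed)
  have 2: "\<forall>k>m. (\<Oplus>i\<in>I. a i \<otimes> Y i k) = \<zero>"
    using assms(2,4) by (auto intro!: add.finprod_one_eqI)
  have "diffop_comp K (\<lambda>k. \<Oplus>i\<in>I. a i \<otimes> Y i k) C k =
      (\<Oplus>j\<in>{..m}. (\<Oplus>i\<in>I. a i \<otimes> Y i j) \<otimes> (D_comp K ^^ j) C k)"
    by (rule diffop_comp_eq[OF 1 2 DC])
  also have "\<dots> = (\<Oplus>j\<in>{..m}. \<Oplus>i\<in>I. ?f i j)"
    using Y DC assms(1,2) by (intro finsum_cong') (auto simp: finsum_ldistr Pi_iff intro!: finsum_closed finsum_cong')
  also have "\<dots> = (\<Oplus>i\<in>I. \<Oplus>j\<in>{..m}. ?f i j)"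
    using f by (intro finsum_swap assms(1)) auto
  also have "\<dots> = (\<Oplus>i\<in>I. a i \<otimes> diffop_comp K (Y i) C k)"
  proof (intro finsum_cong' refl)
    show "(\<lambda>i. a i \<otimes> diffop_comp K (Y i) C k) \<in> I \<rightarrow> carrier K"
    proof
      fix i assume i: "i \<in> I"
      then show "a i \<otimes> diffop_comp K (Y i) C k \<in> carrier K"
        using assms(2)[OF i] diffop_comp_closed[OF assms(3)[OF i] _ C, of m] assms(4)[OF i] by auto
    qed
    fix i assume i: "i \<in> I"
    have "(\<Oplus>j\<in>{..m}. ?f i j) = (\<Oplus>j\<in>{..m}. a i \<otimes> (Y i j \<otimes> (D_comp K ^^ j) C k))"
      using i Y DC assms(2) by (intro finsum_cong') (auto simp: m_assoc)
    also have "\<dots> = a i \<otimes> (\<Oplus>j\<in>{..m}. Y i j \<otimes> (D_comp K ^^ j) C k)"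
      using i Y DC assms(2) by (intro finsum_rdistr[symmetric]) auto
    also have "\<dots> = a i \<otimes> diffop_comp K (Y i) C k"
      using assms(4)[OF i] by (simp add: diffop_comp_eq[OF assms(3)[OF i] _ DC, of m])
    finally show "(\<Oplus>j\<in>{..m}. ?f i j) = a i \<otimes> diffop_comp K (Y i) C k" .
  qed
  finally show ?thesis .
qed

text \<open>The product rule for \<open>D\<close> is applied to each summand
  \<open>B i (D^i \<circ> C)\<close>: one half differentiates the coefficient, the other raises the
  power of \<open>D\<close>.\<close>

lemma diffop_comp_D_comp:
  assumes B: "B \<in> UNIV \<rightarrow> carrier K" "\<forall>i>n. B i = \<zero>" and C: "C \<in> UNIV \<rightarrow> carrier K"
  shows "diffop_comp K (D_comp K B) C = D_comp K (diffop_comp K B C)"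
proof
  fix k
  have 1: "D_comp K B \<in> UNIV \<rightarrow> carrier K" by (rule D_comp_closed[OF B(1)])
  have 2: "\<forall>i>Suc n. D_comp K B i = \<zero>" using D_comp_funpow_bound[OF B(2), of 1] by simp
  have DCf: "(D_comp K ^^ i) C \<in> UNIV \<rightarrow> carrier K" for i by (rule D_comp_funpow_closed[OF C])
  have DC: "(D_comp K ^^ i) C k \<in> carrier K" for i k using DCf by auto
  have [simp]: "B i \<in> carrier K" "\<partial> (B i) \<in> carrier K" "(D_comp K ^^ i) C k \<in> carrier K"
      "D_comp K ((D_comp K ^^ i) C) k \<in> carrier K" for i k
    using B(1) der_closed DC DC[of "Suc i"] by auto
  have "diffop_comp K (D_comp K B) C k =
      (\<Oplus>i\<in>{..Suc n}. (\<partial> (B i) \<otimes> (D_comp K ^^ i) C k) \<oplus>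
        ((case i of 0 \<Rightarrow> \<zero> | Suc j \<Rightarrow> B j) \<otimes> (D_comp K ^^ i) C k))"
    unfolding diffop_comp_eq[OF 1 2 DC]
    by (intro finsum_cong') (auto simp: D_comp_def[of K B] l_distr split: nat.split)
  also have "\<dots> = (\<Oplus>i\<in>{..Suc n}. \<partial> (B i) \<otimes> (D_comp K ^^ i) C k) \<oplus>
      (\<Oplus>i\<in>{..Suc n}. (case i of 0 \<Rightarrow> \<zero> | Suc j \<Rightarrow> B j) \<otimes> (D_comp K ^^ i) C k)"
    by (intro finsum_addf) (auto split: nat.split)
  also have "(\<Oplus>i\<in>{..Suc n}. \<partial> (B i) \<otimes> (D_comp K ^^ i) C k) = (\<Oplus>i\<in>{..n}. \<partial> (B i) \<otimes> (D_comp K ^^ i) C k)"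
    using B(2) finsum_Suc[of "\<lambda>i. \<partial> (B i) \<otimes> (D_comp K ^^ i) C k" n] der_zero by (simp add: Pi_iff)
  also have "(\<Oplus>i\<in>{..Suc n}. (case i of 0 \<Rightarrow> \<zero> | Suc j \<Rightarrow> B j) \<otimes> (D_comp K ^^ i) C k) =
      (\<Oplus>i\<in>{..n}. B i \<otimes> (D_comp K ^^ Suc i) C k)"
    using C by (subst finsum_Suc2) (auto simp: Pi_iff split: nat.split)
  also have "(\<Oplus>i\<in>{..n}. \<partial> (B i) \<otimes> (D_comp K ^^ i) C k) \<oplus> (\<Oplus>i\<in>{..n}. B i \<otimes> (D_comp K ^^ Suc i) C k) =
      (\<Oplus>i\<in>{..n}. (\<partial> (B i) \<otimes> (D_comp K ^^ i) C k) \<oplus> (B i \<otimes> (D_comp K ^^ Suc i) C k))"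
    by (intro finsum_addf[symmetric]) auto
  also have "\<dots> = (\<Oplus>i\<in>{..n}. D_comp K (\<lambda>k. B i \<otimes> (D_comp K ^^ i) C k) k)"
    by (intro finsum_cong') (auto simp: D_comp_smult[OF _ DCf])
  also have "\<dots> = D_comp K (\<lambda>k. \<Oplus>i\<in>{..n}. B i \<otimes> (D_comp K ^^ i) C k) k"
    by (intro D_comp_finsum[symmetric]) auto
  also have "(\<lambda>k. \<Oplus>i\<in>{..n}. B i \<otimes> (D_comp K ^^ i) C k) = diffop_comp K B C"
    using diffop_comp_eq[OF B DC] by auto
  finally show "diffop_comp K (D_comp K B) C k = D_comp K (diffop_comp K B C) k" .
qed

lemma diffop_comp_D_comp_funpow:
  assumes B: "B \<in> UNIV \<rightarrow> carrier K" "\<forall>i>n. B i = \<zero>" and C: "C \<in> UNIV \<rightarrow> carrier K"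
  shows "diffop_comp K ((D_comp K ^^ j) B) C = (D_comp K ^^ j) (diffop_comp K B C)"
proof (induction j)
  case 0
  then show ?case by simp
next
  case (Suc j)
  then show ?case
    using diffop_comp_D_comp[OF D_comp_funpow_closed[OF B(1)] D_comp_funpow_bound[OF B(2)] C] by simp
qed

text \<open>\<open>A \<circ> B\<close> is a left combination of the operators
  \<open>D^i \<circ> B\<close>, so left linearity reduces associativity to the case where the first
  factor is a power of \<open>D\<close>.\<close>

lemma diffop_comp_assoc:
  assumes A: "A \<in> UNIV \<rightarrow> carrier K" "\<forall>i>m. A i = \<zero>"
    and B: "B \<in> UNIV \<rightarrow> carrier K" "\<forall>i>n. B i = \<zero>" and C: "C \<in> UNIV \<rightarrow> carrier K"
  shows "diffop_comp K (diffop_comp K A B) C = diffop_comp K A (diffop_comp K B C)"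
proof
  fix k
  have DB: "(D_comp K ^^ i) B \<in> UNIV \<rightarrow> carrier K" for i by (rule D_comp_funpow_closed[OF B(1)])
  then have DB': "(D_comp K ^^ i) B k \<in> carrier K" for i k by auto
  have DBC: "(D_comp K ^^ i) (diffop_comp K B C) k \<in> carrier K" for i k
    using D_comp_funpow_closed[OF diffop_comp_closed[OF B C]] by auto
  have "diffop_comp K A B = (\<lambda>k. \<Oplus>i\<in>{..m}. A i \<otimes> (D_comp K ^^ i) B k)"
    using diffop_comp_eq[OF A DB'] by auto
  then have "diffop_comp K (diffop_comp K A B) C k =
      (\<Oplus>i\<in>{..m}. A i \<otimes> diffop_comp K ((D_comp K ^^ i) B) C k)"
    using A(1) D_comp_funpow_bound[OF B(2)] 
    by (simp only:) (intro diffop_comp_finsum_left[OF _ _ DB _ C, of _ _ "n + m"], auto)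
  also have "\<dots> = diffop_comp K A (diffop_comp K B C) k"
    unfolding diffop_comp_D_comp_funpow[OF B C] using diffop_comp_eq[OF A DBC] by simp
  finally show "diffop_comp K (diffop_comp K A B) C k = diffop_comp K A (diffop_comp K B C) k" .
qed

lemma D_minus_facts:
  assumes "p \<in> carrier K"
  shows "D_minus K p \<in> UNIV \<rightarrow> carrier K" "\<forall>i>1. D_minus K p i = \<zero>"
  using assms by (auto simp: D_minus_def)

lemma D_minus_comp:
  assumes "p \<in> carrier K" "B \<in> UNIV \<rightarrow> carrier K"
  shows "diffop_comp K (D_minus K p) B k = D_comp K B k \<ominus> p \<otimes> B k"
proof -
  have DB: "(D_comp K ^^ i) B k \<in> carrier K" for i k using D_comp_funpow_closed[OF assms(2)] by auto
  have Bc: "B k \<in> carrier K" "D_comp K B k \<in> carrier K" using assms DB[of 1] by auto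
  have "diffop_comp K (D_minus K p) B k = (\<Oplus>i\<in>{..Suc 0}. D_minus K p i \<otimes> (D_comp K ^^ i) B k)"
    using diffop_comp_eq[OF D_minus_facts[OF assms(1)] DB] by simp
  also have "\<dots> = D_comp K B k \<ominus> p \<otimes> B k"
    using Bc assms(1) by (subst finsum_upto_Suc_0) (auto simp: D_minus_def minus_eq l_minus)
  finally show ?thesis .
qed

lemma D_minus_apply:
  assumes "p \<in> carrier K" "y \<in> carrier K"
  shows "diffop_apply K (D_minus K p) y = \<partial> y \<ominus> p \<otimes> y"
proof -
  have "diffop_apply K (D_minus K p) y = (\<Oplus>i\<in>{..Suc 0}. D_minus K p i \<otimes> (der K ^^ i) y)"
    using diffop_apply_eq[OF D_minus_facts[OF assms(1)] assms(2)] by simp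
  also have "\<dots> = \<partial> y \<ominus> p \<otimes> y"
    using der_closed[OF assms(2)] assms
    by (subst finsum_upto_Suc_0) (auto simp: D_minus_def minus_eq l_minus)
  finally show ?thesis .
qed

lemma D_minus_prod_facts:
  assumes "\<And>i. i \<in> {1..m} \<Longrightarrow> p i \<in> carrier K"
  shows "D_minus_prod K p m \<in> UNIV \<rightarrow> carrier K" "\<forall>i>m. D_minus_prod K p m i = \<zero>"
    "D_minus_prod K p m m = \<one>"
proof -
  have "D_minus_prod K p m \<in> UNIV \<rightarrow> carrier K \<and> (\<forall>i>m. D_minus_prod K p m i = \<zero>) \<and>
    D_minus_prod K p m m = \<one>"
    using assms
  proof (induction m)
    case 0
    then show ?case by auto
  next
    case (Suc m)
    let ?B = "D_minus_prod K p m"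
    have B: "?B \<in> UNIV \<rightarrow> carrier K" "\<forall>i>m. ?B i = \<zero>" "?B m = \<one>" using Suc by auto
    have p: "p (Suc m) \<in> carrier K" using Suc.prems by simp
    have "D_minus_prod K p (Suc m) (Suc m) = \<one>"
      using B p by (simp add: D_minus_comp[OF p B(1)] D_comp_def der_zero minus_eq)
    then show ?case
      using diffop_comp_closed[OF D_minus_facts[OF p] B(1)] diffop_comp_bound[OF D_minus_facts[OF p] B(1,2)]
      by simp
  qed
  then show "D_minus_prod K p m \<in> UNIV \<rightarrow> carrier K" "\<forall>i>m. D_minus_prod K p m i = \<zero>"
    "D_minus_prod K p m m = \<one>" by auto
qed

lemma D_minus_prod_apply_Suc:
  assumes "\<And>i. i \<in> {1..Suc m} \<Longrightarrow> p i \<in> carrier K" "y \<in> carrier K"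
  shows "diffop_apply K (D_minus_prod K p (Suc m)) y =
    \<partial> (diffop_apply K (D_minus_prod K p m) y) \<ominus> p (Suc m) \<otimes> diffop_apply K (D_minus_prod K p m) y"
proof -
  have p: "p (Suc m) \<in> carrier K" using assms by simp
  have B: "D_minus_prod K p m \<in> UNIV \<rightarrow> carrier K" "\<forall>i>m. D_minus_prod K p m i = \<zero>"
    using D_minus_prod_facts[of m p] assms by auto
  have c: "diffop_apply K (D_minus_prod K p m) y \<in> carrier K"
    unfolding diffop_apply_eq[OF B assms(2)] using B(1) der_funpow_closed[OF assms(2)]
    by (intro finsum_closed) (auto simp: Pi_iff)
  show ?thesis
    using diffop_apply_comp[OF D_minus_facts[OF p] B assms(2)] D_minus_apply[OF p c] by simp
qed

lemma diffop_apply_closed: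
  assumes "A \<in> UNIV \<rightarrow> carrier K" "\<forall>i>m. A i = \<zero>" "y \<in> carrier K"
  shows "diffop_apply K A y \<in> carrier K"
  unfolding diffop_apply_eq[OF assms] using assms(1) der_funpow_closed[OF assms(3)]
  by (intro finsum_closed) (auto simp: Pi_iff)

lemma diffop_apply_id: "y \<in> carrier K \<Longrightarrow> diffop_apply K (\<lambda>k. if k = 0 then \<one> else \<zero>) y = y"
  by (subst diffop_apply_eq[of _ 0]) auto

text \<open>\<open>D^i\<close> is congruent to \<open>riccati p i\<close> modulo left multiples of \<open>D - p\<close>.\<close>

primrec riccati :: "'a \<Rightarrow> nat \<Rightarrow> 'a" where
  "riccati p 0 = \<one>"
| "riccati p (Suc i) = \<partial> (riccati p i) \<oplus> p \<otimes> riccati p i"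

lemma riccati_closed: "p \<in> carrier K \<Longrightarrow> riccati p i \<in> carrier K"
  by (induction i) (auto intro: der_closed)

text \<open>With \<open>p = u' / u\<close> this turns \<open>L(u) = 0\<close>, after cancelling
  \<open>u\<close>, into an equation in \<open>p\<close> alone.\<close>

lemma der_funpow_riccati:
  assumes "u \<in> carrier K" "p \<in> carrier K" "\<partial> u = p \<otimes> u"
  shows "(der K ^^ i) u = riccati p i \<otimes> u"
proof (induction i)
  case 0
  then show ?case using assms by simp
next
  case (Suc i)
  have *: "riccati p i \<in> carrier K" "\<partial> (riccati p i) \<in> carrier K"
    using riccati_closed[OF assms(2)] der_closed by auto
  have "(der K ^^ Suc i) u = \<partial> (riccati p i) \<otimes> u \<oplus> riccati p i \<otimes> (p \<otimes> u)"
    using Suc * assms by (simp add: der_mult)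
  also have "\<dots> = riccati p (Suc i) \<otimes> u"
    using * assms(1,2) by simp algebra
  finally show ?case .
qed

text \<open>The quotient of \<open>D^i\<close> in right division by \<open>D - p\<close>. If
  \<open>D^i = S (D - p) + r\<close>, then multiplying by \<open>D\<close> and using
  \<open>D r = r (D - p) + (r' + p r)\<close> gives the next quotient \<open>D S + r\<close> and the
  next remainder \<open>r' + p r\<close>.\<close>

primrec riccati_quotient :: "'a \<Rightarrow> nat \<Rightarrow> nat \<Rightarrow> 'a" where
  "riccati_quotient p 0 = (\<lambda>k. \<zero>)"
| "riccati_quotient p (Suc i) =
    (\<lambda>k. D_comp K (riccati_quotient p i) k \<oplus> (if k = 0 then riccati p i else \<zero>))"

lemma riccati_quotient_facts:
  assumes "p \<in> carrier K"
  shows "riccati_quotient p i \<in> UNIV \<rightarrow> carrier K \<and> (\<forall>k\<ge>i. riccati_quotient p i k = \<zero>) \<and>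
    riccati_quotient p (Suc i) i = \<one>"
proof (induction i)
  case 0
  then show ?case by (auto simp: D_comp_def der_zero)
next
  case (Suc i)
  have 1: "riccati_quotient p (Suc i) \<in> UNIV \<rightarrow> carrier K"
    using D_comp_closed[of "riccati_quotient p i"] Suc riccati_closed[OF assms] by auto
  have 2: "\<forall>k\<ge>Suc i. riccati_quotient p (Suc i) k = \<zero>"
    using Suc by (auto simp: D_comp_def der_zero split: nat.split)
  have "riccati_quotient p (Suc (Suc i)) (Suc i) =
      \<partial> (riccati_quotient p (Suc i) (Suc i)) \<oplus> riccati_quotient p (Suc i) i \<oplus> \<zero>"
    by (simp add: D_comp_def[of K "\<lambda>k. D_comp K (riccati_quotient p i) k \<oplus> (if k = 0 then riccati p i else \<zero>)"])
  also have "\<dots> = \<one>" using Suc 2 by (auto simp only: der_zero order.refl l_zero r_zero one_closed)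
  finally show ?case using 1 2 by blast
qed

lemma riccati_division_power:
  assumes "p \<in> carrier K"
  shows "(if k = i then \<one> else \<zero>) =
    diffop_comp K (riccati_quotient p i) (D_minus K p) k \<oplus> (if k = 0 then riccati p i else \<zero>)"
proof (induction i arbitrary: k)
  case 0
  have "diffop_comp K (\<lambda>k. \<zero>) (D_minus K p) k = \<zero>" by (simp add: diffop_comp_def)
  then show ?case by simp
next
  case (Suc i)
  let ?S = "riccati_quotient p" and ?D = "D_minus K p" and ?r = "riccati p i"
  let ?U = "\<lambda>i k. if k = i then \<one> else \<zero>"
  note S = riccati_quotient_facts[OF assms, of i]
  have D: "?D \<in> UNIV \<rightarrow> carrier K" "\<And>k. ?D k \<in> carrier K" using D_minus_facts[OF assms] by auto
  have r: "?r \<in> carrier K" "\<partial> ?r \<in> carrier K" using riccati_closed[OF assms] der_closed by auto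
  have Sc: "?S i \<in> UNIV \<rightarrow> carrier K" "\<forall>k>i. ?S i k = \<zero>" using S by auto
  have SD: "diffop_comp K (?S i) ?D \<in> UNIV \<rightarrow> carrier K"
    by (rule diffop_comp_closed[OF Sc D(1)])
  have DS: "D_comp K (?S i) \<in> UNIV \<rightarrow> carrier K" using D_comp_closed Sc by blast
  have DS': "diffop_comp K (D_comp K (?S i)) ?D = D_comp K (diffop_comp K (?S i) ?D)"
    by (rule diffop_comp_D_comp[OF Sc D(1)])
  have DSD: "D_comp K (diffop_comp K (?S i) ?D) k \<in> carrier K" using D_comp_closed[OF SD] by auto
  \<comment> \<open>The recursion \<open>D S + r\<close> is written as a two-term left combination,
    of \<open>D \<circ> S\<close> and the identity operator, so that left linearity of composition
    applies.\<close>
  define Y where "Y = (\<lambda>j::nat. if j = 0 then D_comp K (?S i) else ?U 0)"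
  define a where "a = (\<lambda>j::nat. if j = 0 then \<one> else ?r)"
  have Yc: "Y j \<in> UNIV \<rightarrow> carrier K" for j using DS by (auto simp: Y_def)
  have Y0: "Y j k = \<zero>" if "Suc i < k" for j k
    using that D_comp_funpow_bound[OF Sc(2), of 1] by (auto simp: Y_def)
  have U0: "diffop_comp K (?U 0) ?D k = ?D k"
    using D by (subst diffop_comp_eq[of _ 0]) (use D(2) in \<open>auto intro: funcset_mem[OF D_comp_funpow_closed[OF D(1)]]\<close>)
  have DSc: "D_comp K (?S i) k \<in> carrier K" for k using DS by auto
  have "?S (Suc i) = (\<lambda>k. \<Oplus>j\<in>{..Suc 0}. a j \<otimes> Y j k)"
    using DSc r by (auto simp: Y_def a_def a_comm)
  then have "diffop_comp K (?S (Suc i)) ?D k = (\<Oplus>j\<in>{..Suc 0}. a j \<otimes> diffop_comp K (Y j) ?D k)"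
    using Y0 r by (simp only:) (intro diffop_comp_finsum_left[OF _ _ Yc _ D(1), of _ _ "Suc i"], auto simp: a_def)
  also have "\<dots> = D_comp K (diffop_comp K (?S i) ?D) k \<oplus> ?r \<otimes> ?D k"
    using DSD r D by (simp add: a_def Y_def U0 DS' a_comm)
  finally have 1: "diffop_comp K (?S (Suc i)) ?D k = D_comp K (diffop_comp K (?S i) ?D) k \<oplus> ?r \<otimes> ?D k" .
  have SDk: "diffop_comp K (?S i) ?D k \<in> carrier K" for k using SD by auto
  have dU: "\<partial> (?U i k) = \<zero>" for i k by (simp add: der_zero der_one)
  have IH: "?U i = (\<lambda>k. diffop_comp K (?S i) ?D k \<oplus> (if k = 0 then ?r else \<zero>))"
    using Suc by (rule ext)
  have "?U (Suc i) k = D_comp K (?U i) k"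
    by (cases k) (auto simp: D_comp_def dU der_zero der_one)
  also have "\<dots> = D_comp K (diffop_comp K (?S i) ?D) k \<oplus> D_comp K (\<lambda>k. if k = 0 then ?r else \<zero>) k"
    unfolding IH using SDk r der_closed[OF SDk]
    by (cases k) (auto simp: D_comp_def der_add der_zero a_ac)
  \<comment> \<open>This is \<open>D r = r (D - p) + (r' + p r)\<close>, compared coefficient by
    coefficient; beyond \<open>k = 1\<close> both sides vanish.\<close>
  also have "D_comp K (\<lambda>k. if k = 0 then ?r else \<zero>) k = ?r \<otimes> ?D k \<oplus> (if k = 0 then riccati p (Suc i) else \<zero>)"
  proof -
    consider "k = 0" | "k = 1" | "k > 1" by linarith
    then show ?thesis
    proof cases
      case 1
      have "\<partial> ?r = ?r \<otimes> (\<ominus> p) \<oplus> (\<partial> ?r \<oplus> p \<otimes> ?r)" using r assms by algebra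
      then show ?thesis using 1 r by (simp add: D_comp_def D_minus_def)
    next
      case 2
      then show ?thesis using r by (simp add: D_comp_def D_minus_def der_zero)
    next
      case 3
      then show ?thesis using r by (auto simp: D_comp_def D_minus_def der_zero split: nat.split)
    qed
  qed
  also have "D_comp K (diffop_comp K (?S i) ?D) k \<oplus> (?r \<otimes> ?D k \<oplus> (if k = 0 then riccati p (Suc i) else \<zero>)) =
      diffop_comp K (?S (Suc i)) ?D k \<oplus> (if k = 0 then riccati p (Suc i) else \<zero>)"
    unfolding 1 using DSD r D riccati_closed[OF assms, of "Suc i"] by (subst a_assoc) auto
  finally show ?case .
qed

text \<open>The divisions of the powers \<open>D^i\<close>, weighted by the coefficients of
  \<open>A\<close>, add up to a division of \<open>A\<close> whose remainder is the sum in
  \<open>zero\<close>. The quotient of \<open>D^(d+1)\<close> is monic of order \<open>d\<close>, so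
  the leading coefficient of \<open>A\<close> is inherited.\<close>

lemma riccati_division:
  assumes p: "p \<in> carrier K" and A: "A \<in> UNIV \<rightarrow> carrier K" "\<forall>i>Suc d. A i = \<zero>"
    and zero: "(\<Oplus>i\<in>{..Suc d}. A i \<otimes> riccati p i) = \<zero>"
  obtains B where "B \<in> UNIV \<rightarrow> carrier K" "\<forall>i>d. B i = \<zero>" "B d = A (Suc d)"
    "A = diffop_comp K B (D_minus K p)"
proof
  let ?S = "riccati_quotient p" and ?D = "D_minus K p"
  have S: "?S i \<in> UNIV \<rightarrow> carrier K" "\<And>k. k \<ge> i \<Longrightarrow> ?S i k = \<zero>" "?S (Suc i) i = \<one>" for i
    using riccati_quotient_facts[OF p, of i] by blast+
  have Sc: "?S i k \<in> carrier K" for i k using S(1)[of i] by auto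
  have Ac: "A i \<in> carrier K" for i using A by auto
  define B where "B = (\<lambda>k. \<Oplus>i\<in>{..Suc d}. A i \<otimes> ?S i k)"
  show "B \<in> UNIV \<rightarrow> carrier K" using Sc Ac by (auto simp: B_def simp del: finsum_Suc intro!: finsum_closed)
  show "\<forall>i>d. B i = \<zero>"
    using S(2) Ac by (auto simp: B_def simp del: finsum_Suc intro!: add.finprod_one_eqI)
  have "B d = A (Suc d) \<otimes> ?S (Suc d) d \<oplus> (\<Oplus>i\<in>{..d}. A i \<otimes> ?S i d)"
    unfolding B_def using Sc Ac by (intro finsum_Suc) auto
  also have "(\<Oplus>i\<in>{..d}. A i \<otimes> ?S i d) = \<zero>"
    using S(2) Ac by (auto intro!: add.finprod_one_eqI)
  finally show "B d = A (Suc d)" using S(3) Ac by simp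
  show "A = diffop_comp K B ?D"
  proof
    fix k
    have SD: "diffop_comp K (?S i) ?D k \<in> carrier K" for i
      using diffop_comp_closed[of "?S i" i ?D] S D_minus_facts[OF p] by auto
    have r: "riccati p i \<in> carrier K" for i by (rule riccati_closed[OF p])
    let ?u = "if k = 0 then \<one> else \<zero>"
    have "A k = (\<Oplus>i\<in>{..Suc d}. A i \<otimes> (if k = i then \<one> else \<zero>))"
    proof (cases "k \<le> Suc d")
      case True
      have "(\<Oplus>i\<in>{..Suc d}. A i \<otimes> (if k = i then \<one> else \<zero>)) = (\<Oplus>i\<in>{..Suc d}. if k = i then A i else \<zero>)"
        using Ac by (intro finsum_cong') auto
      also have "\<dots> = A k" using True Ac by (intro finsum_singleton) auto
      finally show ?thesis by simp
    next
      case False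
      then have "(\<Oplus>i\<in>{..Suc d}. A i \<otimes> (if k = i then \<one> else \<zero>)) = \<zero>"
        using Ac by (intro add.finprod_one_eqI) auto
      then show ?thesis using A(2) False by simp
    qed
    also have "\<dots> = (\<Oplus>i\<in>{..Suc d}. A i \<otimes> diffop_comp K (?S i) ?D k \<oplus> A i \<otimes> riccati p i \<otimes> ?u)"
    proof (intro finsum_cong')
      fix i
      show "A i \<otimes> (if k = i then \<one> else \<zero>) = A i \<otimes> diffop_comp K (?S i) ?D k \<oplus> A i \<otimes> riccati p i \<otimes> ?u"
        unfolding riccati_division_power[OF p, of k i]
        using Ac SD r by (cases "k = 0") (auto simp: r_distr)
    qed (use Ac SD r in auto)
    also have "\<dots> = (\<Oplus>i\<in>{..Suc d}. A i \<otimes> diffop_comp K (?S i) ?D k) \<oplus>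
        (\<Oplus>i\<in>{..Suc d}. A i \<otimes> riccati p i \<otimes> ?u)"
      using Ac SD r by (intro finsum_addf) auto
    also have "(\<Oplus>i\<in>{..Suc d}. A i \<otimes> riccati p i \<otimes> ?u) = (\<Oplus>i\<in>{..Suc d}. A i \<otimes> riccati p i) \<otimes> ?u"
      using Ac r by (intro finsum_ldistr[symmetric]) auto
    also have "\<dots> = \<zero>" unfolding zero by simp
    also have "(\<Oplus>i\<in>{..Suc d}. A i \<otimes> diffop_comp K (?S i) ?D k) = diffop_comp K B ?D k"
      unfolding B_def using Ac S(2) D_minus_facts[OF p] S(1)
      by (intro diffop_comp_finsum_left[symmetric, of _ _ _ "Suc d"]) auto
    finally show "A k = diffop_comp K B ?D k"
      using funcset_mem[OF diffop_comp_closed[OF \<open>B \<in> UNIV \<rightarrow> carrier K\<close> \<open>\<forall>i>d. B i = \<zero>\<close> D_minus_facts(1)[OF p]], of k] by simp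
  qed
qed

end

section \<open>The number of solutions of a product of first-order operators\<close>

context differential_field
begin

lemma constants_subfield: "subfield (constants K) K"
proof (rule subfieldI')
  show "subring (constants K) K"
    by (rule subringI)
      (auto simp: constants_def der_one der_a_inv der_mult der_add)
  fix c assume "c \<in> constants K - {\<zero>}"
  then have "c \<in> carrier K" "c \<noteq> \<zero>" "\<partial> c = \<zero>" by (auto simp: constants_def)
  then show "inv c \<in> constants K"
    using der_quotient_zero[of \<one> c \<zero>] inverse_facts[of c] by (simp add: der_one)
qed

lemma constants_facts:
  "constants K \<subseteq> carrier K" "c \<in> constants K \<Longrightarrow> c \<in> carrier K" "c \<in> constants K \<Longrightarrow> \<partial> c = \<zero>"
  by (auto simp: constants_def)

lemma der_funpow_linear:
  assumes "c \<in> constants K" "x \<in> carrier K" "y \<in> carrier K"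
  shows "(der K ^^ i) (c \<otimes> x \<oplus> y) = c \<otimes> (der K ^^ i) x \<oplus> (der K ^^ i) y"
proof (induction i)
  case 0
  then show ?case by simp
next
  case (Suc i)
  have "c \<in> carrier K" "\<partial> c = \<zero>" "(der K ^^ i) x \<in> carrier K" "(der K ^^ i) y \<in> carrier K"
    "\<partial> ((der K ^^ i) x) \<in> carrier K"
    using assms constants_facts der_funpow_closed der_closed by auto
  then show ?case using Suc by (simp add: der_add der_mult)
qed

lemma diffop_apply_linear:
  assumes A: "A \<in> UNIV \<rightarrow> carrier K" "\<forall>i>m. A i = \<zero>"
    and c: "c \<in> constants K" "x \<in> carrier K" "y \<in> carrier K"
  shows "diffop_apply K A (c \<otimes> x \<oplus> y) = c \<otimes> diffop_apply K A x \<oplus> diffop_apply K A y"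
proof -
  have cc: "c \<in> carrier K" using c constants_facts by auto
  have *: "A i \<in> carrier K" "(der K ^^ i) x \<in> carrier K" "(der K ^^ i) y \<in> carrier K" for i
    using A c der_funpow_closed by auto
  have "diffop_apply K A (c \<otimes> x \<oplus> y) = (\<Oplus>i\<in>{..m}. A i \<otimes> (der K ^^ i) (c \<otimes> x \<oplus> y))"
    using c cc by (intro diffop_apply_eq[OF A]) auto
  also have "\<dots> = (\<Oplus>i\<in>{..m}. c \<otimes> (A i \<otimes> (der K ^^ i) x) \<oplus> A i \<otimes> (der K ^^ i) y)"
    using * cc by (intro finsum_cong') (auto simp: der_funpow_linear[OF c] r_distr m_lcomm)
  also have "\<dots> = (\<Oplus>i\<in>{..m}. c \<otimes> (A i \<otimes> (der K ^^ i) x)) \<oplus> (\<Oplus>i\<in>{..m}. A i \<otimes> (der K ^^ i) y)"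
    using * cc by (intro finsum_addf) auto
  also have "(\<Oplus>i\<in>{..m}. c \<otimes> (A i \<otimes> (der K ^^ i) x)) = c \<otimes> (\<Oplus>i\<in>{..m}. A i \<otimes> (der K ^^ i) x)"
    using * cc by (intro finsum_rdistr[symmetric]) auto
  finally show ?thesis by (simp add: diffop_apply_eq[OF A] c)
qed

lemma Span_closed_diff:
  assumes "subfield C K" "set us \<subseteq> carrier K" "x \<in> Span C us" "y \<in> Span C us" "c \<in> C"
  shows "c \<otimes> x \<oplus> y \<in> Span C us"
  using Span_subgroup_props(3)[OF assms(1,2) Span_smult_closed[OF assms(1,2,5,3)] assms(4)] .

text \<open>Since \<open>T\<close> maps \<open>ys\<close> into the line \<open>C w\<close>, its
  kernel on their span has codimension at most one. The element \<open>v\<close> with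
  \<open>T v = w\<close> is part of the conclusion because the induction uses it to correct each
  further \<open>y\<close> into the kernel.\<close>

lemma independent_elimination:
  assumes C: "subfield C K" and T: "\<And>y. y \<in> carrier K \<Longrightarrow> T y \<in> carrier K"
    and lin: "\<And>c x y. c \<in> C \<Longrightarrow> x \<in> carrier K \<Longrightarrow> y \<in> carrier K \<Longrightarrow> T (c \<otimes> x \<oplus> y) = c \<otimes> T x \<oplus> T y"
    and w: "w \<in> carrier K"
    and "independent C ys" "\<And>y. y \<in> set ys \<Longrightarrow> \<exists>c\<in>C. T y = c \<otimes> w"
  shows "(\<forall>y\<in>set ys. T y = \<zero>) \<or> (\<exists>v\<in>Span C ys. T v = w \<and>
    (\<exists>us. Suc (length us) = length ys \<and> independent C us \<and> set us \<subseteq> Span C ys \<and> (\<forall>u\<in>set us. T u = \<zero>)))"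
  using assms(5,6)
proof (induction ys rule: list.induct)
  case Nil
  then show ?case by simp
next
  case (Cons y ys)
  note ind = independent_backwards[OF Cons.prems(1)]
  have Cc: "c \<in> carrier K" if "c \<in> C" for c using subfieldE(3)[OF C] that by auto
  have ysc: "set ys \<subseteq> carrier K" using independent_in_carrier[OF ind(2)] .
  have yys: "set (y # ys) \<subseteq> carrier K" using ysc ind(3) by simp
  have sub: "Span C ys \<subseteq> Span C (y # ys)" using mono_Span[OF C ysc ind(3)] .
  have base: "set (y # ys) \<subseteq> Span C (y # ys)" using Span_base_incl[OF C yys] .
  have Sc: "Span C ys \<subseteq> carrier K" using Span_subgroup_props(1)[OF C ysc] .
  have z: "\<zero> \<in> Span C (y # ys)" using Span_subgroup_props(2)[OF C yys] .
  have "\<zero> \<in> C" using subringE(2)[OF subfieldE(1)[OF C]] by auto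
  have T0: "T \<zero> = \<zero>"
  proof -
    have "T (\<one> \<otimes> \<zero> \<oplus> \<zero>) = \<one> \<otimes> T \<zero> \<oplus> T \<zero>"
      using subringE(3)[OF subfieldE(1)[OF C]] by (intro lin) auto
    then show ?thesis using T[of \<zero>] by (simp add: add.l_cancel_one')
  qed
  obtain c where c: "c \<in> C" "T y = c \<otimes> w" using Cons.prems(2)[of y] by auto
  note cc = Cc[OF c(1)]
  from Cons.IH[OF ind(2)] Cons.prems(2)
  consider "\<forall>y\<in>set ys. T y = \<zero>" | v us where "v \<in> Span C ys" "T v = w"
      "Suc (length us) = length ys" "independent C us" "set us \<subseteq> Span C ys" "\<forall>u\<in>set us. T u = \<zero>"
    by auto
  then show ?case
  proof cases
    case 1
    show ?thesis
    proof (cases "c = \<zero>")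
      case True
      then show ?thesis using 1 c w by simp
    next
      case False
      have ic: "inv c \<in> C" "inv c \<in> carrier K" "inv c \<otimes> c = \<one>"
        using subfield_m_inv[OF C, of c] inverse_facts[OF cc False] c False by auto
      have "inv c \<otimes> y \<oplus> \<zero> \<in> Span C (y # ys)"
        using base by (intro Span_closed_diff[OF C yys _ z ic(1)]) auto
      moreover have "T (inv c \<otimes> y \<oplus> \<zero>) = w"
        using lin[OF ic(1) ind(3), of \<zero>] T0 ic w cc c(2) by (simp add: m_assoc[symmetric])
      moreover have "set ys \<subseteq> Span C (y # ys)" using base by auto
      ultimately show ?thesis using 1 ind(2) by (intro disjI2 bexI[of _ "inv c \<otimes> y \<oplus> \<zero>"]) auto
    qed
  next
    case 2
    \<comment> \<open>Subtracting \<open>c v\<close> from \<open>y\<close> kills the image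
      \<open>c w\<close>. The result is new modulo \<open>us\<close>, because \<open>v\<close> and
      \<open>us\<close> lie in the span of \<open>ys\<close> and \<open>y\<close> does not.\<close>
    define y' where "y' = \<ominus> c \<otimes> v \<oplus> y"
    have vc: "v \<in> carrier K" using 2 Sc by auto
    have mc: "\<ominus> c \<in> C" using subringE(5)[OF subfieldE(1)[OF C]] c by auto
    have y'c: "y' \<in> carrier K" using vc cc ind(3) by (simp add: y'_def)
    have "T y' = \<ominus> c \<otimes> w \<oplus> c \<otimes> w" using lin[OF mc vc ind(3)] 2 c by (simp add: y'_def)
    also have "\<dots> = \<zero>" using cc w by (simp add: l_minus l_neg)
    finally have Ty': "T y' = \<zero>" .
    have "y' \<notin> Span C us"
    proof
      assume "y' \<in> Span C us"
      then have "y' \<in> Span C ys" using mono_Span_subset[OF C 2(5) ysc] by auto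
      then have "c \<otimes> v \<oplus> y' \<in> Span C ys"
        using 2(1) c by (intro Span_closed_diff[OF C ysc]) auto
      moreover have "c \<otimes> v \<oplus> y' = y" unfolding y'_def using cc vc ind(3) by algebra
      ultimately show False using ind(1) by simp
    qed
    then have "independent C (y' # us)" using 2 y'c by (intro li_Cons) auto
    moreover have "y' \<in> Span C (y # ys)"
      unfolding y'_def using 2 sub base by (intro Span_closed_diff[OF C yys _ _ mc]) auto
    moreover have "set us \<subseteq> Span C (y # ys)" using 2 sub by auto
    ultimately show ?thesis
      using 2 Ty' sub by (intro disjI2 bexI[of _ v] conjI exI[of _ "y' # us"]) auto
  qed
qed

text \<open>Applying the first \<open>m\<close> factors to solutions of \<open>m + 1\<close> factors
  yields solutions of \<open>u' = p (Suc m) u\<close>, a space of dimension at most one over the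
  constants. Dropping the last factor therefore costs at most one solution, and none unless that
  equation has a nonzero solution; so only solvable indices are counted.\<close>

lemma solutions_bound:
  assumes p: "\<And>i. i \<in> {1..m} \<Longrightarrow> p i \<in> carrier K"
    and "independent (constants K) ys" "\<And>y. y \<in> set ys \<Longrightarrow> diffop_apply K (D_minus_prod K p m) y = \<zero>"
  shows "length ys \<le> card {i \<in> {1..m}. \<exists>z\<in>carrier K. z \<noteq> \<zero> \<and> \<partial> z = p i \<otimes> z}"
  using assms
proof (induction m arbitrary: ys)
  case 0
  show ?case
  proof (cases ys)
    case Nil
    then show ?thesis by simp
  next
    case (Cons y us)
    then have ind: "y \<notin> Span (constants K) us" "y \<in> carrier K" "independent (constants K) us"
      using 0(2) independent_backwards by auto
    have "diffop_apply K (D_minus_prod K p 0) y = y" using ind(2) diffop_apply_id by simp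
    then have "y = \<zero>" using 0(3)[of y] Cons by simp
    then show ?thesis
      using ind Span_subgroup_props(2)[OF constants_subfield independent_in_carrier[OF ind(3)]] by simp
  qed
next
  case (Suc m)
  let ?S = "\<lambda>m. {i \<in> {1..m}. \<exists>z\<in>carrier K. z \<noteq> \<zero> \<and> \<partial> z = p i \<otimes> z}"
  let ?B = "D_minus_prod K p m"
  have pm: "p i \<in> carrier K" if "i \<in> {1..m}" for i using Suc.prems(1) that by auto
  have B: "?B \<in> UNIV \<rightarrow> carrier K" "\<forall>i>m. ?B i = \<zero>" using D_minus_prod_facts[OF pm] by auto
  have p: "p (Suc m) \<in> carrier K" using Suc.prems(1) by simp
  have ysc: "set ys \<subseteq> carrier K" by (rule independent_in_carrier[OF Suc.prems(2)])
  have Bc: "diffop_apply K ?B y \<in> carrier K" if "y \<in> carrier K" for y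
    by (rule diffop_apply_closed[OF B that])
  have eq: "\<partial> (diffop_apply K ?B y) = p (Suc m) \<otimes> diffop_apply K ?B y" if y: "y \<in> set ys" for y
  proof -
    have yc: "y \<in> carrier K" using y ysc by auto
    have "\<partial> (diffop_apply K ?B y) \<ominus> p (Suc m) \<otimes> diffop_apply K ?B y = \<zero>"
      using Suc.prems(3)[OF y] D_minus_prod_apply_Suc[where p=p, OF Suc.prems(1) yc] by simp
    then show ?thesis using Bc[OF yc] p der_closed by (metis m_closed r_right_minus_eq)
  qed
  have sub: "?S m \<subseteq> ?S (Suc m)" by auto
  have fin: "finite (?S m)" "finite (?S (Suc m))" by auto
  show ?case
  proof (cases "\<forall>y\<in>set ys. diffop_apply K ?B y = \<zero>")
    case True
    then have "length ys \<le> card (?S m)" using Suc.IH[OF pm Suc.prems(2)] by auto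
    also have "\<dots> \<le> card (?S (Suc m))" by (rule card_mono[OF fin(2) sub])
    finally show ?thesis .
  next
    case False
    then obtain y0 where y0: "y0 \<in> set ys" "diffop_apply K ?B y0 \<noteq> \<zero>" by auto
    define w where "w = diffop_apply K ?B y0"
    have w: "w \<in> carrier K" "w \<noteq> \<zero>" "\<partial> w = p (Suc m) \<otimes> w"
      using y0 Bc ysc eq by (auto simp: w_def)
    have "Suc m \<in> ?S (Suc m)" "Suc m \<notin> ?S m" using w by auto
    then have "?S m \<subset> ?S (Suc m)" using sub by blast
    then have card: "card (?S m) < card (?S (Suc m))"
      by (rule psubset_card_mono[OF fin(2)])
    have sol: "\<exists>c\<in>constants K. diffop_apply K ?B y = c \<otimes> w" if "y \<in> set ys" for y
    proof -
      have y: "diffop_apply K ?B y \<in> carrier K" using that ysc Bc by auto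
      have "diffop_apply K ?B y \<otimes> inv w \<in> constants K"
        by (rule der_quotient_zero[OF y w(1) p w(2) eq[OF that] w(3)])
      moreover have "diffop_apply K ?B y = diffop_apply K ?B y \<otimes> inv w \<otimes> w"
        using inverse_facts[OF w(1,2)] y w(1) by (simp add: m_assoc)
      ultimately show ?thesis by blast
    qed
    obtain us where us: "Suc (length us) = length ys" "independent (constants K) us"
        "\<forall>u\<in>set us. diffop_apply K ?B u = \<zero>"
      using independent_elimination[OF constants_subfield Bc diffop_apply_linear[OF B] w(1) Suc.prems(2) sol]
        False by blast
    have "length us \<le> card (?S m)" using Suc.IH[OF pm us(2)] us(3) by auto
    then show ?thesis using us(1) card by linarith
  qed
qed

lemma der_pow_log:
  assumes "a \<in> carrier K" "r \<in> carrier K" "\<partial> a = a \<otimes> r"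
  shows "\<partial> (a [^] (k::nat)) = a [^] k \<otimes> ([k] \<cdot> r)"
proof (induction k)
  case 0
  then show ?case by (simp add: der_one)
next
  case (Suc k)
  define x where "x = a [^] k" define s where "s = [k] \<cdot> r"
  have *: "x \<in> carrier K" "s \<in> carrier K" using assms by (auto simp: x_def s_def)
  have "\<partial> (a [^] Suc k) = (x \<otimes> s) \<otimes> a \<oplus> x \<otimes> (a \<otimes> r)"
    using Suc assms * by (simp add: der_mult x_def s_def)
  also have "\<dots> = (x \<otimes> a) \<otimes> (s \<oplus> r)" using * assms(1,2) by algebra
  finally show ?case by (simp add: x_def s_def)
qed

lemma D_comp_unit_funpow:
  "(D_comp K ^^ i) (\<lambda>k. if k = 0 then \<one> else \<zero>) = (\<lambda>k. if k = i then \<one> else \<zero>)"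
proof (induction i)
  case 0
  then show ?case by simp
next
  case (Suc i)
  show ?case
    unfolding funpow.simps o_apply Suc
    by (rule ext) (auto simp: D_comp_def der_zero der_one split: nat.split)
qed

lemma diffop_comp_unit_right:
  assumes "A \<in> UNIV \<rightarrow> carrier K" "\<forall>i>m. A i = \<zero>"
  shows "diffop_comp K A (\<lambda>k. if k = 0 then \<one> else \<zero>) = A"
proof
  fix k
  have Ac: "A i \<in> carrier K" for i using assms(1) by auto
  have "diffop_comp K A (\<lambda>k. if k = 0 then \<one> else \<zero>) k = (\<Oplus>i\<in>{..m}. A i \<otimes> (if k = i then \<one> else \<zero>))"
    by (subst diffop_comp_eq[OF assms]) (auto simp: D_comp_unit_funpow)
  also have "\<dots> = (\<Oplus>i\<in>{..m}. if k = i then A i else \<zero>)"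
    using Ac by (intro finsum_cong') auto
  also have "\<dots> = A k"
  proof (cases "k \<le> m")
    case True
    then show ?thesis using Ac by (intro finsum_singleton) auto
  next
    case False
    then show ?thesis using assms(2) by (auto intro!: add.finprod_one_eqI)
  qed
  finally show "diffop_comp K A (\<lambda>k. if k = 0 then \<one> else \<zero>) k = A k" .
qed

end


section \<open>Solutions of the Riccati equation descend along places\<close>

context differential_place
begin

lemma V_nat_mult: "x \<in> V \<Longrightarrow> [(k::nat)] \<cdot> x \<in> V"
  by (induction k) (auto intro: V_facts)

lemma residue_zero_mult:
  assumes "residue t \<zero>" "x \<in> V"
  shows "residue (t \<otimes> x) \<zero>"
proof -
  obtain c where c: "residue x c" using ex_residue[OF assms(2)] by auto
  then show ?thesis using residue_mult[OF assms(1) c] residue_closed[OF c] by simp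
qed

lemma residue_riccati:
  assumes "residue x c"
  shows "residue (riccati x i) (riccati c i)"
  by (induction i) (auto intro: residue_const F_facts residue_add residue_der residue_mult assms)

text \<open>If \<open>x = u / w\<^sup>e\<close> had a pole, then \<open>riccati x i\<close> would have the leading term \<open>(u / w\<^sup>e)\<^sup>i\<close>, and the
  term of index \<open>n\<close> of the Riccati equation could not cancel.\<close>

lemma riccati_pole:
  assumes x: "x \<in> carrier K" and u: "residue u c" "c \<noteq> \<zero>" and e: "x \<otimes> w [^] (e::nat) = u" "e \<noteq> 0"
    and A: "\<And>i. i \<le> n \<Longrightarrow> A i \<in> F" "A n \<noteq> \<zero>"
  shows "(\<Oplus>i\<in>{..n}. A i \<otimes> riccati x i) \<noteq> \<zero>"
proof
  assume zero: "(\<Oplus>i\<in>{..n}. A i \<otimes> riccati x i) = \<zero>"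
  note uc = residue_closed[OF u(1)]
  have wc: "w \<in> carrier K" using w_in_V V_facts by auto
  \<comment> \<open>\<open>t\<close> clears the pole: \<open>x t = u\<close> has the nonzero residue
    \<open>c\<close>, while \<open>t\<close> itself has residue zero.\<close>
  define t where "t = w [^] e"
  have t: "t \<in> carrier K" "t \<in> V" "residue t \<zero>"
    using wc V_pow[OF w_in_V, of e] residue_w_pow[of e] e by (auto simp: t_def)
  obtain r where r: "r \<in> V" "\<partial> w = w \<otimes> r" using der_w by auto
  define r' where "r' = [e] \<cdot> r"
  have r': "r' \<in> V" "r' \<in> carrier K" "\<partial> t = t \<otimes> r'"
    using r V_nat_mult[OF r(1)] V_facts der_pow_log[OF wc _ r(2), of e] by (auto simp: r'_def t_def)
  \<comment> \<open>Differentiation does not raise the pole order, since \<open>w' / w\<close> is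
    regular; after multiplication by the extra factor \<open>t\<close> its contribution has residue
    zero, and only the product with \<open>x\<close> survives.\<close>
  have s: "residue (riccati x i \<otimes> t [^] i) (c [^] i)" for i
  proof (induction i)
    case 0
    then show ?case by (simp add: residue_const F_facts)
  next
    case (Suc i)
    define R where "R = riccati x i" define T where "T = t [^] i" define k where "k = [i] \<cdot> r'"
    have *: "R \<in> carrier K" "T \<in> carrier K" "k \<in> carrier K" "\<partial> R \<in> carrier K" "k \<in> V"
      using riccati_closed[OF x, of i] t r' der_closed V_nat_mult[OF r'(1)] V_facts
      by (auto simp: R_def T_def k_def)
    have IH: "residue (R \<otimes> T) (c [^] i)" using Suc by (simp add: R_def T_def)
    have dT: "\<partial> T = T \<otimes> k" unfolding T_def k_def by (rule der_pow_log[OF t(1) r'(2,3)])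
    have "riccati x (Suc i) \<otimes> t [^] Suc i = (\<partial> R \<oplus> x \<otimes> R) \<otimes> (T \<otimes> t)"
      by (simp add: R_def T_def)
    also have "\<dots> = t \<otimes> ((\<partial> R \<otimes> T \<oplus> R \<otimes> (T \<otimes> k)) \<ominus> (R \<otimes> T) \<otimes> k) \<oplus> (x \<otimes> t) \<otimes> (R \<otimes> T)"
      using *(1-4) t(1) x by algebra
    also have "\<dots> = t \<otimes> (\<partial> (R \<otimes> T) \<ominus> (R \<otimes> T) \<otimes> k) \<oplus> u \<otimes> (R \<otimes> T)"
      using * dT e by (simp add: der_mult t_def)
    finally have eq: "riccati x (Suc i) \<otimes> t [^] Suc i = t \<otimes> (\<partial> (R \<otimes> T) \<ominus> (R \<otimes> T) \<otimes> k) \<oplus> u \<otimes> (R \<otimes> T)" .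
    have RT: "R \<otimes> T \<in> V" using residue_closed[OF IH] by auto
    then have "\<partial> (R \<otimes> T) \<ominus> (R \<otimes> T) \<otimes> k \<in> V" using der_in_V V_facts * by (auto simp: minus_eq)
    then have "residue (riccati x (Suc i) \<otimes> t [^] Suc i) (\<zero> \<oplus> c \<otimes> c [^] i)"
      unfolding eq by (intro residue_add residue_zero_mult t residue_mult u IH)
    then show ?case using uc by (simp add: m_comm)
  qed
  have rc: "riccati x i \<in> carrier K" for i by (rule riccati_closed[OF x])
  have Ac: "A i \<in> carrier K" if "i \<le> n" for i using A(1)[OF that] F_carrier by auto
  \<comment> \<open>The equation is multiplied by \<open>t^n\<close>, split into \<open>t^i\<close>,
    which makes the term of index \<open>i\<close> regular, and a surplus
    \<open>t^(n - i)\<close>.\<close>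
  have "(\<Oplus>i\<in>{..n}. A i \<otimes> (riccati x i \<otimes> t [^] i) \<otimes> t [^] (n - i)) =
      (\<Oplus>i\<in>{..n}. (A i \<otimes> riccati x i) \<otimes> t [^] n)"
  proof (intro finsum_cong' refl)
    fix i assume i: "i \<in> {..n}"
    then have "t [^] n = t [^] i \<otimes> t [^] (n - i)" using t by (simp add: nat_pow_mult)
    then show "A i \<otimes> (riccati x i \<otimes> t [^] i) \<otimes> t [^] (n - i) = (A i \<otimes> riccati x i) \<otimes> t [^] n"
      using i rc[of i] Ac[of i] t by (simp add: m_assoc)
  qed (use rc Ac t in auto)
  also have "\<dots> = (\<Oplus>i\<in>{..n}. A i \<otimes> riccati x i) \<otimes> t [^] n"
    using rc Ac t by (intro finsum_ldistr[symmetric]) auto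
  also have "\<dots> = \<zero>" using zero t by simp
  finally have sum0: "(\<Oplus>i\<in>{..n}. A i \<otimes> (riccati x i \<otimes> t [^] i) \<otimes> t [^] (n - i)) = \<zero>" .
  \<comment> \<open>Only \<open>i = n\<close> has no surplus factor \<open>t\<close>, so the residue
    of the sum is the nonzero element \<open>A n c^n\<close>, contradicting that the sum is
    zero.\<close>
  have "residue (\<Oplus>i\<in>{..n}. A i \<otimes> (riccati x i \<otimes> t [^] i) \<otimes> t [^] (n - i))
      (\<Oplus>i\<in>{..n}. if n = i then A i \<otimes> c [^] i else \<zero>)"
  proof (rule residue_finsum)
    fix i assume i: "i \<in> {..n}"
    have tr: "residue (t [^] (n - i)) (if n = i then \<one> else \<zero>)"
    proof (cases "n = i")
      case True
      then show ?thesis by (simp add: residue_const F_facts)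
    next
      case False
      then obtain j where "n - i = Suc j" using i by (cases "n - i") auto
      then show ?thesis using False residue_zero_mult[OF t(3) V_pow[OF t(2), of j]] t
        by (simp add: m_comm)
    qed
    have "residue (A i \<otimes> (riccati x i \<otimes> t [^] i) \<otimes> t [^] (n - i)) (A i \<otimes> c [^] i \<otimes> (if n = i then \<one> else \<zero>))"
      using i by (intro residue_mult s tr residue_const A) auto
    then show "residue (A i \<otimes> (riccati x i \<otimes> t [^] i) \<otimes> t [^] (n - i)) (if n = i then A i \<otimes> c [^] i else \<zero>)"
      using i Ac uc by (auto split: if_splits)
  qed simp
  moreover have "(\<Oplus>i\<in>{..n}. if n = i then A i \<otimes> c [^] i else \<zero>) = A n \<otimes> c [^] n"
    using Ac uc by (intro finsum_singleton) auto
  ultimately have "residue \<zero> (A n \<otimes> c [^] n)" using sum0 by simp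
  then have "A n \<otimes> c [^] n = \<zero>" using residue_unique residue_const F_facts by blast
  then show False using A(2) Ac[of n] pow_nonzero[OF uc(2) u(2), of n] integral uc by blast
qed

lemma riccati_descent:
  assumes x: "x \<in> generate_field K (insert w F)" and A: "\<And>i. i \<le> n \<Longrightarrow> A i \<in> F" "A n \<noteq> \<zero>"
    and zero: "(\<Oplus>i\<in>{..n}. A i \<otimes> riccati x i) = \<zero>"
  shows "\<exists>c\<in>F. (\<Oplus>i\<in>{..n}. A i \<otimes> riccati c i) = \<zero>"
proof -
  have wc: "w \<in> carrier K" using w_in_V V_facts by auto
  have xc: "x \<in> carrier K"
    using x generate_field_in_carrier[of "insert w F"] F_facts wc by auto
  have "x \<in> V"
  proof (cases "x = \<zero>")
    case True
    then show ?thesis using V_facts by simp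
  next
    case False
    obtain u c e where u: "residue u c" "c \<noteq> \<zero>" "x = w [^] (e::nat) \<otimes> u \<or> x \<otimes> w [^] e = u"
      using factorization[OF x False] by metis
    from u(3) show ?thesis
    proof
      assume "x = w [^] e \<otimes> u"
      then show ?thesis using V_pow[OF w_in_V] V_facts residue_closed[OF u(1)] by auto
    next
      assume e: "x \<otimes> w [^] e = u"
      then have "e = 0" using riccati_pole[where A=A and n=n, OF xc u(1,2) e _ A] zero by blast
      then show ?thesis using e xc residue_closed[OF u(1)] by simp
    qed
  qed
  then obtain c where c: "residue x c" using ex_residue by auto
  have "residue (\<Oplus>i\<in>{..n}. A i \<otimes> riccati x i) (\<Oplus>i\<in>{..n}. A i \<otimes> riccati c i)"
    by (intro residue_finsum residue_mult residue_riccati c residue_const A) auto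
  then have "(\<Oplus>i\<in>{..n}. A i \<otimes> riccati c i) = \<zero>"
    using zero residue_unique residue_const F_facts by metis
  then show ?thesis using residue_closed[OF c] by auto
qed

end

section \<open>From admissible extensions to factorizations\<close>

lemma (in differential_field) D_minus_prod_cong:
  assumes "\<And>i. i \<in> {1..m} \<Longrightarrow> p i = q i"
  shows "D_minus_prod K p m = D_minus_prod K q m"
  using assms by (induction m) auto

locale special_chain = differential_field K
  for K :: "('a, 'm) differential_ring_scheme" (structure) +
  fixes F :: "nat \<Rightarrow> 'a set" and r :: nat
  assumes subfields: "i \<le> r \<Longrightarrow> differential_subfield (F i) K"
    and steps: "i < r \<Longrightarrow> \<exists>y. special_transcendental K (F i) y \<and> F (Suc i) = generate_field K (insert y (F i))"
begin

lemma place_step: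
  assumes "i < r"
  obtains V w where "differential_place K (F i) V w" "F (Suc i) = generate_field K (insert w (F i))"
  using steps[OF assms] place_of_special[OF subfields[of i]] assms by (metis less_imp_le)

lemma chain_mono: "i \<le> j \<Longrightarrow> j \<le> r \<Longrightarrow> F i \<subseteq> F j"
proof (induction j rule: dec_induct)
  case base
  then show ?case by simp
next
  case (step j)
  then obtain y where "F (Suc j) = generate_field K (insert y (F j))"
    using steps[of j] by auto
  then have "F j \<subseteq> F (Suc j)" using generate_field.incl[of _ "insert y (F j)" K] by blast
  then show ?case using step by auto
qed

lemma riccati_descent_chain:
  assumes "x \<in> F r" and A: "\<And>i. i \<le> n \<Longrightarrow> A i \<in> F 0" "A n \<noteq> \<zero>"
    and "(\<Oplus>i\<in>{..n}. A i \<otimes> riccati x i) = \<zero>"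
  shows "\<exists>c\<in>F 0. (\<Oplus>i\<in>{..n}. A i \<otimes> riccati c i) = \<zero>"
proof -
  have "\<exists>c\<in>F j. (\<Oplus>i\<in>{..n}. A i \<otimes> riccati c i) = \<zero>" if "j \<le> r" for j
    using that
  proof (induction j rule: inc_induct)
    case base
    then show ?case using assms by auto
  next
    case (step j)
    then obtain c where c: "c \<in> F (Suc j)" "(\<Oplus>i\<in>{..n}. A i \<otimes> riccati c i) = \<zero>" by auto
    obtain V w where V: "differential_place K (F j) V w" "F (Suc j) = generate_field K (insert w (F j))"
      using place_step[OF step.hyps(2)] by metis
    have "A i \<in> F j" if "i \<le> n" for i using A(1)[OF that] chain_mono[of 0 j] step.hyps by auto
    then show ?case
      using differential_place.riccati_descent[OF V(1), of c n A] A(2) c V(2) by auto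
  qed
  then show ?thesis by blast
qed

lemma root_descent_chain:
  assumes "g \<in> F r" "0 < (m::nat)" "g [^] m \<in> F 0" "constants K \<subseteq> F 0"
  shows "g \<in> F 0"
proof -
  have "g \<in> F j" if "j \<le> r" for j
    using that
  proof (induction j rule: inc_induct)
    case base
    then show ?case using assms by auto
  next
    case (step j)
    obtain V w where V: "differential_place K (F j) V w" "F (Suc j) = generate_field K (insert w (F j))"
      using place_step[OF step.hyps(2)] by metis
    have "F 0 \<subseteq> F j" using chain_mono[of 0 j] step.hyps by auto
    then have "g [^] m \<in> F j" "constants K \<subseteq> F j" using assms(3,4) by blast+
    then show ?case
      using differential_place.root_in_base_field[OF V(1) _ assms(2)] step.IH V(2) by blast
  qed
  then show ?thesis by blast
qed

end

section \<open>Transport of operators along an extension and factorization over the base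
  field\<close>

context differential_extension
begin

sublocale hom: ring_hom_cring K E \<phi>
  by (intro ring_hom_cring.intro ring_hom_cring_axioms.intro K.is_cring E.is_cring hom)

lemma hom_carrier: "a \<in> carrier K \<Longrightarrow> \<phi> a \<in> carrier E"
  by simp

lemma hom_eq_zero_iff:
  assumes "a \<in> carrier K"
  shows "\<phi> a = \<zero>\<^bsub>E\<^esub> \<longleftrightarrow> a = \<zero>\<^bsub>K\<^esub>"
proof
  assume 0: "\<phi> a = \<zero>\<^bsub>E\<^esub>"
  show "a = \<zero>\<^bsub>K\<^esub>"
  proof (rule ccontr)
    assume "a \<noteq> \<zero>\<^bsub>K\<^esub>"
    note ia = K.inverse_facts[OF assms this]
    have "\<phi> a \<otimes>\<^bsub>E\<^esub> \<phi> (inv\<^bsub>K\<^esub> a) = \<one>\<^bsub>E\<^esub>"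
      using hom.hom_mult[OF assms ia(1)] ia(2) by simp
    then show False using 0 ia(1) by simp
  qed
qed simp

lemma hom_inj: "inj_on \<phi> (carrier K)"
proof (rule inj_onI)
  fix a b assume ab: "a \<in> carrier K" "b \<in> carrier K" "\<phi> a = \<phi> b"
  then have "\<phi> (a \<ominus>\<^bsub>K\<^esub> b) = \<zero>\<^bsub>E\<^esub>"
    by (simp add: K.minus_eq E.r_neg)
  then show "a = b" using hom_eq_zero_iff[of "a \<ominus>\<^bsub>K\<^esub> b"] ab by simp
qed

lemma hom_comp_closed: "A \<in> UNIV \<rightarrow> carrier K \<Longrightarrow> \<phi> \<circ> A \<in> UNIV \<rightarrow> carrier E"
  by (auto simp: Pi_iff)

lemma hom_D_comp:
  assumes "B \<in> UNIV \<rightarrow> carrier K"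
  shows "\<phi> \<circ> D_comp K B = D_comp E (\<phi> \<circ> B)"
proof
  fix k
  have "B j \<in> carrier K" "\<partial>\<^bsub>K\<^esub> (B j) \<in> carrier K" "\<partial>\<^bsub>E\<^esub> (\<phi> (B j)) \<in> carrier E" for j
    using funcset_mem[OF assms, of j] K.der_closed E.der_closed hom_carrier by auto
  then show "(\<phi> \<circ> D_comp K B) k = D_comp E (\<phi> \<circ> B) k"
    by (cases k) (auto simp: D_comp_def hom_der)
qed

lemma hom_D_comp_funpow:
  assumes "B \<in> UNIV \<rightarrow> carrier K"
  shows "\<phi> \<circ> (D_comp K ^^ i) B = (D_comp E ^^ i) (\<phi> \<circ> B)"
proof (induction i)
  case 0
  then show ?case by simp
next
  case (Suc i)
  show ?case
    unfolding funpow.simps o_apply hom_D_comp[OF K.D_comp_funpow_closed[OF assms]] Suc ..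
qed

lemma hom_diffop_comp:
  assumes A: "A \<in> UNIV \<rightarrow> carrier K" "\<forall>i>m. A i = \<zero>\<^bsub>K\<^esub>" and B: "B \<in> UNIV \<rightarrow> carrier K"
  shows "\<phi> \<circ> diffop_comp K A B = diffop_comp E (\<phi> \<circ> A) (\<phi> \<circ> B)"
proof
  fix k
  have D: "(D_comp K ^^ i) B k \<in> carrier K" for i k using K.D_comp_funpow_closed[OF B] by auto
  have Ac: "A i \<in> carrier K" for i using A(1) by auto
  have D': "(D_comp E ^^ i) (\<phi> \<circ> B) k = \<phi> ((D_comp K ^^ i) B k)" for i k
    using fun_cong[OF hom_D_comp_funpow[OF B, of i], of k] by simp
  have "\<phi> (diffop_comp K A B k) = (\<Oplus>\<^bsub>E\<^esub>i\<in>{..m}. \<phi> (A i \<otimes>\<^bsub>K\<^esub> (D_comp K ^^ i) B k))"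
    unfolding K.diffop_comp_eq[OF A D] using Ac D by (subst hom.hom_finsum) (auto simp: comp_def)
  also have "\<dots> = (\<Oplus>\<^bsub>E\<^esub>i\<in>{..m}. (\<phi> \<circ> A) i \<otimes>\<^bsub>E\<^esub> (D_comp E ^^ i) (\<phi> \<circ> B) k)"
    using Ac D by (intro E.finsum_cong') (auto simp: D')
  also have "\<dots> = diffop_comp E (\<phi> \<circ> A) (\<phi> \<circ> B) k"
    using A Ac D by (intro E.diffop_comp_eq[symmetric]) (auto simp: D')
  finally show "(\<phi> \<circ> diffop_comp K A B) k = diffop_comp E (\<phi> \<circ> A) (\<phi> \<circ> B) k" by simp
qed

lemma hom_D_minus:
  assumes "p \<in> carrier K"
  shows "\<phi> \<circ> D_minus K p = D_minus E (\<phi> p)"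
  using assms by (auto simp: D_minus_def)

lemma hom_D_minus_prod:
  assumes "\<And>i. i \<in> {1..m} \<Longrightarrow> p i \<in> carrier K"
  shows "\<phi> \<circ> D_minus_prod K p m = D_minus_prod E (\<phi> \<circ> p) m"
  using assms
proof (induction m)
  case 0
  then show ?case by auto
next
  case (Suc m)
  have p: "p (Suc m) \<in> carrier K" "\<And>i. i \<in> {1..m} \<Longrightarrow> p i \<in> carrier K" using Suc.prems by auto
  have "\<phi> \<circ> D_minus_prod K p (Suc m) = diffop_comp E (\<phi> \<circ> D_minus K (p (Suc m))) (\<phi> \<circ> D_minus_prod K p m)"
    unfolding D_minus_prod.simps
    by (rule hom_diffop_comp[OF K.D_minus_facts[OF p(1)] K.D_minus_prod_facts(1)[OF p(2)]])
  moreover have "D_minus E ((\<phi> \<circ> p) (Suc m)) = \<phi> \<circ> D_minus K (p (Suc m))"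
    using hom_D_minus[OF p(1)] by (metis comp_apply)
  ultimately show ?case
    by (simp only: D_minus_prod.simps(2)[of E] Suc.IH[OF p(2), symmetric])
qed

lemma hom_riccati:
  assumes "p \<in> carrier K"
  shows "\<phi> (K.riccati p i) = E.riccati (\<phi> p) i"
proof (induction i)
  case 0
  then show ?case by simp
next
  case (Suc i)
  then show ?case
    using assms K.riccati_closed[OF assms, of i] K.der_closed hom_der[OF K.riccati_closed[OF assms, of i]]
    by simp
qed

lemma constants_in_image: "constants E \<subseteq> \<phi> ` carrier K"
  using no_new_constants by (auto simp: constants_def)

text \<open>The logarithmic derivative of \<open>u\<close> solves the Riccati equation of
  \<open>A\<close> in \<open>E\<close>; descending the chain replaces it by a solution
  \<open>p\<close> in \<open>K\<close>, which need not be the logarithmic derivative of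
  \<open>u\<close>, and division by \<open>D - p\<close> leaves no remainder.\<close>

lemma factorization_step:
  assumes chain: "special_chain E F r" "F 0 = \<phi> ` carrier K" "F r = carrier E"
    and A: "A \<in> UNIV \<rightarrow> carrier K" "\<forall>i>Suc d. A i = \<zero>\<^bsub>K\<^esub>" "A (Suc d) \<noteq> \<zero>\<^bsub>K\<^esub>"
    and u: "u \<in> carrier E" "u \<noteq> \<zero>\<^bsub>E\<^esub>" "diffop_apply E (\<phi> \<circ> A) u = \<zero>\<^bsub>E\<^esub>"
  obtains B p where "p \<in> carrier K" "B \<in> UNIV \<rightarrow> carrier K" "\<forall>i>d. B i = \<zero>\<^bsub>K\<^esub>" "B d = A (Suc d)"
    "A = diffop_comp K B (D_minus K p)"
proof -
  define \<rho> where "\<rho> = \<partial>\<^bsub>E\<^esub> u \<otimes>\<^bsub>E\<^esub> inv\<^bsub>E\<^esub> u"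
  note iu = E.inverse_facts[OF u(1,2)]
  have \<rho>: "\<rho> \<in> carrier E" "\<partial>\<^bsub>E\<^esub> u = \<rho> \<otimes>\<^bsub>E\<^esub> u"
    using iu E.der_closed[OF u(1)] u(1) by (auto simp: \<rho>_def E.m_assoc)
  have Ac: "A i \<in> carrier K" for i using A(1) by auto
  have rc: "E.riccati \<rho> i \<in> carrier E" for i by (rule E.riccati_closed[OF \<rho>(1)])
  have "diffop_apply E (\<phi> \<circ> A) u = (\<Oplus>\<^bsub>E\<^esub>i\<in>{..Suc d}. \<phi> (A i) \<otimes>\<^bsub>E\<^esub> (der E ^^ i) u)"
    using Ac A(2) u by (subst E.diffop_apply_eq) auto
  also have "\<dots> = (\<Oplus>\<^bsub>E\<^esub>i\<in>{..Suc d}. (\<phi> (A i) \<otimes>\<^bsub>E\<^esub> E.riccati \<rho> i) \<otimes>\<^bsub>E\<^esub> u)"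
    using Ac rc u by (intro E.finsum_cong') (auto simp: E.der_funpow_riccati[OF u(1) \<rho>] E.m_assoc)
  also have "\<dots> = (\<Oplus>\<^bsub>E\<^esub>i\<in>{..Suc d}. \<phi> (A i) \<otimes>\<^bsub>E\<^esub> E.riccati \<rho> i) \<otimes>\<^bsub>E\<^esub> u"
    using Ac rc u by (intro E.finsum_ldistr[symmetric]) auto
  finally have "(\<Oplus>\<^bsub>E\<^esub>i\<in>{..Suc d}. \<phi> (A i) \<otimes>\<^bsub>E\<^esub> E.riccati \<rho> i) \<otimes>\<^bsub>E\<^esub> u = \<zero>\<^bsub>E\<^esub>"
    using u(3) by simp
  moreover have "(\<Oplus>\<^bsub>E\<^esub>i\<in>{..Suc d}. \<phi> (A i) \<otimes>\<^bsub>E\<^esub> E.riccati \<rho> i) \<in> carrier E"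
    using Ac rc by (intro E.finsum_closed) auto
  ultimately have "(\<Oplus>\<^bsub>E\<^esub>i\<in>{..Suc d}. \<phi> (A i) \<otimes>\<^bsub>E\<^esub> E.riccati \<rho> i) = \<zero>\<^bsub>E\<^esub>"
    using E.integral u by blast
  then obtain c where c: "c \<in> F 0" "(\<Oplus>\<^bsub>E\<^esub>i\<in>{..Suc d}. \<phi> (A i) \<otimes>\<^bsub>E\<^esub> E.riccati c i) = \<zero>\<^bsub>E\<^esub>"
    using special_chain.riccati_descent_chain[OF chain(1), of \<rho> "Suc d" "\<lambda>i. \<phi> (A i)"] \<rho> chain(2,3) Ac
      A(3) hom_eq_zero_iff by auto
  obtain p where p: "p \<in> carrier K" "c = \<phi> p" using c(1) chain(2) by auto
  have rp: "K.riccati p i \<in> carrier K" for i by (rule K.riccati_closed[OF p(1)])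
  have "\<phi> (\<Oplus>\<^bsub>K\<^esub>i\<in>{..Suc d}. A i \<otimes>\<^bsub>K\<^esub> K.riccati p i) = (\<Oplus>\<^bsub>E\<^esub>i\<in>{..Suc d}. \<phi> (A i) \<otimes>\<^bsub>E\<^esub> E.riccati c i)"
    using Ac rp by (subst hom.hom_finsum) (auto simp: comp_def p(2) hom_riccati[OF p(1), symmetric] intro!: E.finsum_cong')
  then have zero: "(\<Oplus>\<^bsub>K\<^esub>i\<in>{..Suc d}. A i \<otimes>\<^bsub>K\<^esub> K.riccati p i) = \<zero>\<^bsub>K\<^esub>"
    using c(2) Ac rp by (subst hom_eq_zero_iff[symmetric]) (auto intro!: K.finsum_closed simp del: K.finsum_Suc)
  show ?thesis
    by (rule K.riccati_division[OF p(1) A(1,2) zero]) (rule that[OF p(1)])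
qed

text \<open>\<open>m\<close> right factors have been split off and the left factor \<open>A\<close>
  has order \<open>n - m\<close>. A product of \<open>m\<close> factors annihilates at most
  \<open>m\<close> independent elements, so for \<open>m < n\<close> some solution \<open>y\<close>
  survives it, and its image is a nonzero solution of \<open>A\<close> from which the next factor is
  obtained.\<close>

lemma factorization_of_solutions:
  assumes chain: "special_chain E F r" "F 0 = \<phi> ` carrier K" "F r = carrier E"
    and L: "L \<in> UNIV \<rightarrow> carrier K" "\<forall>i>n. L i = \<zero>\<^bsub>K\<^esub>" "L n \<noteq> \<zero>\<^bsub>K\<^esub>"
    and ys: "length ys = n" "E.independent (constants E) ys"
      "\<And>y. y \<in> set ys \<Longrightarrow> diffop_apply E (\<phi> \<circ> L) y = \<zero>\<^bsub>E\<^esub>"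
    and "m \<le> n"
  shows "\<exists>A p. (\<forall>i\<in>{1..m}. p i \<in> carrier K) \<and> A \<in> UNIV \<rightarrow> carrier K \<and> (\<forall>i>n - m. A i = \<zero>\<^bsub>K\<^esub>) \<and>
    A (n - m) = L n \<and> L = diffop_comp K A (D_minus_prod K p m)"
  using \<open>m \<le> n\<close>
proof (induction m)
  case 0
  show ?case
    by (intro exI[of _ L]) (use L K.diffop_comp_unit_right[OF L(1,2)] in auto)
next
  case (Suc m)
  obtain A p where p: "\<forall>i\<in>{1..m}. p i \<in> carrier K"
    and A: "A \<in> UNIV \<rightarrow> carrier K" "\<forall>i>n - m. A i = \<zero>\<^bsub>K\<^esub>" "A (n - m) = L n"
      "L = diffop_comp K A (D_minus_prod K p m)"
    using Suc.IH[OF Suc_leD[OF Suc.prems]] by blast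
  have p: "\<And>i. i \<in> {1..m} \<Longrightarrow> p i \<in> carrier K" using p by blast
  define d where "d = n - Suc m"
  have d: "n - m = Suc d" using Suc.prems by (simp add: d_def)
  let ?P = "D_minus_prod K p m" and ?PE = "D_minus_prod E (\<phi> \<circ> p) m"
  have P: "?P \<in> UNIV \<rightarrow> carrier K" "\<forall>i>m. ?P i = \<zero>\<^bsub>K\<^esub>" using K.D_minus_prod_facts(1,2)[where p=p, OF p] by blast+
  have pE: "(\<phi> \<circ> p) i \<in> carrier E" if "i \<in> {1..m}" for i using p that by auto
  have PE: "?PE \<in> UNIV \<rightarrow> carrier E" "\<forall>i>m. ?PE i = \<zero>\<^bsub>E\<^esub>" using E.D_minus_prod_facts(1,2)[where p="\<phi> \<circ> p", OF pE] by blast+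
  have AE: "\<phi> \<circ> A \<in> UNIV \<rightarrow> carrier E" "\<forall>i>n - m. (\<phi> \<circ> A) i = \<zero>\<^bsub>E\<^esub>"
    using hom_comp_closed[OF A(1)] A(2) by auto
  have ysc: "set ys \<subseteq> carrier E" by (rule E.independent_in_carrier[OF ys(2)])
  have "\<exists>y\<in>set ys. diffop_apply E ?PE y \<noteq> \<zero>\<^bsub>E\<^esub>"
  proof (rule ccontr)
    assume "\<not> ?thesis"
    then have z: "\<And>y. y \<in> set ys \<Longrightarrow> diffop_apply E ?PE y = \<zero>\<^bsub>E\<^esub>" by blast
    have "length ys \<le> card {i \<in> {1..m}. \<exists>z\<in>carrier E. z \<noteq> \<zero>\<^bsub>E\<^esub> \<and> \<partial>\<^bsub>E\<^esub> z = (\<phi> \<circ> p) i \<otimes>\<^bsub>E\<^esub> z}"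
      by (rule E.solutions_bound[OF pE ys(2) z])
    also have "\<dots> \<le> card {1..m}" by (intro card_mono) auto
    finally show False using ys(1) Suc.prems by simp
  qed
  then obtain y where y: "y \<in> set ys" "y \<in> carrier E" "diffop_apply E ?PE y \<noteq> \<zero>\<^bsub>E\<^esub>" using ysc by auto
  have "\<phi> \<circ> L = diffop_comp E (\<phi> \<circ> A) ?PE"
    unfolding A(4) using hom_diffop_comp[OF A(1,2) P(1)] hom_D_minus_prod[of m p] p A(4) by simp
  then have "diffop_apply E (\<phi> \<circ> A) (diffop_apply E ?PE y) = \<zero>\<^bsub>E\<^esub>"
    using E.diffop_apply_comp[where A="\<phi> \<circ> A", OF AE PE y(2)] ys(3)[OF y(1)] by simp
  then obtain B q where B: "q \<in> carrier K" "B \<in> UNIV \<rightarrow> carrier K" "\<forall>i>d. B i = \<zero>\<^bsub>K\<^esub>" "B d = A (Suc d)"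
      "A = diffop_comp K B (D_minus K q)"
    using factorization_step[OF chain A(1), of d "diffop_apply E ?PE y"] A L(3) y d
      E.diffop_apply_closed[OF PE y(2)] by metis
  define p' where "p' = p(Suc m := q)"
  have P': "D_minus_prod K p' m = ?P" by (rule K.D_minus_prod_cong) (auto simp: p'_def)
  have "L = diffop_comp K B (D_minus_prod K p' (Suc m))"
    using A(4) K.diffop_comp_assoc[OF B(2,3) K.D_minus_facts[OF B(1)] P(1)] B(5) P' by (simp add: p'_def)
  moreover have "\<forall>i\<in>{1..Suc m}. p' i \<in> carrier K" using p B(1) by (auto simp: p'_def le_Suc_eq)
  ultimately show ?case using B A(3) d unfolding d_def by (intro exI[of _ B] exI[of _ p']) auto
qed

text \<open>After \<open>n\<close> factors the remaining operator is multiplication by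
  \<open>L n\<close>, so the \<open>n\<close> solutions are annihilated by the product itself. The
  bound by the number of solvable equations \<open>z' = p i z\<close> then leaves no index
  out.\<close>

lemma exponentials_of_solutions:
  assumes chain: "special_chain E F r" "F 0 = \<phi> ` carrier K" "F r = carrier E"
    and L: "diffop_of_order K n L" and ys: "contains_all_solutions E \<phi> n L"
  obtains z p where "exponentials_of_integrals K E \<phi> n z p"
    "L = (\<lambda>k. L n \<otimes>\<^bsub>K\<^esub> D_minus_prod K p n k)"
proof -
  have L': "L \<in> UNIV \<rightarrow> carrier K" "\<forall>i>n. L i = \<zero>\<^bsub>K\<^esub>" "L n \<noteq> \<zero>\<^bsub>K\<^esub>"
    using L by (auto simp: diffop_of_order_def)
  have Ln: "L n \<in> carrier K" using L'(1) by auto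
  obtain ys where ys: "length ys = n" "E.independent (constants E) ys"
      "\<And>y. y \<in> set ys \<Longrightarrow> y \<in> carrier E" "\<And>y. y \<in> set ys \<Longrightarrow> diffop_apply E (\<phi> \<circ> L) y = \<zero>\<^bsub>E\<^esub>"
    using ys by (auto simp: contains_all_solutions_def)
  obtain A p where p: "\<forall>i\<in>{1..n}. p i \<in> carrier K"
    and A: "A \<in> UNIV \<rightarrow> carrier K" "\<forall>i>0. A i = \<zero>\<^bsub>K\<^esub>" "A 0 = L n" "L = diffop_comp K A (D_minus_prod K p n)"
    using factorization_of_solutions[OF chain L' ys(1,2,4) order.refl] unfolding diff_self_eq_0 by blast
  have p: "\<And>i. i \<in> {1..n} \<Longrightarrow> p i \<in> carrier K" using p by blast
  let ?P = "D_minus_prod K p n" and ?PE = "D_minus_prod E (\<phi> \<circ> p) n"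
  have P: "?P \<in> UNIV \<rightarrow> carrier K" using K.D_minus_prod_facts(1,2)[where p=p, OF p] by blast+
  have AP: "diffop_comp K A ?P k = A 0 \<otimes>\<^bsub>K\<^esub> ?P k" for k
  proof -
    have Pk: "?P k \<in> carrier K" "A 0 \<in> carrier K" using P A(1) by auto
    have "diffop_comp K A ?P k = (\<Oplus>\<^bsub>K\<^esub>i\<in>{..0}. A i \<otimes>\<^bsub>K\<^esub> (D_comp K ^^ i) ?P k)"
      by (rule K.diffop_comp_eq[OF A(1,2)]) (rule funcset_mem[OF K.D_comp_funpow_closed[OF P] UNIV_I])
    then show ?thesis using Pk by simp
  qed
  have L_eq: "L = (\<lambda>k. L n \<otimes>\<^bsub>K\<^esub> ?P k)"
    by (rule ext, subst (1) A(4)) (simp only: AP A(3))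
  have pE: "(\<phi> \<circ> p) i \<in> carrier E" if "i \<in> {1..n}" for i using p that by auto
  have PE: "?PE \<in> UNIV \<rightarrow> carrier E" "\<forall>i>n. ?PE i = \<zero>\<^bsub>E\<^esub>" using E.D_minus_prod_facts(1,2)[where p="\<phi> \<circ> p", OF pE] by blast+
  have "\<phi> \<circ> L = diffop_comp E (\<phi> \<circ> A) ?PE"
    unfolding A(4) using hom_diffop_comp[OF A(1,2) P] hom_D_minus_prod[of n p] p A(4) by simp
  have AE: "\<phi> \<circ> A \<in> UNIV \<rightarrow> carrier E" "\<forall>i>0. (\<phi> \<circ> A) i = \<zero>\<^bsub>E\<^esub>"
    using hom_comp_closed[OF A(1)] A(2) by auto
  have PEy: "diffop_apply E ?PE y = \<zero>\<^bsub>E\<^esub>" if y: "y \<in> set ys" for y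
  proof -
    note c = E.diffop_apply_closed[OF PE ys(3)[OF y]]
    have "diffop_apply E (\<phi> \<circ> A) (diffop_apply E ?PE y) = \<zero>\<^bsub>E\<^esub>"
      using E.diffop_apply_comp[where A="\<phi> \<circ> A", OF AE PE ys(3)[OF y]] ys(4)[OF y] \<open>\<phi> \<circ> L = _\<close> by simp
    then have "\<phi> (L n) \<otimes>\<^bsub>E\<^esub> diffop_apply E ?PE y = \<zero>\<^bsub>E\<^esub>"
      using E.diffop_apply_eq[OF AE c] c Ln A(3) by simp
    then show ?thesis using E.integral c Ln L'(3) hom_eq_zero_iff hom_carrier by blast
  qed
  let ?S = "{i \<in> {1..n}. \<exists>z\<in>carrier E. z \<noteq> \<zero>\<^bsub>E\<^esub> \<and> \<partial>\<^bsub>E\<^esub> z = (\<phi> \<circ> p) i \<otimes>\<^bsub>E\<^esub> z}"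
  have "n \<le> card ?S" using E.solutions_bound[OF pE ys(2) PEy] ys(1) by simp
  then have "?S = {1..n}" by (intro card_seteq) auto
  then have "\<forall>i\<in>{1..n}. \<exists>z\<in>carrier E. z \<noteq> \<zero>\<^bsub>E\<^esub> \<and> \<partial>\<^bsub>E\<^esub> z = (\<phi> \<circ> p) i \<otimes>\<^bsub>E\<^esub> z" by blast
  then obtain z where "\<forall>i\<in>{1..n}. z i \<in> carrier E \<and> z i \<noteq> \<zero>\<^bsub>E\<^esub> \<and> \<partial>\<^bsub>E\<^esub> (z i) = (\<phi> \<circ> p) i \<otimes>\<^bsub>E\<^esub> z i"
    by metis
  then show ?thesis
    using that[of z p] p L_eq by (auto simp: exponentials_of_integrals_def)
qed

end

text \<open>Powers of cosets are cosets of powers, and a coset is trivial exactly when its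
  representative lies in \<open>H\<close>; the quotient can thus be forgotten in favour of roots of
  elements of \<open>H\<close>.\<close>

lemma torsion_free_quotient_iff:
  assumes G: "comm_group G" and H: "subgroup H G"
  shows "torsion_free (G Mod H) \<longleftrightarrow>
    (\<forall>x\<in>carrier G. \<forall>m::nat. 0 < m \<longrightarrow> x [^]\<^bsub>G\<^esub> m \<in> H \<longrightarrow> x \<in> H)"
proof -
  interpret G: comm_group G by fact
  interpret H: normal H G using G.subgroup_imp_normal[OF H] .
  have pow: "(H #>\<^bsub>G\<^esub> x) [^]\<^bsub>G Mod H\<^esub> (m::nat) = H #>\<^bsub>G\<^esub> (x [^]\<^bsub>G\<^esub> m)" if "x \<in> carrier G" for x m
    using H.FactGroup_pow[OF that, of m] by simp
  have one: "\<one>\<^bsub>G Mod H\<^esub> = H" by (simp add: FactGroup_def)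
  have coset: "H #>\<^bsub>G\<^esub> x = H \<longleftrightarrow> x \<in> H" if "x \<in> carrier G" for x
    using G.coset_join1[OF _ that H] G.coset_join2[OF that H] H.subset by blast
  have "carrier (G Mod H) = (\<lambda>x. H #>\<^bsub>G\<^esub> x) ` carrier G"
    by (auto simp: FactGroup_def RCOSETS_def)
  then show ?thesis
    by (simp add: torsion_free_def pow one coset)
qed

section \<open>Towers of exponential and logarithmic extensions\<close>

text \<open>
  The special transcendental elements needed to solve equations: exponentials of integrals (\<open>f = 0\<close>) and
  reciprocals of integrals (\<open>q = 0\<close>).
\<close>

definition liouvillian_step :: "('a, 'm) differential_ring_scheme \<Rightarrow> 'a set \<Rightarrow> 'a \<Rightarrow> bool"
  where "liouvillian_step K F y \<longleftrightarrow> y \<in> carrier K \<and> ring.transcendental K F y \<and>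
    (\<exists>q\<in>F. \<exists>f\<in>F. \<partial>\<^bsub>K\<^esub> y = y \<otimes>\<^bsub>K\<^esub> (q \<oplus>\<^bsub>K\<^esub> f \<otimes>\<^bsub>K\<^esub> y))"

text \<open>Growing towers by one step at the top makes transitivity and transport along embeddings
  plain rule inductions; the indexed chain required of admissible extensions is recovered by
  \<open>special_tower_chain\<close>.\<close>

inductive special_tower :: "('a, 'm) differential_ring_scheme \<Rightarrow> 'a set \<Rightarrow> 'a set \<Rightarrow> bool"
  for K A where
  base: "special_tower K A A"
| step: "special_tower K A B \<Longrightarrow> liouvillian_step K B y \<Longrightarrow>
    special_tower K A (generate_field K (insert y B))"

lemma special_tower_trans:
  assumes "special_tower K B C" "special_tower K A B"
  shows "special_tower K A C"
  using assms by (induction rule: special_tower.induct) (auto intro: special_tower.intros)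

lemma special_tower_mono: "special_tower K A B \<Longrightarrow> A \<subseteq> B"
  by (induction rule: special_tower.induct) (auto intro: generate_field.incl)

context differential_field
begin

lemma transcendentalI:
  assumes "subring F K" "y \<in> carrier K" "\<And>p. set p \<subseteq> F \<Longrightarrow> eval p y = \<zero> \<Longrightarrow> set p \<subseteq> {\<zero>}"
  shows "transcendental F y"
proof (rule ccontr)
  assume "algebraic F y"
  then obtain p where p: "p \<in> carrier (F[X])" "p \<noteq> []" "eval p y = \<zero>"
    using algebraicE[OF assms(1,2)] unfolding over_def by blast
  have "set p \<subseteq> {\<zero>}" using assms(3)[OF univ_poly_set[OF assms(1) p(1)] p(3)] .
  then show False using p(1,2) by (cases p) (auto simp: univ_poly_def polynomial_def)
qed

text \<open>The right-hand side \<open>y (q + f y)\<close> is polynomial, so \<open>Q = 1\<close>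
  serves as denominator and is relatively prime to everything. The list \<open>[f, q]\<close> is
  normalized because \<open>f\<close> may be zero.\<close>

lemma liouvillian_step_special:
  assumes F: "differential_subfield F K" and y: "liouvillian_step K F y"
  shows "special_transcendental K F y"
proof -
  note Ff = differential_subfieldD[OF F]
  obtain q f where yc: "y \<in> carrier K" "transcendental F y" and qf: "q \<in> F" "f \<in> F"
    and dy: "\<partial> y = y \<otimes> (q \<oplus> f \<otimes> y)"
    using y by (auto simp: liouvillian_step_def)
  define P where "P = normalize [f, q]"
  have P: "P \<in> carrier (F[X])"
    unfolding P_def using normalize_gives_polynomial[of "[f, q]" F] qf
    by (simp add: univ_poly_def del: normalize.simps)
  have c: "f \<in> carrier K" "q \<in> carrier K" using qf Ff(3) by auto
  then have "eval P y = q \<oplus> f \<otimes> y"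
    unfolding P_def using eval_normalize[of "[f, q]" y] yc by (auto simp: a_comm)
  moreover interpret FX: domain "F[X]" using univ_poly_is_domain[OF Ff(2)] .
  have "relatively_prime (F[X]) (X \<otimes>\<^bsub>F[X]\<^esub> P) [\<one>]"
    unfolding relatively_prime_def univ_poly_one[of K F, symmetric]
  proof (intro ballI impI)
    fix d assume d: "d \<in> carrier (F[X])" "d divides\<^bsub>F[X]\<^esub> \<one>\<^bsub>F[X]\<^esub>"
    show "d \<in> Units (F[X])" by (rule FX.divides_unit[OF d(2,1) FX.Units_one_closed])
  qed
  moreover have "eval [\<one>] y = \<one>" using yc by simp
  moreover have "[\<one>] \<in> carrier (F[X])" using FX.one_closed by (simp add: univ_poly_one)
  ultimately show ?thesis
    unfolding special_transcendental_def using yc dy P c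
    by (intro conjI bexI[of _ P] bexI[of _ "[\<one>]"]) auto
qed

lemma generate_differential_subfield:
  assumes F: "differential_subfield F K" and y: "y \<in> carrier K" "\<partial> y \<in> generate_field K (insert y F)"
  shows "differential_subfield (generate_field K (insert y F)) K"
proof -
  note Ff = differential_subfieldD[OF F]
  have sub: "insert y F \<subseteq> carrier K" using Ff y by auto
  have sf: "subfield (generate_field K (insert y F)) K" by (rule generate_field_is_subfield[OF sub])
  have c: "h \<in> carrier K" if "h \<in> generate_field K (insert y F)" for h
    using generate_field_in_carrier[OF sub that] .
  have "\<partial> x \<in> generate_field K (insert y F)" if "x \<in> generate_field K (insert y F)" for x
    using that
  proof (induction rule: generate_field.induct)
    case one
    then show ?case using subringE(2)[OF subfieldE(1)[OF sf]] by (simp add: der_one)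
  next
    case (incl h)
    then show ?case using y Ff(4) by (auto intro: generate_field.incl)
  next
    case (a_inv h)
    then show ?case using c by (simp add: der_a_inv generate_field.a_inv)
  next
    case (m_inv h)
    note h = c[OF m_inv.hyps(1)] and ih = inverse_facts[OF c[OF m_inv.hyps(1)] m_inv.hyps(2)]
    have d: "\<partial> (inv h) \<in> carrier K" "\<partial> h \<in> carrier K" using ih h der_closed by auto
    have "\<zero> = \<partial> (inv h) \<otimes> h \<oplus> inv h \<otimes> \<partial> h"
      using der_mult[OF ih(1) h] ih(3) by (simp add: der_one)
    then have "inv h \<otimes> \<partial> h = \<zero> \<ominus> \<partial> (inv h) \<otimes> h"
      using d h ih by (intro eq_add_imp) auto
    then have "\<partial> (inv h) \<otimes> h = \<ominus> (inv h \<otimes> \<partial> h)"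
      using d h ih by (simp add: minus_eq)
    then have "\<partial> (inv h) = \<ominus> (inv h \<otimes> \<partial> h) \<otimes> inv h"
      using d h ih m_inv.hyps(2) by (intro cross_mult_divide) auto
    then show ?case
      using m_inv generate_field.eng_mult generate_field.a_inv generate_field.m_inv by metis
  next
    case (eng_add h1 h2)
    then show ?case using c by (simp add: der_add generate_field.eng_add)
  next
    case (eng_mult h1 h2)
    then show ?case using c by (simp add: der_mult generate_field.eng_add generate_field.eng_mult)
  qed
  then show ?thesis using sf by (simp add: differential_subfield_def)
qed

lemma liouvillian_step_subfield:
  assumes F: "differential_subfield F K" and y: "liouvillian_step K F y"
  shows "differential_subfield (generate_field K (insert y F)) K"
proof (rule generate_differential_subfield[OF F])
  show "y \<in> carrier K" using y by (simp add: liouvillian_step_def)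
  obtain q f where "q \<in> F" "f \<in> F" "\<partial> y = y \<otimes> (q \<oplus> f \<otimes> y)"
    using y by (auto simp: liouvillian_step_def)
  moreover have "x \<in> generate_field K (insert y F)" if "x = y \<or> x \<in> F" for x
    using that by (auto intro: generate_field.incl)
  ultimately show "\<partial> y \<in> generate_field K (insert y F)"
    by (simp add: generate_field.eng_add generate_field.eng_mult)
qed

lemma special_tower_subfield:
  assumes "special_tower K A B" "differential_subfield A K"
  shows "differential_subfield B K"
  using assms by (induction rule: special_tower.induct) (auto intro: liouvillian_step_subfield)

lemma special_tower_chain:
  assumes "special_tower K A B" "differential_subfield A K"
  shows "\<exists>r::nat. \<exists>F. F 0 = A \<and> F r = B \<and> (\<forall>i\<le>r. differential_subfield (F i) K) \<and>
    (\<forall>i<r. \<exists>y. special_transcendental K (F i) y \<and> F (Suc i) = generate_field K (insert y (F i)))"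
  using assms
proof (induction rule: special_tower.induct)
  case base
  then show ?case by (intro exI[of _ 0] exI[of _ "\<lambda>_. A"]) auto
next
  case (step B y)
  then obtain r :: nat and F where F: "F 0 = A" "F r = B" "\<forall>i\<le>r. differential_subfield (F i) K"
      "\<forall>i<r. \<exists>y. special_transcendental K (F i) y \<and> F (Suc i) = generate_field K (insert y (F i))"
    by auto
  have B: "differential_subfield B K" using F by auto
  let ?F = "F(Suc r := generate_field K (insert y B))"
  have "\<exists>y. special_transcendental K (?F i) y \<and> ?F (Suc i) = generate_field K (insert y (?F i))"
    if "i < Suc r" for i
  proof (cases "i = r")
    case True
    then show ?thesis using liouvillian_step_special[OF B step.hyps(2)] F(2) by auto
  next
    case False
    then show ?thesis using that F(4) by auto
  qed
  moreover have "differential_subfield (?F i) K" if "i \<le> Suc r" for i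
    using that F(3) liouvillian_step_subfield[OF B step.hyps(2)] by (auto simp: le_Suc_eq)
  ultimately show ?case using F(1) by (intro exI[of _ "Suc r"] exI[of _ ?F]) auto
qed

end

text \<open>The map is constrained only on a subfield \<open>S\<close>, and constants are left free.
  One transport result then covers both the structure maps of extensions (\<open>S\<close> the whole
  carrier) and the passage to a smaller carrier (\<open>\<chi>\<close> the identity).\<close>

locale differential_embedding =
  M: differential_field M + N: differential_field N
  for M :: "('a, 'm) differential_ring_scheme" and N :: "('b, 'n) differential_ring_scheme" +
  fixes S :: "'a set" and \<chi> :: "'a \<Rightarrow> 'b"
  assumes S: "differential_subfield S M"
    and closed: "x \<in> S \<Longrightarrow> \<chi> x \<in> carrier N"
    and add: "x \<in> S \<Longrightarrow> y \<in> S \<Longrightarrow> \<chi> (x \<oplus>\<^bsub>M\<^esub> y) = \<chi> x \<oplus>\<^bsub>N\<^esub> \<chi> y"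
    and mult: "x \<in> S \<Longrightarrow> y \<in> S \<Longrightarrow> \<chi> (x \<otimes>\<^bsub>M\<^esub> y) = \<chi> x \<otimes>\<^bsub>N\<^esub> \<chi> y"
    and hom_one: "\<chi> \<one>\<^bsub>M\<^esub> = \<one>\<^bsub>N\<^esub>"
    and der: "x \<in> S \<Longrightarrow> \<chi> (\<partial>\<^bsub>M\<^esub> x) = \<partial>\<^bsub>N\<^esub> (\<chi> x)"
begin

lemmas S_facts = M.differential_subfieldD[OF S]

lemma S_carrier: "x \<in> S \<Longrightarrow> x \<in> carrier M"
  using S_facts(3) by auto

lemma zero: "\<chi> \<zero>\<^bsub>M\<^esub> = \<zero>\<^bsub>N\<^esub>"
  using add[OF S_facts(5,5)] closed[OF S_facts(5)] N.add.l_cancel_one' by simp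

lemma hom_a_inv: "x \<in> S \<Longrightarrow> \<chi> (\<ominus>\<^bsub>M\<^esub> x) = \<ominus>\<^bsub>N\<^esub> \<chi> x"
  using add[OF S_facts(7), of x x] zero closed S_facts(7) S_carrier
  by (metis M.l_neg N.minus_equality)

lemma eq_zero_iff:
  assumes "x \<in> S"
  shows "\<chi> x = \<zero>\<^bsub>N\<^esub> \<longleftrightarrow> x = \<zero>\<^bsub>M\<^esub>"
proof
  assume 0: "\<chi> x = \<zero>\<^bsub>N\<^esub>"
  show "x = \<zero>\<^bsub>M\<^esub>"
  proof (rule ccontr)
    assume nz: "x \<noteq> \<zero>\<^bsub>M\<^esub>"
    have "\<chi> x \<otimes>\<^bsub>N\<^esub> \<chi> (inv\<^bsub>M\<^esub> x) = \<one>\<^bsub>N\<^esub>"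
      using mult[OF assms S_facts(10)[OF assms nz]] M.inverse_facts[OF S_carrier[OF assms] nz] hom_one by simp
    then show False using 0 closed[OF S_facts(10)[OF assms nz]] by simp
  qed
qed (simp add: zero)

lemma hom_m_inv:
  assumes "x \<in> S" "x \<noteq> \<zero>\<^bsub>M\<^esub>"
  shows "\<chi> (inv\<^bsub>M\<^esub> x) = inv\<^bsub>N\<^esub> (\<chi> x)"
proof -
  have "\<chi> x \<otimes>\<^bsub>N\<^esub> \<chi> (inv\<^bsub>M\<^esub> x) = \<one>\<^bsub>N\<^esub>"
    using mult[OF assms(1) S_facts(10)[OF assms]] M.inverse_facts[OF S_carrier[OF assms(1)] assms(2)] hom_one
    by simp
  then show ?thesis
    using closed[OF assms(1)] closed[OF S_facts(10)[OF assms]] by (metis N.comm_inv_char)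
qed

lemma pow: "x \<in> S \<Longrightarrow> \<chi> (x [^]\<^bsub>M\<^esub> (n::nat)) = \<chi> x [^]\<^bsub>N\<^esub> n"
  by (induction n) (auto simp: hom_one mult S_facts(11))

lemma eval_in_S: "set p \<subseteq> S \<Longrightarrow> y \<in> S \<Longrightarrow> M.eval p y \<in> S"
  by (induction p) (auto simp: S_facts)

lemma hom_eval: "set p \<subseteq> S \<Longrightarrow> y \<in> S \<Longrightarrow> \<chi> (M.eval p y) = N.eval (map \<chi> p) (\<chi> y)"
  by (induction p) (auto simp: zero add mult pow S_facts eval_in_S)

lemma image_subfield:
  assumes "differential_subfield A M" "A \<subseteq> S"
  shows "differential_subfield (\<chi> ` A) N"
proof -
  note Af = M.differential_subfieldD[OF assms(1)]
  have AS: "x \<in> S" if "x \<in> A" for x using that assms(2) by auto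
  have "subfield (\<chi> ` A) N"
  proof (rule N.subfieldI')
    show "subring (\<chi> ` A) N"
    proof (rule N.subringI)
      show "\<chi> ` A \<subseteq> carrier N" using AS closed by auto
      show "\<one>\<^bsub>N\<^esub> \<in> \<chi> ` A" using hom_one Af(6) by (metis imageI)
      show "\<ominus>\<^bsub>N\<^esub> x \<in> \<chi> ` A" if "x \<in> \<chi> ` A" for x
        using that hom_a_inv AS Af(7) by (force simp: image_iff)
      show "x \<otimes>\<^bsub>N\<^esub> y \<in> \<chi> ` A" "x \<oplus>\<^bsub>N\<^esub> y \<in> \<chi> ` A" if "x \<in> \<chi> ` A" "y \<in> \<chi> ` A" for x y
        using that mult add AS Af(8,9) by (auto simp: image_iff) (metis+)
    qed
    show "inv\<^bsub>N\<^esub> k \<in> \<chi> ` A" if "k \<in> \<chi> ` A - {\<zero>\<^bsub>N\<^esub>}" for k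
    proof -
      obtain x where x: "x \<in> A" "k = \<chi> x" "x \<noteq> \<zero>\<^bsub>M\<^esub>"
        using \<open>k \<in> _\<close> zero by auto
      then show ?thesis using hom_m_inv[of x] AS Af(10) by (metis imageI)
    qed
  qed
  moreover have "\<partial>\<^bsub>N\<^esub> k \<in> \<chi> ` A" if "k \<in> \<chi> ` A" for k
    using that der AS Af(4) by (metis (no_types, lifting) imageE imageI)
  ultimately show ?thesis by (simp add: differential_subfield_def)
qed

lemma image_generate_field:
  assumes "generate_field M B \<subseteq> S"
  shows "\<chi> ` generate_field M B = generate_field N (\<chi> ` B)"
proof
  have "\<chi> x \<in> generate_field N (\<chi> ` B)" if "x \<in> generate_field M B" for x
    using that
  proof (induction rule: generate_field.induct)
    case one
    then show ?case using hom_one generate_field.one by metis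
  next
    case (incl h)
    then show ?case by (intro generate_field.incl) auto
  next
    case (a_inv h)
    then show ?case using hom_a_inv assms generate_field.a_inv by (metis subsetD)
  next
    case (m_inv h)
    then have "h \<in> S" using assms by auto
    then show ?case using hom_m_inv eq_zero_iff m_inv generate_field.m_inv by metis
  next
    case (eng_add h1 h2)
    then show ?case using add assms generate_field.eng_add by (metis subsetD)
  next
    case (eng_mult h1 h2)
    then show ?case using mult assms generate_field.eng_mult by (metis subsetD)
  qed
  then show "\<chi> ` generate_field M B \<subseteq> generate_field N (\<chi> ` B)" by auto
  have "x \<in> \<chi> ` generate_field M B" if "x \<in> generate_field N (\<chi> ` B)" for x
    using that
  proof (induction rule: generate_field.induct)
    case one
    then show ?case using hom_one generate_field.one by (metis imageI)
  next
    case (incl h)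
    then show ?case using generate_field.incl by (metis image_iff)
  next
    case (a_inv h)
    then obtain g where g: "g \<in> generate_field M B" "h = \<chi> g" by auto
    then show ?case using hom_a_inv[of g] assms generate_field.a_inv[OF g(1)] by (metis imageI subsetD)
  next
    case (m_inv h)
    then obtain g where g: "g \<in> generate_field M B" "h = \<chi> g" by auto
    then have "g \<noteq> \<zero>\<^bsub>M\<^esub>" "g \<in> S" using m_inv zero assms by auto
    then show ?case using hom_m_inv[of g] g generate_field.m_inv[OF g(1)] by (metis imageI)
  next
    case (eng_add h1 h2)
    then obtain g1 g2 where g: "g1 \<in> generate_field M B" "h1 = \<chi> g1" "g2 \<in> generate_field M B" "h2 = \<chi> g2"
      by auto
    then show ?case using add[of g1 g2] assms generate_field.eng_add[OF g(1,3)] by (metis imageI subsetD)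
  next
    case (eng_mult h1 h2)
    then obtain g1 g2 where g: "g1 \<in> generate_field M B" "h1 = \<chi> g1" "g2 \<in> generate_field M B" "h2 = \<chi> g2"
      by auto
    then show ?case using mult[of g1 g2] assms generate_field.eng_mult[OF g(1,3)] by (metis imageI subsetD)
  qed
  then show "generate_field N (\<chi> ` B) \<subseteq> \<chi> ` generate_field M B" by auto
qed

text \<open>A relation for \<open>\<chi> y\<close> over the image has coefficients that lift to
  \<open>B\<close>; evaluation commutes with \<open>\<chi>\<close>, which vanishes only at zero on
  \<open>S\<close>, so the lifted relation holds for \<open>y\<close> and is trivial.\<close>

lemma image_liouvillian_step:
  assumes B: "differential_subfield B M" "B \<subseteq> S" and y: "liouvillian_step M B y" "y \<in> S"
  shows "liouvillian_step N (\<chi> ` B) (\<chi> y)"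
proof -
  note Bf = M.differential_subfieldD[OF B(1)]
  obtain q f where qf: "q \<in> B" "f \<in> B" "\<partial>\<^bsub>M\<^esub> y = y \<otimes>\<^bsub>M\<^esub> (q \<oplus>\<^bsub>M\<^esub> f \<otimes>\<^bsub>M\<^esub> y)"
    and tr: "M.transcendental B y"
    using y by (auto simp: liouvillian_step_def)
  have qfS: "q \<in> S" "f \<in> S" using qf B(2) by auto
  have "\<partial>\<^bsub>N\<^esub> (\<chi> y) = \<chi> y \<otimes>\<^bsub>N\<^esub> (\<chi> q \<oplus>\<^bsub>N\<^esub> \<chi> f \<otimes>\<^bsub>N\<^esub> \<chi> y)"
    using der[OF y(2)] qf(3) qfS y(2) by (simp add: mult add S_facts)
  moreover have "N.transcendental (\<chi> ` B) (\<chi> y)"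
  proof (rule N.transcendentalI)
    show "subring (\<chi> ` B) N" using N.differential_subfieldD[OF image_subfield[OF B]] by auto
    show "\<chi> y \<in> carrier N" using closed y by auto
    fix p assume p: "set p \<subseteq> \<chi> ` B" "N.eval p (\<chi> y) = \<zero>\<^bsub>N\<^esub>"
    obtain p' where p': "p = map \<chi> p'" "set p' \<subseteq> B"
      using p(1) by (metis (no_types, lifting) ex_map_conv image_iff subset_code(1) in_lists_conv_set lists_image image_eqI in_listsD in_listsI)
    have S': "set p' \<subseteq> S" using p' B by auto
    have "M.eval p' y = \<zero>\<^bsub>M\<^esub>"
      using hom_eval[OF S' y(2)] eq_zero_iff[OF eval_in_S[OF S' y(2)]] p(2) p'(1) by simp
    then have "set p' \<subseteq> {\<zero>\<^bsub>M\<^esub>}"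
      using M.transcendental_eval_zero[OF tr p'(2) Bf(3) S_carrier[OF y(2)]] by simp
    then show "set p \<subseteq> {\<zero>\<^bsub>N\<^esub>}" using p'(1) zero by auto
  qed
  ultimately show ?thesis unfolding liouvillian_step_def using closed[OF y(2)] qf by auto
qed

lemma image_special_tower:
  assumes "special_tower M A B" "differential_subfield A M" "B \<subseteq> S"
  shows "special_tower N (\<chi> ` A) (\<chi> ` B)"
  using assms
proof (induction rule: special_tower.induct)
  case base
  show ?case by (rule special_tower.base)
next
  case (step B y)
  have sub: "insert y B \<subseteq> S"
    using step.prems(2) generate_field.incl[of _ "insert y B" M] by blast
  have B: "differential_subfield B M" by (rule M.special_tower_subfield[OF step.hyps(1) step.prems(1)])
  have "liouvillian_step N (\<chi> ` B) (\<chi> y)"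
    using image_liouvillian_step[OF B _ step.hyps(2)] sub by auto
  then have "special_tower N (\<chi> ` A) (generate_field N (insert (\<chi> y) (\<chi> ` B)))"
    using step sub by (intro special_tower.step) auto
  then show ?case using image_generate_field[OF step.prems(2)] by simp
qed

end

lemma (in differential_extension) embedding: "differential_embedding K E (carrier K) \<phi>"
proof (intro differential_embedding.intro differential_embedding_axioms.intro)
  show "differential_subfield (carrier K) K"
    using K.carrier_is_subfield K.der_closed by (auto simp: differential_subfield_def)
qed (auto simp: hom_der K.differential_field_axioms E.differential_field_axioms)

text \<open>A tower inside an extension may stop at a proper subfield, while an admissible extension
  must be exhausted by its chain; so the subfield is turned into a differential field of its
  own.\<close>

lemma (in differential_field) restrict_differential_field:
  assumes S: "differential_subfield S K"
  shows "differential_field (K\<lparr>carrier := S\<rparr>)" "differential_embedding K (K\<lparr>carrier := S\<rparr>) S id"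
proof -
  note Sf = differential_subfieldD[OF S]
  have f: "field (K\<lparr>carrier := S\<rparr>)" using subfield_iff(2)[OF Sf(1)] .
  have pow: "[m] \<cdot>\<^bsub>K\<lparr>carrier := S\<rparr>\<^esub> x = [(m::nat)] \<cdot> x" for x m
    by (induction m) (auto simp: add_pow_def nat_pow_def)
  show d: "differential_field (K\<lparr>carrier := S\<rparr>)"
  proof (intro differential_field.intro f differential_field_axioms.intro)
    show "[m] \<cdot>\<^bsub>K\<lparr>carrier := S\<rparr>\<^esub> \<one>\<^bsub>K\<lparr>carrier := S\<rparr>\<^esub> \<noteq> \<zero>\<^bsub>K\<lparr>carrier := S\<rparr>\<^esub>" if "0 < m" for m :: nat
      unfolding pow using char_zero[OF that] by simp
  next
    fix a b assume "a \<in> carrier (K\<lparr>carrier := S\<rparr>)" "b \<in> carrier (K\<lparr>carrier := S\<rparr>)"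
    then have ab: "a \<in> S" "b \<in> S" "a \<in> carrier K" "b \<in> carrier K" using Sf(3) by auto
    show "\<partial>\<^bsub>K\<lparr>carrier := S\<rparr>\<^esub> a \<in> carrier (K\<lparr>carrier := S\<rparr>)" using Sf(4) ab by simp
    show "\<partial>\<^bsub>K\<lparr>carrier := S\<rparr>\<^esub> (a \<oplus>\<^bsub>K\<lparr>carrier := S\<rparr>\<^esub> b) =
        \<partial>\<^bsub>K\<lparr>carrier := S\<rparr>\<^esub> a \<oplus>\<^bsub>K\<lparr>carrier := S\<rparr>\<^esub> \<partial>\<^bsub>K\<lparr>carrier := S\<rparr>\<^esub> b"
      using der_add[OF ab(3,4)] by simp
    show "\<partial>\<^bsub>K\<lparr>carrier := S\<rparr>\<^esub> (a \<otimes>\<^bsub>K\<lparr>carrier := S\<rparr>\<^esub> b) =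
        (\<partial>\<^bsub>K\<lparr>carrier := S\<rparr>\<^esub> a \<otimes>\<^bsub>K\<lparr>carrier := S\<rparr>\<^esub> b) \<oplus>\<^bsub>K\<lparr>carrier := S\<rparr>\<^esub>
        (a \<otimes>\<^bsub>K\<lparr>carrier := S\<rparr>\<^esub> \<partial>\<^bsub>K\<lparr>carrier := S\<rparr>\<^esub> b)"
      using der_mult[OF ab(3,4)] by simp
  qed
  show "differential_embedding K (K\<lparr>carrier := S\<rparr>) S id"
    by (intro differential_embedding.intro differential_embedding_axioms.intro d S differential_field_axioms) auto
qed

lemma (in differential_extension) restrict_extension:
  assumes S: "differential_subfield S E" "\<phi> ` carrier K \<subseteq> S"
  shows "differential_extension K (E\<lparr>carrier := S\<rparr>) \<phi>"
proof (intro differential_extension.intro differential_extension_axioms.intro)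
  show "differential_field K" ..
  show "differential_field (E\<lparr>carrier := S\<rparr>)" by (rule E.restrict_differential_field[OF S(1)])
  show "\<phi> \<in> ring_hom K (E\<lparr>carrier := S\<rparr>)"
    using S(2) hom by (auto simp: ring_hom_def)
  show "constants (E\<lparr>carrier := S\<rparr>) = \<phi> ` constants K"
  proof -
    have "constants (E\<lparr>carrier := S\<rparr>) = constants E \<inter> S"
      using E.differential_subfieldD(3)[OF S(1)] by (auto simp: constants_def)
    also have "\<dots> = \<phi> ` constants K"
      unfolding no_new_constants using S(2) by (auto simp: constants_def)
    finally show ?thesis .
  qed
qed (use hom_der in auto)

section \<open>Extensions by exponentials and reciprocals of integrals, and their
  composition\<close>

definition liouvillian_extension ::
    "('a, 'm) differential_ring_scheme \<Rightarrow> ('b, 'n) differential_ring_scheme \<Rightarrow> ('a \<Rightarrow> 'b) \<Rightarrow> bool"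
  where "liouvillian_extension K E \<phi> \<longleftrightarrow>
    differential_extension K E \<phi> \<and> special_tower E (\<phi> ` carrier K) (carrier E)"

lemma liouvillian_extension_admissible:
  assumes "liouvillian_extension K E \<phi>"
  shows "admissible_extension K E \<phi>"
proof -
  interpret differential_extension K E \<phi> using assms by (simp add: liouvillian_extension_def)
  interpret emb: differential_embedding K E "carrier K" \<phi> by (rule embedding)
  have "differential_subfield (\<phi> ` carrier K) E" by (rule emb.image_subfield[OF emb.S order.refl])
  then show ?thesis
    using E.special_tower_chain assms differential_extension_axioms
    unfolding liouvillian_extension_def admissible_extension_def by blast
qed

lemma liouvillian_extension_refl:
  assumes "differential_field K"
  shows "liouvillian_extension K K id"
proof -
  interpret differential_field K by fact
  have "differential_extension K K id"
    by (intro differential_extension.intro differential_extension_axioms.intro assms) (auto simp: ring_hom_def)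
  then show ?thesis by (simp add: liouvillian_extension_def special_tower.base)
qed

lemma liouvillian_extension_trans:
  assumes "liouvillian_extension K M \<phi>" "liouvillian_extension M N \<psi>"
  shows "liouvillian_extension K N (\<psi> \<circ> \<phi>)"
proof -
  interpret KM: differential_extension K M \<phi> using assms by (simp add: liouvillian_extension_def)
  interpret MN: differential_extension M N \<psi> using assms by (simp add: liouvillian_extension_def)
  interpret embK: differential_embedding K M "carrier K" \<phi> by (rule KM.embedding)
  interpret embM: differential_embedding M N "carrier M" \<psi> by (rule MN.embedding)
  have "differential_subfield (\<phi> ` carrier K) M" by (rule embK.image_subfield[OF embK.S order.refl])
  then have "special_tower N (\<psi> ` \<phi> ` carrier K) (\<psi> ` carrier M)"
    using embM.image_special_tower[of "\<phi> ` carrier K" "carrier M"] assms(1)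
    by (simp add: liouvillian_extension_def)
  then have "special_tower N ((\<psi> \<circ> \<phi>) ` carrier K) (carrier N)"
    using special_tower_trans assms(2) unfolding liouvillian_extension_def image_comp by blast
  moreover have "differential_extension K N (\<psi> \<circ> \<phi>)"
  proof (intro differential_extension.intro differential_extension_axioms.intro)
    show "differential_field K" ..
    show "differential_field N" ..
    show "\<psi> \<circ> \<phi> \<in> ring_hom K N" using ring_hom_trans[OF KM.hom MN.hom] .
    show "constants N = (\<psi> \<circ> \<phi>) ` constants K"
      using KM.no_new_constants MN.no_new_constants by (simp add: image_comp)
  qed (simp add: KM.hom_der MN.hom_der)
  ultimately show ?thesis by (simp add: liouvillian_extension_def)
qed

section \<open>Fraction fields of differential domains\<close>

text \<open>
  The fraction field is built on any type with room for it: \<open>\<kappa> a b\<close> is the element that stands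
  for \<open>a / b\<close>.
\<close>

locale fraction_map = domain R for R :: "('a, 'm) ring_scheme" (structure) +
  fixes d :: "'a \<Rightarrow> 'a" and \<kappa> :: "'a \<Rightarrow> 'a \<Rightarrow> 'c"
  assumes d_closed: "a \<in> carrier R \<Longrightarrow> d a \<in> carrier R"
    and d_add: "a \<in> carrier R \<Longrightarrow> b \<in> carrier R \<Longrightarrow> d (a \<oplus> b) = d a \<oplus> d b"
    and d_mult: "a \<in> carrier R \<Longrightarrow> b \<in> carrier R \<Longrightarrow> d (a \<otimes> b) = d a \<otimes> b \<oplus> a \<otimes> d b"
    and char_zero: "0 < (m::nat) \<Longrightarrow> [m] \<cdot> \<one> \<noteq> \<zero>"
    and \<kappa>_eq_iff: "a \<in> carrier R \<Longrightarrow> b \<in> carrier R \<Longrightarrow> b \<noteq> \<zero> \<Longrightarrow>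
      c \<in> carrier R \<Longrightarrow> e \<in> carrier R \<Longrightarrow> e \<noteq> \<zero> \<Longrightarrow> \<kappa> a b = \<kappa> c e \<longleftrightarrow> a \<otimes> e = c \<otimes> b"
begin

text \<open>Operations on \<open>frac\<close> go through an arbitrarily chosen representative; each
  is then shown, by cross-multiplication, to obey the usual formula for every
  representative.\<close>

definition frac_rep :: "'c \<Rightarrow> 'a \<times> 'a"
  where "frac_rep x = (SOME (a, b). a \<in> carrier R \<and> b \<in> carrier R \<and> b \<noteq> \<zero> \<and> x = \<kappa> a b)"

definition frac :: "'c differential_ring" where
  "frac = \<lparr>carrier = {\<kappa> a b |a b. a \<in> carrier R \<and> b \<in> carrier R \<and> b \<noteq> \<zero>},
    monoid.mult = \<lambda>x y. case (frac_rep x, frac_rep y) of ((a, b), (c, e)) \<Rightarrow> \<kappa> (a \<otimes> c) (b \<otimes> e),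
    monoid.one = \<kappa> \<one> \<one>, ring.zero = \<kappa> \<zero> \<one>,
    ring.add = \<lambda>x y. case (frac_rep x, frac_rep y) of ((a, b), (c, e)) \<Rightarrow> \<kappa> (a \<otimes> e \<oplus> c \<otimes> b) (b \<otimes> e),
    differential_ring.der = \<lambda>x. case frac_rep x of (a, b) \<Rightarrow> \<kappa> (d a \<otimes> b \<ominus> a \<otimes> d b) (b \<otimes> b)\<rparr>"

abbreviation nz :: "'a set" where "nz \<equiv> {b \<in> carrier R. b \<noteq> \<zero>}"

lemma nz_mult: "a \<in> nz \<Longrightarrow> b \<in> nz \<Longrightarrow> a \<otimes> b \<in> nz"
  using integral by auto

lemma one_nz: "\<one> \<in> nz"
  by auto

lemma frac_repE:
  assumes "a \<in> carrier R" "b \<in> nz"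
  obtains c e where "frac_rep (\<kappa> a b) = (c, e)" "c \<in> carrier R" "e \<in> nz" "c \<otimes> b = a \<otimes> e"
proof -
  let ?Q = "\<lambda>(c, e). c \<in> carrier R \<and> e \<in> carrier R \<and> e \<noteq> \<zero> \<and> \<kappa> a b = \<kappa> c e"
  have "?Q (SOME p. ?Q p)" using assms by (intro someI[of ?Q "(a, b)"]) auto
  then have "?Q (frac_rep (\<kappa> a b))" by (simp add: frac_rep_def)
  then obtain c e where ce: "frac_rep (\<kappa> a b) = (c, e)" "c \<in> carrier R" "e \<in> nz" "\<kappa> a b = \<kappa> c e"
    by (cases "frac_rep (\<kappa> a b)") auto
  then have "c \<otimes> b = a \<otimes> e" using \<kappa>_eq_iff[of a b c e] assms by auto
  then show ?thesis using that ce by blast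
qed

lemma frac_carrier: "carrier frac = {\<kappa> a b |a b. a \<in> carrier R \<and> b \<in> nz}"
  by (auto simp: frac_def)

lemma \<kappa>_closed: "a \<in> carrier R \<Longrightarrow> b \<in> nz \<Longrightarrow> \<kappa> a b \<in> carrier frac"
  by (auto simp: frac_carrier)

lemma fracE:
  assumes "x \<in> carrier frac"
  obtains a b where "a \<in> carrier R" "b \<in> nz" "x = \<kappa> a b"
  using assms by (auto simp: frac_carrier)

lemma frac_zero: "\<zero>\<^bsub>frac\<^esub> = \<kappa> \<zero> \<one>" and frac_one: "\<one>\<^bsub>frac\<^esub> = \<kappa> \<one> \<one>"
  by (simp_all add: frac_def)

lemma \<kappa>_eqI:
  assumes "a \<in> carrier R" "b \<in> nz" "c \<in> carrier R" "e \<in> nz" "a \<otimes> e = c \<otimes> b"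
  shows "\<kappa> a b = \<kappa> c e"
  using \<kappa>_eq_iff[of a b c e] assms by auto

lemma frac_mult:
  assumes "a \<in> carrier R" "b \<in> nz" "c \<in> carrier R" "e \<in> nz"
  shows "\<kappa> a b \<otimes>\<^bsub>frac\<^esub> \<kappa> c e = \<kappa> (a \<otimes> c) (b \<otimes> e)"
proof -
  obtain a' b' where 1: "frac_rep (\<kappa> a b) = (a', b')" "a' \<in> carrier R" "b' \<in> nz" "a' \<otimes> b = a \<otimes> b'"
    using frac_repE[OF assms(1,2)] by blast
  obtain c' e' where 2: "frac_rep (\<kappa> c e) = (c', e')" "c' \<in> carrier R" "e' \<in> nz" "c' \<otimes> e = c \<otimes> e'"
    using frac_repE[OF assms(3,4)] by blast
  have r: "a \<in> carrier R" "b \<in> carrier R" "c \<in> carrier R" "e \<in> carrier R" "a' \<in> carrier R" "b' \<in> carrier R"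
    "c' \<in> carrier R" "e' \<in> carrier R" using assms 1 2 by auto
  have "\<kappa> a b \<otimes>\<^bsub>frac\<^esub> \<kappa> c e = \<kappa> (a' \<otimes> c') (b' \<otimes> e')"
    using 1(1) 2(1) by (simp add: frac_def)
  also have "\<dots> = \<kappa> (a \<otimes> c) (b \<otimes> e)"
  proof (rule \<kappa>_eqI)
    have "(a' \<otimes> c') \<otimes> (b \<otimes> e) = (a' \<otimes> b) \<otimes> (c' \<otimes> e)" using r by algebra
    also have "\<dots> = (a \<otimes> c) \<otimes> (b' \<otimes> e')" unfolding 1(4) 2(4) using r by algebra
    finally show "(a' \<otimes> c') \<otimes> (b \<otimes> e) = (a \<otimes> c) \<otimes> (b' \<otimes> e')" .
  qed (use r nz_mult[OF 1(3) 2(3)] nz_mult[OF assms(2,4)] in simp_all)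
  finally show ?thesis .
qed

lemma frac_add:
  assumes "a \<in> carrier R" "b \<in> nz" "c \<in> carrier R" "e \<in> nz"
  shows "\<kappa> a b \<oplus>\<^bsub>frac\<^esub> \<kappa> c e = \<kappa> (a \<otimes> e \<oplus> c \<otimes> b) (b \<otimes> e)"
proof -
  obtain a' b' where 1: "frac_rep (\<kappa> a b) = (a', b')" "a' \<in> carrier R" "b' \<in> nz" "a' \<otimes> b = a \<otimes> b'"
    using frac_repE[OF assms(1,2)] by blast
  obtain c' e' where 2: "frac_rep (\<kappa> c e) = (c', e')" "c' \<in> carrier R" "e' \<in> nz" "c' \<otimes> e = c \<otimes> e'"
    using frac_repE[OF assms(3,4)] by blast
  have r: "a \<in> carrier R" "b \<in> carrier R" "c \<in> carrier R" "e \<in> carrier R" "a' \<in> carrier R" "b' \<in> carrier R"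
    "c' \<in> carrier R" "e' \<in> carrier R" using assms 1 2 by auto
  have "\<kappa> a b \<oplus>\<^bsub>frac\<^esub> \<kappa> c e = \<kappa> (a' \<otimes> e' \<oplus> c' \<otimes> b') (b' \<otimes> e')"
    using 1(1) 2(1) by (simp add: frac_def)
  also have "\<dots> = \<kappa> (a \<otimes> e \<oplus> c \<otimes> b) (b \<otimes> e)"
  proof (rule \<kappa>_eqI)
    have "(a' \<otimes> e' \<oplus> c' \<otimes> b') \<otimes> (b \<otimes> e) = (a' \<otimes> b) \<otimes> (e' \<otimes> e) \<oplus> (c' \<otimes> e) \<otimes> (b' \<otimes> b)" using r by algebra
    also have "\<dots> = (a \<otimes> e \<oplus> c \<otimes> b) \<otimes> (b' \<otimes> e')" unfolding 1(4) 2(4) using r by algebra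
    finally show "(a' \<otimes> e' \<oplus> c' \<otimes> b') \<otimes> (b \<otimes> e) = (a \<otimes> e \<oplus> c \<otimes> b) \<otimes> (b' \<otimes> e')" .
  qed (use r nz_mult[OF 1(3) 2(3)] nz_mult[OF assms(2,4)] in simp_all)
  finally show ?thesis .
qed

text \<open>Independence of the representative needs, besides the relation \<open>c b = a e\<close>
  between two representatives, also the derivative of that relation.\<close>

lemma frac_der:
  assumes "a \<in> carrier R" "b \<in> nz"
  shows "\<partial>\<^bsub>frac\<^esub> (\<kappa> a b) = \<kappa> (d a \<otimes> b \<ominus> a \<otimes> d b) (b \<otimes> b)"
proof -
  obtain c e where 1: "frac_rep (\<kappa> a b) = (c, e)" "c \<in> carrier R" "e \<in> nz" "c \<otimes> b = a \<otimes> e"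
    using frac_repE[OF assms] by blast
  have r: "a \<in> carrier R" "b \<in> carrier R" "c \<in> carrier R" "e \<in> carrier R"
    "d a \<in> carrier R" "d b \<in> carrier R" "d c \<in> carrier R" "d e \<in> carrier R"
    using assms 1 d_closed by auto
  have "d (c \<otimes> b) = d (a \<otimes> e)" using 1(4) by simp
  then have *: "d c \<otimes> b \<oplus> c \<otimes> d b = d a \<otimes> e \<oplus> a \<otimes> d e" using r by (simp add: d_mult)
  have "\<partial>\<^bsub>frac\<^esub> (\<kappa> a b) = \<kappa> (d c \<otimes> e \<ominus> c \<otimes> d e) (e \<otimes> e)"
    using 1(1) by (simp add: frac_def)
  also have "\<dots> = \<kappa> (d a \<otimes> b \<ominus> a \<otimes> d b) (b \<otimes> b)"
  proof (rule \<kappa>_eqI)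
    have "(d c \<otimes> e \<ominus> c \<otimes> d e) \<otimes> (b \<otimes> b) =
        (d c \<otimes> b \<oplus> c \<otimes> d b) \<otimes> (b \<otimes> e) \<ominus> (c \<otimes> b) \<otimes> (d e \<otimes> b \<oplus> e \<otimes> d b)" using r by algebra
    also have "\<dots> = (d a \<otimes> b \<ominus> a \<otimes> d b) \<otimes> (e \<otimes> e)" unfolding * 1(4) using r by algebra
    finally show "(d c \<otimes> e \<ominus> c \<otimes> d e) \<otimes> (b \<otimes> b) = (d a \<otimes> b \<ominus> a \<otimes> d b) \<otimes> (e \<otimes> e)" .
  qed (use r nz_mult[OF 1(3,3)] nz_mult[OF assms(2,2)] in simp_all)
  finally show ?thesis .
qed

lemma \<kappa>_cancel:
  assumes "a \<in> carrier R" "b \<in> nz" "s \<in> nz"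
  shows "\<kappa> (s \<otimes> a) (s \<otimes> b) = \<kappa> a b"
proof (rule \<kappa>_eqI)
  show "(s \<otimes> a) \<otimes> b = a \<otimes> (s \<otimes> b)" using assms by (simp add: m_ac)
qed (use assms nz_mult[OF assms(3,2)] in auto)

lemma frac_cring: "cring frac"
proof (rule cringI)
  show "abelian_group frac"
  proof (rule abelian_groupI)
    fix x y z assume x: "x \<in> carrier frac" and y: "y \<in> carrier frac" and z: "z \<in> carrier frac"
    obtain a b where ab: "a \<in> carrier R" "b \<in> nz" "x = \<kappa> a b" using x by (rule fracE)
    obtain c e where ce: "c \<in> carrier R" "e \<in> nz" "y = \<kappa> c e" using y by (rule fracE)
    obtain g h where gh: "g \<in> carrier R" "h \<in> nz" "z = \<kappa> g h" using z by (rule fracE)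
    have r: "a \<in> carrier R" "b \<in> carrier R" "c \<in> carrier R" "e \<in> carrier R" "g \<in> carrier R" "h \<in> carrier R"
      using ab ce gh by auto
    show "x \<oplus>\<^bsub>frac\<^esub> y \<in> carrier frac"
      unfolding ab ce frac_add[OF ab(1,2) ce(1,2)] using r nz_mult[OF ab(2) ce(2)] by (intro \<kappa>_closed) auto
    show "(x \<oplus>\<^bsub>frac\<^esub> y) \<oplus>\<^bsub>frac\<^esub> z = x \<oplus>\<^bsub>frac\<^esub> (y \<oplus>\<^bsub>frac\<^esub> z)"
    proof -
      have "(a \<otimes> e \<oplus> c \<otimes> b) \<otimes> h \<oplus> g \<otimes> (b \<otimes> e) = a \<otimes> (e \<otimes> h) \<oplus> (c \<otimes> h \<oplus> g \<otimes> e) \<otimes> b"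
        using r by algebra
      then show ?thesis
        unfolding ab ce gh using r ab(2) ce(2) gh(2) nz_mult[OF ab(2) ce(2)] nz_mult[OF ce(2) gh(2)]
        by (simp add: frac_add m_assoc)
    qed
    show "x \<oplus>\<^bsub>frac\<^esub> y = y \<oplus>\<^bsub>frac\<^esub> x"
      unfolding ab ce frac_add[OF ab(1,2) ce(1,2)] frac_add[OF ce(1,2) ab(1,2)] using r
      by (simp add: a_comm m_comm)
  next
    show "\<zero>\<^bsub>frac\<^esub> \<in> carrier frac" unfolding frac_zero by (intro \<kappa>_closed one_nz) simp
    fix x assume x: "x \<in> carrier frac"
    obtain a b where ab: "a \<in> carrier R" "b \<in> nz" "x = \<kappa> a b" using x by (rule fracE)
    show "\<zero>\<^bsub>frac\<^esub> \<oplus>\<^bsub>frac\<^esub> x = x"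
      unfolding ab frac_zero frac_add[OF zero_closed one_nz ab(1,2)] using ab by simp
    have "\<kappa> (\<ominus> a) b \<oplus>\<^bsub>frac\<^esub> x = \<kappa> (\<ominus> a \<otimes> b \<oplus> a \<otimes> b) (b \<otimes> b)"
      unfolding ab using ab by (intro frac_add) auto
    also have "\<dots> = \<kappa> \<zero> \<one>"
      using ab nz_mult[OF ab(2,2)] by (intro \<kappa>_eqI one_nz) (auto simp: l_minus l_neg)
    finally show "\<exists>y\<in>carrier frac. y \<oplus>\<^bsub>frac\<^esub> x = \<zero>\<^bsub>frac\<^esub>"
      using \<kappa>_closed[of "\<ominus> a" b] ab by (auto simp: frac_zero)
  qed
next
  show "Group.comm_monoid frac"
  proof (rule comm_monoidI)
    fix x y z assume x: "x \<in> carrier frac" and y: "y \<in> carrier frac" and z: "z \<in> carrier frac"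
    obtain a b where ab: "a \<in> carrier R" "b \<in> nz" "x = \<kappa> a b" using x by (rule fracE)
    obtain c e where ce: "c \<in> carrier R" "e \<in> nz" "y = \<kappa> c e" using y by (rule fracE)
    obtain g h where gh: "g \<in> carrier R" "h \<in> nz" "z = \<kappa> g h" using z by (rule fracE)
    show "x \<otimes>\<^bsub>frac\<^esub> y \<in> carrier frac"
      unfolding ab ce frac_mult[OF ab(1,2) ce(1,2)] using ab ce nz_mult[OF ab(2) ce(2)] by (intro \<kappa>_closed) auto
    show "(x \<otimes>\<^bsub>frac\<^esub> y) \<otimes>\<^bsub>frac\<^esub> z = x \<otimes>\<^bsub>frac\<^esub> (y \<otimes>\<^bsub>frac\<^esub> z)"
      unfolding ab ce gh using ab ce gh nz_mult[OF ab(2) ce(2)] nz_mult[OF ce(2) gh(2)]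
      by (simp add: frac_mult m_assoc)
    show "x \<otimes>\<^bsub>frac\<^esub> y = y \<otimes>\<^bsub>frac\<^esub> x"
      unfolding ab ce frac_mult[OF ab(1,2) ce(1,2)] frac_mult[OF ce(1,2) ab(1,2)] using ab ce
      by (simp add: m_comm)
  next
    show "\<one>\<^bsub>frac\<^esub> \<in> carrier frac" unfolding frac_one by (intro \<kappa>_closed one_nz) simp
    fix x assume x: "x \<in> carrier frac"
    obtain a b where ab: "a \<in> carrier R" "b \<in> nz" "x = \<kappa> a b" using x by (rule fracE)
    show "\<one>\<^bsub>frac\<^esub> \<otimes>\<^bsub>frac\<^esub> x = x"
      unfolding ab frac_one frac_mult[OF one_closed one_nz ab(1,2)] using ab by simp
  qed
next
  fix x y z assume x: "x \<in> carrier frac" and y: "y \<in> carrier frac" and z: "z \<in> carrier frac"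
  obtain a b where ab: "a \<in> carrier R" "b \<in> nz" "x = \<kappa> a b" using x by (rule fracE)
  obtain c e where ce: "c \<in> carrier R" "e \<in> nz" "y = \<kappa> c e" using y by (rule fracE)
  obtain g h where gh: "g \<in> carrier R" "h \<in> nz" "z = \<kappa> g h" using z by (rule fracE)
  have r: "a \<in> carrier R" "b \<in> carrier R" "c \<in> carrier R" "e \<in> carrier R" "g \<in> carrier R" "h \<in> carrier R"
    using ab ce gh by auto
  note n = nz_mult[OF ab(2) ce(2)] nz_mult[OF ce(2) gh(2)] nz_mult[OF ab(2) gh(2)]
  have "(x \<oplus>\<^bsub>frac\<^esub> y) \<otimes>\<^bsub>frac\<^esub> z = \<kappa> ((a \<otimes> e \<oplus> c \<otimes> b) \<otimes> g) ((b \<otimes> e) \<otimes> h)"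
    unfolding ab ce gh using r ab(2) ce(2) gh(2) n by (simp add: frac_add frac_mult)
  also have "\<dots> = \<kappa> (h \<otimes> ((a \<otimes> e \<oplus> c \<otimes> b) \<otimes> g)) (h \<otimes> ((b \<otimes> e) \<otimes> h))"
    using r nz_mult[OF n(1) gh(2)] gh(2) by (intro \<kappa>_cancel[symmetric]) auto
  also have "h \<otimes> ((a \<otimes> e \<oplus> c \<otimes> b) \<otimes> g) = (a \<otimes> g) \<otimes> (e \<otimes> h) \<oplus> (c \<otimes> g) \<otimes> (b \<otimes> h)" using r by algebra
  also have "h \<otimes> ((b \<otimes> e) \<otimes> h) = (b \<otimes> h) \<otimes> (e \<otimes> h)" using r by algebra
  also have "\<kappa> ((a \<otimes> g) \<otimes> (e \<otimes> h) \<oplus> (c \<otimes> g) \<otimes> (b \<otimes> h)) ((b \<otimes> h) \<otimes> (e \<otimes> h)) =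
      x \<otimes>\<^bsub>frac\<^esub> z \<oplus>\<^bsub>frac\<^esub> y \<otimes>\<^bsub>frac\<^esub> z"
    unfolding ab ce gh using r ab(2) ce(2) gh(2) n by (simp add: frac_add frac_mult)
  finally show "(x \<oplus>\<^bsub>frac\<^esub> y) \<otimes>\<^bsub>frac\<^esub> z = x \<otimes>\<^bsub>frac\<^esub> z \<oplus>\<^bsub>frac\<^esub> y \<otimes>\<^bsub>frac\<^esub> z" .
qed

lemma frac_embed_hom: "(\<lambda>a. \<kappa> a \<one>) \<in> ring_hom R frac"
  using one_nz by (intro ring_hom_memI) (auto simp: frac_add frac_mult frac_one intro!: \<kappa>_closed)

lemma frac_embed_eq_zero: "a \<in> carrier R \<Longrightarrow> \<kappa> a \<one> = \<zero>\<^bsub>frac\<^esub> \<longleftrightarrow> a = \<zero>"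
  unfolding frac_zero by (subst \<kappa>_eq_iff) auto

lemma d_one: "d \<one> = \<zero>"
proof -
  have "\<zero> \<oplus> d \<one> = d \<one> \<oplus> d \<one>" using d_mult[of \<one> \<one>] d_closed[of \<one>] by simp
  then show ?thesis using d_closed[of \<one>] by (metis add.r_cancel one_closed zero_closed)
qed

lemma frac_embed_der: "a \<in> carrier R \<Longrightarrow> \<partial>\<^bsub>frac\<^esub> (\<kappa> a \<one>) = \<kappa> (d a) \<one>"
  using frac_der[of a \<one>] d_closed[of a] by (simp add: d_one minus_eq)

lemma frac_differential_field: "differential_field frac"
proof -
  interpret fr: cring frac by (rule frac_cring)
  interpret emb: ring_hom_cring R frac "\<lambda>a. \<kappa> a \<one>"
    by (intro ring_hom_cring.intro ring_hom_cring_axioms.intro is_cring frac_cring frac_embed_hom)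
  have field: "field frac"
  proof (rule fr.cring_fieldI2)
    show "\<zero>\<^bsub>frac\<^esub> \<noteq> \<one>\<^bsub>frac\<^esub>" using frac_embed_eq_zero[OF one_closed] zero_not_one frac_one by metis
    fix x assume x: "x \<in> carrier frac" "x \<noteq> \<zero>\<^bsub>frac\<^esub>"
    obtain a b where ab: "a \<in> carrier R" "b \<in> nz" "x = \<kappa> a b" using x(1) by (rule fracE)
    have "a \<noteq> \<zero>"
    proof
      assume "a = \<zero>"
      then have "x = \<zero>\<^bsub>frac\<^esub>" unfolding ab frac_zero using ab by (intro \<kappa>_eqI one_nz) auto
      then show False using x by simp
    qed
    then have a: "a \<in> nz" using ab by auto
    have "x \<otimes>\<^bsub>frac\<^esub> \<kappa> b a = \<kappa> (a \<otimes> b) (b \<otimes> a)" unfolding ab using ab a by (intro frac_mult) auto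
    also have "\<dots> = \<one>\<^bsub>frac\<^esub>"
      unfolding frac_one using ab nz_mult[OF ab(2) a] by (intro \<kappa>_eqI one_nz) (auto simp: m_comm)
    finally show "\<exists>y\<in>carrier frac. x \<otimes>\<^bsub>frac\<^esub> y = \<one>\<^bsub>frac\<^esub>" using \<kappa>_closed[of b a] ab a by auto
  qed
  show ?thesis
  proof (intro differential_field.intro differential_field_axioms.intro field)
    fix x y assume x: "x \<in> carrier frac" and y: "y \<in> carrier frac"
    obtain a b where ab: "a \<in> carrier R" "b \<in> nz" "x = \<kappa> a b" using x by (rule fracE)
    obtain c e where ce: "c \<in> carrier R" "e \<in> nz" "y = \<kappa> c e" using y by (rule fracE)
    have r: "a \<in> carrier R" "b \<in> carrier R" "c \<in> carrier R" "e \<in> carrier R"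
      "d a \<in> carrier R" "d b \<in> carrier R" "d c \<in> carrier R" "d e \<in> carrier R"
      using ab ce d_closed by auto
    note be = nz_mult[OF ab(2) ce(2)] and bb = nz_mult[OF ab(2,2)] and ee = nz_mult[OF ce(2,2)]
    show "\<partial>\<^bsub>frac\<^esub> x \<in> carrier frac"
      unfolding ab frac_der[OF ab(1,2)] using r bb by (intro \<kappa>_closed) auto
    have dx: "d a \<otimes> b \<ominus> a \<otimes> d b \<in> carrier R" "d c \<otimes> e \<ominus> c \<otimes> d e \<in> carrier R" using r by auto
    have "\<partial>\<^bsub>frac\<^esub> (x \<oplus>\<^bsub>frac\<^esub> y) =
        \<kappa> (d (a \<otimes> e \<oplus> c \<otimes> b) \<otimes> (b \<otimes> e) \<ominus> (a \<otimes> e \<oplus> c \<otimes> b) \<otimes> d (b \<otimes> e)) ((b \<otimes> e) \<otimes> (b \<otimes> e))"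
      unfolding ab ce frac_add[OF ab(1,2) ce(1,2)] using r be by (intro frac_der) auto
    also have "d (a \<otimes> e \<oplus> c \<otimes> b) = (d a \<otimes> e \<oplus> a \<otimes> d e) \<oplus> (d c \<otimes> b \<oplus> c \<otimes> d b)"
      using r by (simp add: d_add d_mult)
    also have "d (b \<otimes> e) = d b \<otimes> e \<oplus> b \<otimes> d e" using r by (simp add: d_mult)
    also have "((d a \<otimes> e \<oplus> a \<otimes> d e) \<oplus> (d c \<otimes> b \<oplus> c \<otimes> d b)) \<otimes> (b \<otimes> e) \<ominus>
        (a \<otimes> e \<oplus> c \<otimes> b) \<otimes> (d b \<otimes> e \<oplus> b \<otimes> d e) =
        (d a \<otimes> b \<ominus> a \<otimes> d b) \<otimes> (e \<otimes> e) \<oplus> (d c \<otimes> e \<ominus> c \<otimes> d e) \<otimes> (b \<otimes> b)"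
      using r by algebra
    also have "(b \<otimes> e) \<otimes> (b \<otimes> e) = (b \<otimes> b) \<otimes> (e \<otimes> e)" using r by algebra
    also have "\<kappa> ((d a \<otimes> b \<ominus> a \<otimes> d b) \<otimes> (e \<otimes> e) \<oplus> (d c \<otimes> e \<ominus> c \<otimes> d e) \<otimes> (b \<otimes> b)) ((b \<otimes> b) \<otimes> (e \<otimes> e)) =
        \<partial>\<^bsub>frac\<^esub> x \<oplus>\<^bsub>frac\<^esub> \<partial>\<^bsub>frac\<^esub> y"
      unfolding ab ce frac_der[OF ab(1,2)] frac_der[OF ce(1,2)] frac_add[OF dx(1) bb dx(2) ee] ..
    finally show "\<partial>\<^bsub>frac\<^esub> (x \<oplus>\<^bsub>frac\<^esub> y) = \<partial>\<^bsub>frac\<^esub> x \<oplus>\<^bsub>frac\<^esub> \<partial>\<^bsub>frac\<^esub> y" .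
    have "\<partial>\<^bsub>frac\<^esub> (x \<otimes>\<^bsub>frac\<^esub> y) = \<kappa> (d (a \<otimes> c) \<otimes> (b \<otimes> e) \<ominus> (a \<otimes> c) \<otimes> d (b \<otimes> e)) ((b \<otimes> e) \<otimes> (b \<otimes> e))"
      unfolding ab ce frac_mult[OF ab(1,2) ce(1,2)] using r be by (intro frac_der) auto
    \<comment> \<open>Numerator and denominator are multiplied by \<open>b e\<close>, since the sum
      on the other side of the product rule comes with the denominator
      \<open>b^3 e^3\<close>.\<close>
    also have "\<dots> = \<kappa> ((b \<otimes> e) \<otimes> (d (a \<otimes> c) \<otimes> (b \<otimes> e) \<ominus> (a \<otimes> c) \<otimes> d (b \<otimes> e)))
        ((b \<otimes> e) \<otimes> ((b \<otimes> e) \<otimes> (b \<otimes> e)))"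
      using r be nz_mult[OF be be] d_closed by (intro \<kappa>_cancel[symmetric]) auto
    also have "d (a \<otimes> c) = d a \<otimes> c \<oplus> a \<otimes> d c" using r by (simp add: d_mult)
    also have "d (b \<otimes> e) = d b \<otimes> e \<oplus> b \<otimes> d e" using r by (simp add: d_mult)
    also have "(b \<otimes> e) \<otimes> ((d a \<otimes> c \<oplus> a \<otimes> d c) \<otimes> (b \<otimes> e) \<ominus> (a \<otimes> c) \<otimes> (d b \<otimes> e \<oplus> b \<otimes> d e)) =
        (d a \<otimes> b \<ominus> a \<otimes> d b) \<otimes> c \<otimes> (b \<otimes> (e \<otimes> e)) \<oplus> (a \<otimes> (d c \<otimes> e \<ominus> c \<otimes> d e)) \<otimes> ((b \<otimes> b) \<otimes> e)"
      using r by algebra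
    also have "(b \<otimes> e) \<otimes> ((b \<otimes> e) \<otimes> (b \<otimes> e)) = ((b \<otimes> b) \<otimes> e) \<otimes> (b \<otimes> (e \<otimes> e))" using r by algebra
    also have "\<kappa> ((d a \<otimes> b \<ominus> a \<otimes> d b) \<otimes> c \<otimes> (b \<otimes> (e \<otimes> e)) \<oplus> (a \<otimes> (d c \<otimes> e \<ominus> c \<otimes> d e)) \<otimes> ((b \<otimes> b) \<otimes> e))
        (((b \<otimes> b) \<otimes> e) \<otimes> (b \<otimes> (e \<otimes> e))) = \<partial>\<^bsub>frac\<^esub> x \<otimes>\<^bsub>frac\<^esub> y \<oplus>\<^bsub>frac\<^esub> x \<otimes>\<^bsub>frac\<^esub> \<partial>\<^bsub>frac\<^esub> y"
      unfolding ab ce frac_der[OF ab(1,2)] frac_der[OF ce(1,2)] frac_mult[OF dx(1) bb ce(1,2)]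
        frac_mult[OF ab(1,2) dx(2) ee]
      using r dx nz_mult[OF bb ce(2)] nz_mult[OF ab(2) ee] by (intro frac_add[symmetric]) auto
    finally show "\<partial>\<^bsub>frac\<^esub> (x \<otimes>\<^bsub>frac\<^esub> y) = \<partial>\<^bsub>frac\<^esub> x \<otimes>\<^bsub>frac\<^esub> y \<oplus>\<^bsub>frac\<^esub> x \<otimes>\<^bsub>frac\<^esub> \<partial>\<^bsub>frac\<^esub> y" .
  next
    fix m :: nat assume m: "0 < m"
    have "\<kappa> ([k] \<cdot> \<one>) \<one> = [k] \<cdot>\<^bsub>frac\<^esub> \<one>\<^bsub>frac\<^esub>" for k :: nat
      by (induction k) (auto simp: frac_one[symmetric] frac_zero[symmetric])
    then show "[m] \<cdot>\<^bsub>frac\<^esub> \<one>\<^bsub>frac\<^esub> \<noteq> \<zero>\<^bsub>frac\<^esub>"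
      using char_zero[OF m] frac_embed_eq_zero[of "[m] \<cdot> \<one>"] by simp
  qed
qed

end

text \<open>Iterating an injection of \<open>S \<times> S\<close> into \<open>S\<close> codes lists
  of equal length injectively; lists of different lengths may still collide, so a code of the length
  is paired with the result.\<close>

lemma ex_injection_lists:
  assumes "infinite S"
  shows "\<exists>h :: 'a list \<Rightarrow> 'a. inj_on h (lists S) \<and> h ` lists S \<subseteq> S"
proof -
  have "|S \<times> S| \<le>o |S|" using card_of_Times_same_infinite[OF assms] ordIso_iff_ordLeq by blast
  then obtain p where p: "inj_on p (S \<times> S)" "p ` (S \<times> S) \<subseteq> S" using card_of_ordLeq by metis
  obtain c :: "nat \<Rightarrow> 'a" where c: "inj c" "range c \<subseteq> S" using infinite_countable_subset[OF assms] by blast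
  define enc where "enc = rec_list (c 0) (\<lambda>x _ r. p (x, r))"
  have enc: "enc [] = c 0" "enc (x # xs) = p (x, enc xs)" for x xs by (simp_all add: enc_def)
  have enc_S: "enc xs \<in> S" if "xs \<in> lists S" for xs
    using that c(2) p(2) by (induction xs) (auto simp: enc)
  have inj: "xs = ys" if "xs \<in> lists S" "ys \<in> lists S" "length xs = length ys" "enc xs = enc ys" for xs ys
    using that(3,1,2,4)
  proof (induction xs ys rule: list_induct2)
    case Nil
    then show ?case by simp
  next
    case (Cons x xs y ys)
    then have "(x, enc xs) = (y, enc ys)"
      using enc_S by (intro inj_onD[OF p(1)]) (auto simp: enc)
    then show ?case using Cons by auto
  qed
  define h where "h xs = p (c (length xs), enc xs)" for xs
  have "inj_on h (lists S)"
  proof (rule inj_onI)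
    fix xs ys assume *: "xs \<in> lists S" "ys \<in> lists S" "h xs = h ys"
    have "(c (length xs), enc xs) = (c (length ys), enc ys)"
      using * enc_S c(2) by (intro inj_onD[OF p(1)]) (auto simp: h_def)
    then show "xs = ys" using inj[OF *(1,2)] injD[OF c(1)] by auto
  qed
  have "h xs \<in> S" if "xs \<in> lists S" for xs
  proof -
    have "(c (length xs), enc xs) \<in> S \<times> S" using enc_S[OF that] c(2) by auto
    then show ?thesis using p(2) unfolding h_def by blast
  qed
  then have "h ` lists S \<subseteq> S" by blast
  with \<open>inj_on h (lists S)\<close> show ?thesis by blast
qed

lemma ex_injection_pairs:
  assumes "infinite S" "inj_on g A" "g ` A \<subseteq> S"
  shows "\<exists>h. inj_on h (A \<times> A) \<and> h ` (A \<times> A) \<subseteq> S"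
proof -
  have "|S \<times> S| \<le>o |S|" using card_of_Times_same_infinite[OF assms(1)] ordIso_iff_ordLeq by blast
  then obtain p where p: "inj_on p (S \<times> S)" "p ` (S \<times> S) \<subseteq> S" using card_of_ordLeq by metis
  have "inj_on (p \<circ> map_prod g g) (A \<times> A)"
  proof (rule comp_inj_on)
    show "inj_on (map_prod g g) (A \<times> A)" using map_prod_inj_on[OF assms(2,2)] .
    show "inj_on p (map_prod g g ` (A \<times> A))" using assms(3) by (intro inj_on_subset[OF p(1)]) auto
  qed
  moreover have "(p \<circ> map_prod g g) ` (A \<times> A) \<subseteq> S" using assms(3) p(2) by fastforce
  ultimately show ?thesis by blast
qed

text \<open>Choosing one representative in each class of fractions gives \<open>\<kappa>\<close>.\<close>

lemma (in domain) ex_fraction_map: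
  fixes h :: "'a \<times> 'a \<Rightarrow> 'c"
  assumes h: "inj_on h (carrier R \<times> carrier R)"
  shows "\<exists>\<kappa>. \<forall>a\<in>carrier R. \<forall>b\<in>carrier R. \<forall>c\<in>carrier R. \<forall>e\<in>carrier R. b \<noteq> \<zero> \<longrightarrow> e \<noteq> \<zero> \<longrightarrow>
    (\<kappa> a b :: 'c) = \<kappa> c e \<longleftrightarrow> a \<otimes> e = c \<otimes> b"
proof -
  define Q where "Q a b = {(c, e). c \<in> carrier R \<and> e \<in> carrier R \<and> e \<noteq> \<zero> \<and> a \<otimes> e = c \<otimes> b}" for a b
  have self: "(a, b) \<in> Q a b" if "a \<in> carrier R" "b \<in> carrier R" "b \<noteq> \<zero>" for a b
    using that by (simp add: Q_def)
  have trans: "a \<otimes> k = g \<otimes> b"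
    if "a \<otimes> e = c \<otimes> b" "c \<otimes> k = g \<otimes> e" and r: "a \<in> carrier R" "b \<in> carrier R" "c \<in> carrier R"
      "e \<in> carrier R" "e \<noteq> \<zero>" "g \<in> carrier R" "k \<in> carrier R" for a b c e g k
  proof -
    have "e \<otimes> (a \<otimes> k) = (a \<otimes> e) \<otimes> k" using r by algebra
    also have "\<dots> = b \<otimes> (c \<otimes> k)" unfolding that(1) using r by algebra
    also have "\<dots> = e \<otimes> (g \<otimes> b)" unfolding that(2) using r by algebra
    finally show ?thesis using r m_lcancel by auto
  qed
  have Q_eq: "Q a b = Q c e" if "a \<otimes> e = c \<otimes> b" "a \<in> carrier R" "b \<in> carrier R" "b \<noteq> \<zero>" "c \<in> carrier R"
      "e \<in> carrier R" "e \<noteq> \<zero>" for a b c e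
  proof -
    have "c \<otimes> b = a \<otimes> e" using that(1) by simp
    then show ?thesis
      unfolding Q_def using that trans[of a e c b] trans[of c b a e] trans by blast
  qed
  define \<kappa> where "\<kappa> a b = h (SOME q. q \<in> Q a b)" for a b
  have some: "(SOME q. q \<in> Q a b) \<in> Q a b" if "a \<in> carrier R" "b \<in> carrier R" "b \<noteq> \<zero>" for a b
    using someI[of "\<lambda>q. q \<in> Q a b", OF self[OF that]] .
  show ?thesis
  proof (intro exI[of _ \<kappa>] ballI impI iffI)
    fix a b c e assume r: "a \<in> carrier R" "b \<in> carrier R" "c \<in> carrier R" "e \<in> carrier R" "b \<noteq> \<zero>" "e \<noteq> \<zero>"
    {
      assume "a \<otimes> e = c \<otimes> b"
      then have "Q a b = Q c e" by (rule Q_eq) (use r in auto)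
      then show "\<kappa> a b = \<kappa> c e" by (simp only: \<kappa>_def)
    next
      assume eq: "\<kappa> a b = \<kappa> c e"
      obtain g k where gk: "(SOME q. q \<in> Q a b) = (g, k)" by fastforce
      obtain g' k' where gk': "(SOME q. q \<in> Q c e) = (g', k')" by fastforce
      have 1: "(g, k) \<in> Q a b" "(g', k') \<in> Q c e"
        using some[of a b] some[of c e] r gk gk' by auto
      have "h (g, k) = h (g', k')" using eq unfolding \<kappa>_def gk gk' .
      then have "(g, k) = (g', k')"
        by (rule inj_onD[OF h]) (use 1 in \<open>auto simp: Q_def\<close>)
      then have "a \<otimes> k = g \<otimes> b" "g \<otimes> e = c \<otimes> k" "g \<in> carrier R" "k \<in> carrier R" "k \<noteq> \<zero>"
        using 1 by (auto simp: Q_def)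
      then show "a \<otimes> e = c \<otimes> b" using trans[of a k g b e c] r by simp
    }
  qed
qed

text \<open>The multiples of one are distinct in characteristic zero. This is the room that lets
  polynomials and fractions be coded by elements of the field itself.\<close>

lemma (in differential_field) infinite_carrier: "infinite (carrier K)"
proof -
  have "inj (\<lambda>n::nat. [n] \<cdot> \<one>)"
  proof (rule linorder_injI)
    fix m n :: nat assume mn: "m < n"
    show "[m] \<cdot> \<one> \<noteq> [n] \<cdot> \<one>"
    proof
      assume eq: "[m] \<cdot> \<one> = [n] \<cdot> \<one>"
      have "[n] \<cdot> \<one> = [m] \<cdot> \<one> \<oplus> [(n - m)] \<cdot> \<one>"
        using mn add.nat_pow_mult[of \<one> m "n - m"] by simp
      then have "[m] \<cdot> \<one> \<oplus> \<zero> = [m] \<cdot> \<one> \<oplus> [(n - m)] \<cdot> \<one>" using eq by simp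
      then have "[(n - m)] \<cdot> \<one> = \<zero>" by (metis add.l_cancel add.nat_pow_closed one_closed zero_closed)
      then show False using char_zero[of "n - m"] mn by simp
    qed
  qed
  moreover have "range (\<lambda>n::nat. [n] \<cdot> \<one>) \<subseteq> carrier K" by auto
  ultimately show ?thesis using infinite_iff_countable_subset by blast
qed

section \<open>Adjoining integrals\<close>

context differential_field
begin

lemma der_add_pow: "a \<in> carrier K \<Longrightarrow> \<partial> ([(k::nat)] \<cdot> a) = [k] \<cdot> \<partial> a"
  by (induction k) (auto simp: der_zero der_add der_closed)

lemma add_pow_eq_mult: "a \<in> carrier K \<Longrightarrow> [(k::nat)] \<cdot> a = ([k] \<cdot> \<one>) \<otimes> a"
  by (simp add: add_pow_ldistr)

end

context differential_place
begin

text \<open>A constant \<open>x\<close> of \<open>F(w)\<close> outside \<open>F\<close> would, through the coefficient of \<open>w\<close> in \<open>u\<close> where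
  \<open>x = w\<^sup>e u\<close>, provide an integral of \<open>f\<close> in \<open>F\<close>.\<close>

lemma constants_of_logarithmic:
  assumes f: "f \<in> F" "\<And>a. a \<in> F \<Longrightarrow> \<partial> a \<noteq> f" and dw: "\<partial> w = w \<otimes> \<ominus> (f \<otimes> w)"
    and x: "x \<in> generate_field K (insert w F)" "\<partial> x = \<zero>"
  shows "x \<in> F"
proof -
  have wc: "w \<in> carrier K" using w_in_V V_facts by auto
  have fc: "f \<in> carrier K" using f F_carrier by auto
  define s where "s = \<ominus> (f \<otimes> w)"
  have sc: "s \<in> carrier K" using fc wc by (simp add: s_def)
  \<comment> \<open>A nonzero constant has neither zero nor pole at \<open>w = 0\<close>: in
    \<open>x = w^e u\<close> or \<open>x w^e = u\<close>, an exponent \<open>e > 0\<close> is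
    refuted by producing an integral of \<open>f\<close> in \<open>F\<close>.\<close>
  have unit: "x \<in> V \<and> (\<exists>c. residue x c \<and> c \<noteq> \<zero> \<and> \<partial> c = \<zero>)"
    if x: "x \<in> generate_field K (insert w F)" "\<partial> x = \<zero>" "x \<noteq> \<zero>" for x
  proof -
    have xc: "x \<in> carrier K"
      using x generate_field_in_carrier[of "insert w F"] F_facts wc by auto
    obtain u c e where u: "residue u c" "c \<noteq> \<zero>" "x = w [^] (e::nat) \<otimes> u \<or> x \<otimes> w [^] e = u"
      using factorization[OF x(1,3)] by metis
    note uc = residue_closed[OF u(1)]
    define k where "k = [e] \<cdot> \<one>"
    have k: "k \<in> carrier K" "k \<in> F" "\<partial> k = \<zero>"
      using F_facts(12)[OF F_facts(6), of e] der_add_pow[of \<one> e] by (auto simp: k_def der_one)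
    define t where "t = w [^] e"
    have t: "t \<in> carrier K" "t \<noteq> \<zero>" using wc pow_nonzero w_nonzero by (auto simp: t_def)
    have dt: "\<partial> t = t \<otimes> (k \<otimes> s)"
      using der_pow_log[OF wc sc, of e] dw sc add_pow_eq_mult[OF sc, of e] by (simp add: t_def k_def s_def)
    \<comment> \<open>From \<open>x' = 0\<close> and \<open>w' = -f w^2\<close>, the logarithmic
      derivative of \<open>u\<close> is \<open>g w\<close>, with \<open>g = e f\<close> when
      \<open>w^e\<close> is a factor of \<open>x\<close> and \<open>g = -e f\<close> when it is a
      denominator.\<close>
    have "\<exists>g\<in>F. (g = k \<otimes> f \<or> g = \<ominus> (k \<otimes> f)) \<and> \<partial> u = w \<otimes> (g \<otimes> u)"
      using u(3)
    proof
      assume e: "x = w [^] e \<otimes> u"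
      have d: "\<partial> u \<in> carrier K" using der_closed uc by auto
      have "\<zero> = (t \<otimes> (k \<otimes> s)) \<otimes> u \<oplus> t \<otimes> \<partial> u"
        using x(2) dt uc t unfolding e t_def[symmetric] by (simp add: der_mult)
      then have "t \<otimes> \<partial> u = \<zero> \<ominus> (t \<otimes> (k \<otimes> s)) \<otimes> u"
        using t uc d sc k by (intro eq_add_imp) auto
      also have "\<dots> = t \<otimes> (w \<otimes> ((k \<otimes> f) \<otimes> u))"
        unfolding s_def using t(1) uc(4) wc fc k(1) by algebra
      finally have "\<partial> u = w \<otimes> ((k \<otimes> f) \<otimes> u)"
        using m_lcancel[OF t(2,1)] d wc fc k uc by auto
      then show ?thesis using F_facts(9)[OF k(2) f(1)] by auto
    next
      assume e: "x \<otimes> w [^] e = u"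
      have "\<partial> u = x \<otimes> (t \<otimes> (k \<otimes> s))"
        unfolding e[symmetric] t_def[symmetric] using dt x(2) xc t k sc by (simp add: der_mult)
      also have "\<dots> = w \<otimes> (\<ominus> (k \<otimes> f) \<otimes> (x \<otimes> t))"
        unfolding s_def using t(1) xc wc fc k(1) by algebra
      finally have "\<partial> u = w \<otimes> (\<ominus> (k \<otimes> f) \<otimes> u)" using e by (simp add: t_def)
      then show ?thesis using F_facts(7)[OF F_facts(9)[OF k(2) f(1)]] by auto
    qed
    then obtain g where g: "g \<in> F" "g = k \<otimes> f \<or> g = \<ominus> (k \<otimes> f)" "\<partial> u = w \<otimes> (g \<otimes> u)" by auto
    have gc: "g \<in> carrier K" using g F_carrier by auto
    have gV: "g \<in> V" using g F_subset_V by auto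
    have fV: "f \<in> V" using f F_subset_V by auto
    obtain v where v: "c \<in> F" "v \<in> V" "u = c \<oplus> w \<otimes> v" using u(1) by (rule residueE)
    have vc: "v \<in> carrier K" "\<partial> v \<in> carrier K" "\<partial> v \<in> V" using v V_facts der_closed der_in_V by auto
    have dc: "\<partial> c = \<zero>"
      using residue_unique[OF residue_der[OF u(1)]] g(3) residue_uniformizer[OF V_facts(6)[OF gV uc(3)]] by simp
    \<comment> \<open>As \<open>c\<close> is constant, the derivative of \<open>u = c + w v\<close>
      is that of \<open>w v\<close>; cancelling \<open>w\<close> and taking residues will give
      \<open>a' = g c\<close> for the residue \<open>a\<close> of \<open>v\<close>.\<close>
    have "w \<otimes> (g \<otimes> u) = \<partial> (w \<otimes> v)"
      using g(3) dc vc uc wc der_closed unfolding v(3) by (simp add: der_add)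
    also have "\<dots> = w \<otimes> (\<partial> v \<ominus> f \<otimes> w \<otimes> v)"
      using vc wc fc dw by (simp add: der_mult) algebra
    also have "f \<otimes> w \<otimes> v = w \<otimes> (f \<otimes> v)" using vc(1) wc fc by algebra
    finally have "w \<otimes> (g \<otimes> u) = w \<otimes> (\<partial> v \<ominus> w \<otimes> (f \<otimes> v))" .
    then have "g \<otimes> u = \<partial> v \<ominus> w \<otimes> (f \<otimes> v)"
      using m_lcancel[OF w_nonzero wc, of "g \<otimes> u" "\<partial> v \<ominus> w \<otimes> (f \<otimes> v)"] gc uc vc fc wc by blast
    then have eq: "\<partial> v = g \<otimes> u \<oplus> w \<otimes> (f \<otimes> v)"
      using gc uc vc fc wc by (simp add: minus_eq a_assoc l_neg)
    obtain a where a: "residue v a" using ex_residue[OF v(2)] by auto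
    note ac = residue_closed[OF a]
    have "residue (\<partial> v) (g \<otimes> c \<oplus> \<zero>)"
      unfolding eq using fV v(2) V_facts
      by (intro residue_add residue_mult residue_const[OF g(1)] u(1) residue_uniformizer) auto
    then have da: "\<partial> a = g \<otimes> c" using residue_unique[OF residue_der[OF a]] gc uc by simp
    \<comment> \<open>With \<open>g = e f\<close> or \<open>g = -e f\<close> and \<open>c\<close>
      constant, \<open>a / (e c)\<close> or its negative is an element of \<open>F\<close> with
      derivative \<open>f\<close>, which is excluded.\<close>
    have "e = 0"
    proof (rule ccontr)
      assume "e \<noteq> 0"
      then have knz: "k \<noteq> \<zero>" using char_zero[of e] by (simp add: k_def)
      have kc: "k \<otimes> c \<in> F" "k \<otimes> c \<noteq> \<zero>" "k \<otimes> c \<in> carrier K" "\<partial> (k \<otimes> c) = \<zero>"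
        using F_facts(9)[OF k(2) v(1)] integral[of k c] knz u(2) k uc dc by (auto simp: der_mult)
      define b where "b = inv (k \<otimes> c)"
      note ib = inverse_facts[OF kc(3,2), folded b_def]
      have b: "b \<in> F" "b \<in> carrier K" "\<partial> b = \<zero>"
      proof -
        show "b \<in> F" using F_facts(10)[OF kc(1,2)] by (simp add: b_def)
        show "b \<in> carrier K" by (rule ib)
        have "\<one> \<otimes> b \<in> constants K" unfolding b_def
          by (rule der_quotient_zero[of \<one> "k \<otimes> c" \<zero>]) (use kc in \<open>simp_all add: der_one\<close>)
        then show "\<partial> b = \<zero>" using ib by (simp add: constants_def)
      qed
      have dab: "\<partial> (a \<otimes> b) = (g \<otimes> c) \<otimes> b" using ac b da gc uc by (simp add: der_mult)
      from g(2) show False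
      proof
        assume "g = k \<otimes> f"
        then have "(g \<otimes> c) \<otimes> b = f \<otimes> ((k \<otimes> c) \<otimes> b)" using k fc uc b by (simp add: m_ac)
        then show False using dab ib(2) fc f(2)[OF F_facts(9)[OF ac(1) b(1)]] by simp
      next
        assume "g = \<ominus> (k \<otimes> f)"
        then have "(g \<otimes> c) \<otimes> b = \<ominus> (f \<otimes> ((k \<otimes> c) \<otimes> b))" using k fc uc b by (simp add: m_ac l_minus r_minus)
        then have "\<partial> (\<ominus> (a \<otimes> b)) = f" using dab ib(2) fc ac b by (simp add: der_a_inv)
        then show False using f(2)[OF F_facts(7)[OF F_facts(9)[OF ac(1) b(1)]]] by simp
      qed
    qed
    then have "x = u" using u(3) xc uc by auto
    then show ?thesis using u dc uc by auto
  qed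
  show ?thesis
  proof (cases "x = \<zero>")
    case True
    then show ?thesis using F_facts by simp
  next
    case False
    have xc: "x \<in> carrier K"
      using x generate_field_in_carrier[of "insert w F"] F_facts wc by auto
    obtain c where c: "residue x c" "\<partial> c = \<zero>" using unit[OF x False] by auto
    note cc = residue_closed[OF c(1)]
    \<comment> \<open>Subtracting the constant residue leaves a constant of \<open>F(w)\<close> with
      residue zero; by \<open>unit\<close> it cannot be nonzero.\<close>
    define y where "y = x \<ominus> c"
    have "c \<in> generate_field K (insert w F)" using cc by (auto intro: generate_field.incl)
    then have y: "y \<in> generate_field K (insert w F)"
      unfolding y_def minus_eq using x by (intro generate_field.eng_add generate_field.a_inv)
    have dy: "\<partial> y = \<zero>" using xc cc c x by (simp add: y_def der_minus)
    have mc: "residue (\<ominus> c) (\<ominus> c)" using residue_const F_facts cc by auto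
    have ry: "residue y \<zero>" using residue_add[OF c(1) mc] cc by (simp add: y_def minus_eq r_neg)
    have "y = \<zero>"
    proof (rule ccontr)
      assume "y \<noteq> \<zero>"
      then show False using unit[OF y dy] residue_unique[OF ry] by auto
    qed
    then have "x = c" using xc cc by (simp add: y_def)
    then show ?thesis using cc by simp
  qed
qed

end

section \<open>Polynomials under the derivation of the reciprocal of an integral\<close>

context differential_field
begin

lemma UP_is_domain: "UP_domain K"
  by (intro UP_domain.intro domain_axioms)

text \<open>Leibniz rules for the convolution of coefficient sequences: termwise for the derivation
  of coefficients, and for multiplication by the index because
  \<open>n = i + (n - i)\<close>.\<close>

lemma up_finsum_coeff:
  fixes p q :: "nat \<Rightarrow> 'a"
  assumes "\<And>i. p i \<in> carrier K" "\<And>i. q i \<in> carrier K"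
  shows "\<partial> (\<Oplus>i\<in>{..n}. p i \<otimes> q (n - i)) =
      (\<Oplus>i\<in>{..n}. \<partial> (p i) \<otimes> q (n - i)) \<oplus> (\<Oplus>i\<in>{..n}. p i \<otimes> \<partial> (q (n - i)))"
    and "add_pow K n \<one> \<otimes> (\<Oplus>i\<in>{..n}. p i \<otimes> q (n - i)) =
      (\<Oplus>i\<in>{..n}. (add_pow K i \<one> \<otimes> p i) \<otimes> q (n - i)) \<oplus> (\<Oplus>i\<in>{..n}. p i \<otimes> (add_pow K (n - i) \<one> \<otimes> q (n - i)))"
proof -
  have d: "\<partial> (p i) \<in> carrier K" "\<partial> (q i) \<in> carrier K" for i using assms der_closed by auto
  have "\<partial> (\<Oplus>i\<in>{..n}. p i \<otimes> q (n - i)) = (\<Oplus>i\<in>{..n}. \<partial> (p i) \<otimes> q (n - i) \<oplus> p i \<otimes> \<partial> (q (n - i)))"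
    using assms d by (subst der_finsum) (auto simp: der_mult)
  also have "\<dots> = (\<Oplus>i\<in>{..n}. \<partial> (p i) \<otimes> q (n - i)) \<oplus> (\<Oplus>i\<in>{..n}. p i \<otimes> \<partial> (q (n - i)))"
    using assms d by (intro finsum_addf) auto
  finally show "\<partial> (\<Oplus>i\<in>{..n}. p i \<otimes> q (n - i)) =
      (\<Oplus>i\<in>{..n}. \<partial> (p i) \<otimes> q (n - i)) \<oplus> (\<Oplus>i\<in>{..n}. p i \<otimes> \<partial> (q (n - i)))" .
  have "add_pow K n \<one> \<otimes> (\<Oplus>i\<in>{..n}. p i \<otimes> q (n - i)) = (\<Oplus>i\<in>{..n}. add_pow K n \<one> \<otimes> (p i \<otimes> q (n - i)))"
    using assms by (intro finsum_rdistr) auto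
  also have "\<dots> = (\<Oplus>i\<in>{..n}. (add_pow K i \<one> \<otimes> p i) \<otimes> q (n - i) \<oplus> p i \<otimes> (add_pow K (n - i) \<one> \<otimes> q (n - i)))"
  proof (intro finsum_cong')
    fix i assume i: "i \<in> {..n}"
    define a where "a = add_pow K i \<one>" define b where "b = add_pow K (n - i) \<one>"
    have ab: "a \<in> carrier K" "b \<in> carrier K" by (auto simp: a_def b_def)
    have "add_pow K n \<one> = a \<oplus> b" using i add.nat_pow_mult[of \<one> i "n - i"] by (simp add: a_def b_def)
    then show "add_pow K n \<one> \<otimes> (p i \<otimes> q (n - i)) =
        (add_pow K i \<one> \<otimes> p i) \<otimes> q (n - i) \<oplus> p i \<otimes> (add_pow K (n - i) \<one> \<otimes> q (n - i))"
      unfolding a_def[symmetric] b_def[symmetric] using assms(1)[of i] assms(2)[of "n - i"] ab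
      by simp algebra
  qed (use assms in auto)
  also have "\<dots> = (\<Oplus>i\<in>{..n}. (add_pow K i \<one> \<otimes> p i) \<otimes> q (n - i)) \<oplus>
      (\<Oplus>i\<in>{..n}. p i \<otimes> (add_pow K (n - i) \<one> \<otimes> q (n - i)))"
    using assms by (intro finsum_addf) auto
  finally show "add_pow K n \<one> \<otimes> (\<Oplus>i\<in>{..n}. p i \<otimes> q (n - i)) =
      (\<Oplus>i\<in>{..n}. (add_pow K i \<one> \<otimes> p i) \<otimes> q (n - i)) \<oplus> (\<Oplus>i\<in>{..n}. p i \<otimes> (add_pow K (n - i) \<one> \<otimes> q (n - i)))" .
qed

text \<open>The derivation is the sum of the coefficientwise derivation \<open>\<delta>\<close> and of \<open>- f X\<close> times the Euler
  operator \<open>\<theta> = X d/dX\<close>.\<close>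

lemma ex_UP_derivation:
  fixes P (structure)
  defines "P \<equiv> UP K"
  assumes f: "f \<in> carrier K"
  shows "\<exists>d. (\<forall>p\<in>carrier P. d p \<in> carrier P) \<and>
    (\<forall>p\<in>carrier P. \<forall>q\<in>carrier P. d (p \<oplus>\<^bsub>P\<^esub> q) = d p \<oplus>\<^bsub>P\<^esub> d q) \<and>
    (\<forall>p\<in>carrier P. \<forall>q\<in>carrier P. d (p \<otimes>\<^bsub>P\<^esub> q) = d p \<otimes>\<^bsub>P\<^esub> q \<oplus>\<^bsub>P\<^esub> p \<otimes>\<^bsub>P\<^esub> d q) \<and>
    (\<forall>a\<in>carrier K. d (up_ring.monom P a 0) = up_ring.monom P (\<partial>\<^bsub>K\<^esub> a) 0) \<and>
    d (up_ring.monom P \<one>\<^bsub>K\<^esub> 1) = up_ring.monom P \<one>\<^bsub>K\<^esub> 1 \<otimes>\<^bsub>P\<^esub> \<ominus>\<^bsub>P\<^esub> (up_ring.monom P f 0 \<otimes>\<^bsub>P\<^esub> up_ring.monom P \<one>\<^bsub>K\<^esub> 1)"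
proof -
  let ?c = "up_ring.coeff P"
  have mem: "g \<in> carrier P \<and> ?c g = g" if "\<And>n. g n \<in> carrier K" "\<And>n. m < n \<Longrightarrow> g n = \<zero>\<^bsub>K\<^esub>" for g m
  proof -
    have "g \<in> up K" using that by (intro mem_upI) (auto intro!: exI[of _ m] bound.intro)
    then show ?thesis unfolding P_def UP_def by simp
  qed
  interpret UP: UP_domain K P unfolding P_def by (rule UP_is_domain)
  interpret PD: domain P by (rule UP.UP_domain)
  have cc: "?c p n \<in> carrier K" if "p \<in> carrier P" for p n using UP.coeff_closed[OF that] .
  have c0: "?c p n = \<zero>\<^bsub>K\<^esub>" if "p \<in> carrier P" "deg K p < n" for p n
    using UP.deg_aboveD[OF that(2,1)] .
  define \<delta> where "\<delta> p = (\<lambda>n. \<partial>\<^bsub>K\<^esub> (?c p n))" for p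
  define \<theta> where "\<theta> p = (\<lambda>n. add_pow K n \<one>\<^bsub>K\<^esub> \<otimes>\<^bsub>K\<^esub> ?c p n)" for p
  have \<delta>: "\<delta> p \<in> carrier P" "?c (\<delta> p) n = \<partial>\<^bsub>K\<^esub> (?c p n)" if "p \<in> carrier P" for p n
    using mem[of "\<delta> p" "deg K p"] cc[OF that] c0[OF that] der_closed der_zero
    by (auto simp: \<delta>_def)
  have \<theta>: "\<theta> p \<in> carrier P" "?c (\<theta> p) n = add_pow K n \<one>\<^bsub>K\<^esub> \<otimes>\<^bsub>K\<^esub> ?c p n" if "p \<in> carrier P" for p n
    using mem[of "\<theta> p" "deg K p"] cc[OF that] c0[OF that] by (auto simp: \<theta>_def)
  have \<delta>_add: "\<delta> (p \<oplus>\<^bsub>P\<^esub> q) = \<delta> p \<oplus>\<^bsub>P\<^esub> \<delta> q" if "p \<in> carrier P" "q \<in> carrier P" for p q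
    using that \<delta> cc by (intro UP.up_eqI) (auto simp: der_add)
  have \<theta>_add: "\<theta> (p \<oplus>\<^bsub>P\<^esub> q) = \<theta> p \<oplus>\<^bsub>P\<^esub> \<theta> q" if "p \<in> carrier P" "q \<in> carrier P" for p q
    using that \<theta> cc by (intro UP.up_eqI) (auto simp: r_distr)
  have \<delta>_mult: "\<delta> (p \<otimes>\<^bsub>P\<^esub> q) = \<delta> p \<otimes>\<^bsub>P\<^esub> q \<oplus>\<^bsub>P\<^esub> p \<otimes>\<^bsub>P\<^esub> \<delta> q" if "p \<in> carrier P" "q \<in> carrier P" for p q
  proof (rule UP.up_eqI)
    show "?c (\<delta> (p \<otimes>\<^bsub>P\<^esub> q)) n = ?c (\<delta> p \<otimes>\<^bsub>P\<^esub> q \<oplus>\<^bsub>P\<^esub> p \<otimes>\<^bsub>P\<^esub> \<delta> q) n" for n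
      using up_finsum_coeff(1)[of "?c p" "?c q" n] that \<delta> cc by simp
  qed (use that \<delta> in auto)
  have \<theta>_mult: "\<theta> (p \<otimes>\<^bsub>P\<^esub> q) = \<theta> p \<otimes>\<^bsub>P\<^esub> q \<oplus>\<^bsub>P\<^esub> p \<otimes>\<^bsub>P\<^esub> \<theta> q" if "p \<in> carrier P" "q \<in> carrier P" for p q
  proof (rule UP.up_eqI)
    show "?c (\<theta> (p \<otimes>\<^bsub>P\<^esub> q)) n = ?c (\<theta> p \<otimes>\<^bsub>P\<^esub> q \<oplus>\<^bsub>P\<^esub> p \<otimes>\<^bsub>P\<^esub> \<theta> q) n" for n
      using up_finsum_coeff(2)[of "?c p" "?c q" n] that \<theta> cc by simp
  qed (use that \<theta> in auto)
  let ?X = "up_ring.monom P \<one>\<^bsub>K\<^esub> 1"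
  \<comment> \<open>As the Euler operator fixes \<open>X\<close> and the coefficientwise derivation
    kills it, this factor gives \<open>X' = -f X^2\<close>.\<close>
  define g where "g = \<ominus>\<^bsub>P\<^esub> (up_ring.monom P f 0 \<otimes>\<^bsub>P\<^esub> ?X)"
  have g: "g \<in> carrier P" using f by (simp add: g_def)
  define d where "d p = \<delta> p \<oplus>\<^bsub>P\<^esub> g \<otimes>\<^bsub>P\<^esub> \<theta> p" for p
  show ?thesis
  proof (intro exI[of _ d] conjI ballI)
    fix p q assume p: "p \<in> carrier P" and q: "q \<in> carrier P"
    note r = p q g \<delta>(1)[OF p] \<delta>(1)[OF q] \<theta>(1)[OF p] \<theta>(1)[OF q]
    show "d p \<in> carrier P" using r by (simp add: d_def)
    show "d (p \<oplus>\<^bsub>P\<^esub> q) = d p \<oplus>\<^bsub>P\<^esub> d q"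
      unfolding d_def \<delta>_add[OF p q] \<theta>_add[OF p q] using r by algebra
    show "d (p \<otimes>\<^bsub>P\<^esub> q) = d p \<otimes>\<^bsub>P\<^esub> q \<oplus>\<^bsub>P\<^esub> p \<otimes>\<^bsub>P\<^esub> d q"
      unfolding d_def \<delta>_mult[OF p q] \<theta>_mult[OF p q] using r by algebra
  next
    fix a assume a: "a \<in> carrier K"
    have "\<theta> (up_ring.monom P a 0) = \<zero>\<^bsub>P\<^esub>"
      using a \<theta> by (intro UP.up_eqI) auto
    moreover have "\<delta> (up_ring.monom P a 0) = up_ring.monom P (\<partial>\<^bsub>K\<^esub> a) 0"
      using a \<delta> der_closed by (intro UP.up_eqI) (auto simp: der_zero)
    ultimately show "d (up_ring.monom P a 0) = up_ring.monom P (\<partial>\<^bsub>K\<^esub> a) 0"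
      using a der_closed g by (simp add: d_def)
  next
    have "\<theta> ?X = ?X"
      using \<theta>[of ?X] by (intro UP.up_eqI) auto
    moreover have "\<delta> ?X = \<zero>\<^bsub>P\<^esub>"
      using \<delta>[of ?X] by (intro UP.up_eqI) (auto simp: der_zero der_one)
    ultimately have "d ?X = g \<otimes>\<^bsub>P\<^esub> ?X" using g by (simp add: d_def)
    then show "d ?X = ?X \<otimes>\<^bsub>P\<^esub> \<ominus>\<^bsub>P\<^esub> (up_ring.monom P f 0 \<otimes>\<^bsub>P\<^esub> ?X)"
      unfolding g_def[symmetric] using g UP.UP_m_comm[of ?X g] by simp
  qed
qed

text \<open>The coefficients up to the degree determine a polynomial, so polynomials are coded as
  lists over the carrier and then by single elements.\<close>

lemma ex_UP_injection: "\<exists>g. inj_on g (carrier (UP K)) \<and> g ` carrier (UP K) \<subseteq> carrier K"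
proof -
  interpret UP: UP_domain K "UP K" by (rule UP_is_domain)
  obtain h :: "'a list \<Rightarrow> 'a" where h: "inj_on h (lists (carrier K))" "h ` lists (carrier K) \<subseteq> carrier K"
    using ex_injection_lists[OF infinite_carrier] by blast
  define l where "l p = map (up_ring.coeff (UP K) p) [0..<Suc (deg K p)]" for p
  have l: "l p \<in> lists (carrier K)" if "p \<in> carrier (UP K)" for p
    using UP.coeff_closed[OF that] by (auto simp: l_def)
  have "inj_on l (carrier (UP K))"
  proof (rule inj_onI)
    fix p q assume p: "p \<in> carrier (UP K)" and q: "q \<in> carrier (UP K)" and eq: "l p = l q"
    have "length (l p) = length (l q)" using eq by simp
    then have deg: "deg K p = deg K q" by (simp add: l_def)
    show "p = q"
    proof (rule UP.up_eqI[OF _ p q])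
      fix n
      show "up_ring.coeff (UP K) p n = up_ring.coeff (UP K) q n"
      proof (cases "n \<le> deg K p")
        case True
        then have "l p ! n = up_ring.coeff (UP K) p n" "l q ! n = up_ring.coeff (UP K) q n"
          using deg by (auto simp: l_def simp del: upt_Suc)
        then show ?thesis using eq by simp
      next
        case False
        then show ?thesis using UP.deg_aboveD p q deg by simp
      qed
    qed
  qed
  then have "inj_on (h \<circ> l) (carrier (UP K))"
    using l by (intro comp_inj_on inj_on_subset[OF h(1)]) auto
  moreover have "(h \<circ> l) ` carrier (UP K) \<subseteq> carrier K" using h(2) l by auto
  ultimately show ?thesis by blast
qed

end

context differential_field
begin

text \<open>The new field is \<open>K(X)\<close> with \<open>X' = -f X^2\<close>, formed as the
  fraction field of \<open>UP K\<close> and coded in the type of \<open>K\<close>. That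
  \<open>f\<close> has no antiderivative in \<open>K\<close> is what excludes new constants.\<close>

lemma ex_integral_extension:
  assumes f: "f \<in> carrier K" "\<And>a. a \<in> carrier K \<Longrightarrow> \<partial> a \<noteq> f"
  shows "\<exists>(N :: 'a differential_ring) \<psi> w. liouvillian_extension K N \<psi> \<and> w \<in> carrier N \<and> w \<noteq> \<zero>\<^bsub>N\<^esub> \<and>
    \<partial>\<^bsub>N\<^esub> w = w \<otimes>\<^bsub>N\<^esub> \<ominus>\<^bsub>N\<^esub> (\<psi> f \<otimes>\<^bsub>N\<^esub> w)"
proof -
  define P where "P = UP K"
  let ?m = "up_ring.monom P" and ?c = "up_ring.coeff P"
  interpret UP: UP_domain K P unfolding P_def by (rule UP_is_domain)
  let ?X = "?m \<one> 1"
  obtain d where d: "\<And>p. p \<in> carrier P \<Longrightarrow> d p \<in> carrier P"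
      "\<And>p q. p \<in> carrier P \<Longrightarrow> q \<in> carrier P \<Longrightarrow> d (p \<oplus>\<^bsub>P\<^esub> q) = d p \<oplus>\<^bsub>P\<^esub> d q"
      "\<And>p q. p \<in> carrier P \<Longrightarrow> q \<in> carrier P \<Longrightarrow> d (p \<otimes>\<^bsub>P\<^esub> q) = d p \<otimes>\<^bsub>P\<^esub> q \<oplus>\<^bsub>P\<^esub> p \<otimes>\<^bsub>P\<^esub> d q"
    and dm: "\<And>a. a \<in> carrier K \<Longrightarrow> d (?m a 0) = ?m (\<partial> a) 0"
    and dX: "d ?X = ?X \<otimes>\<^bsub>P\<^esub> \<ominus>\<^bsub>P\<^esub> (?m f 0 \<otimes>\<^bsub>P\<^esub> ?X)"
    using ex_UP_derivation[OF f(1), folded P_def] by blast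
  obtain g where g: "inj_on g (carrier P)" "g ` carrier P \<subseteq> carrier K"
    using ex_UP_injection unfolding P_def by blast
  obtain h where h: "inj_on h (carrier P \<times> carrier P)" "h ` (carrier P \<times> carrier P) \<subseteq> carrier K"
    using ex_injection_pairs[OF infinite_carrier g] by blast
  obtain \<kappa> :: "(nat \<Rightarrow> 'a) \<Rightarrow> (nat \<Rightarrow> 'a) \<Rightarrow> 'a" where \<kappa>: "\<forall>a\<in>carrier P. \<forall>b\<in>carrier P. \<forall>c\<in>carrier P.
      \<forall>e\<in>carrier P. b \<noteq> \<zero>\<^bsub>P\<^esub> \<longrightarrow> e \<noteq> \<zero>\<^bsub>P\<^esub> \<longrightarrow> \<kappa> a b = \<kappa> c e \<longleftrightarrow> a \<otimes>\<^bsub>P\<^esub> e = c \<otimes>\<^bsub>P\<^esub> b"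
    using domain.ex_fraction_map[OF UP.UP_domain h(1)] by blast
  have m_add_pow: "?m (add_pow K k \<one>) 0 = add_pow P k \<one>\<^bsub>P\<^esub>" for k :: nat
    by (induction k) auto
  have m_zero_iff: "?m a i = \<zero>\<^bsub>P\<^esub> \<longleftrightarrow> a = \<zero>" if "a \<in> carrier K" for a i
  proof
    assume "?m a i = \<zero>\<^bsub>P\<^esub>"
    then have "?c (?m a i) i = \<zero>" by simp
    then show "a = \<zero>" using that by simp
  qed simp
  interpret fr: fraction_map P d \<kappa>
  proof (intro fraction_map.intro UP.UP_domain fraction_map_axioms.intro)
    show "add_pow P m \<one>\<^bsub>P\<^esub> \<noteq> \<zero>\<^bsub>P\<^esub>" if "0 < m" for m :: nat
      unfolding m_add_pow[symmetric] using m_zero_iff char_zero[OF that] by simp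
    show "(\<kappa> a b = \<kappa> c e) = (a \<otimes>\<^bsub>P\<^esub> e = c \<otimes>\<^bsub>P\<^esub> b)"
      if "a \<in> carrier P" "b \<in> carrier P" "b \<noteq> \<zero>\<^bsub>P\<^esub>" "c \<in> carrier P" "e \<in> carrier P" "e \<noteq> \<zero>\<^bsub>P\<^esub>" for a b c e
      using \<kappa> that by blast
  qed (use d in auto)
  define N where "N = fr.frac"
  define \<iota> where "\<iota> a = \<kappa> a \<one>\<^bsub>P\<^esub>" for a
  interpret N: differential_field N unfolding N_def by (rule fr.frac_differential_field)
  interpret \<iota>: ring_hom_cring P N \<iota>
    unfolding \<iota>_def N_def
    by (intro ring_hom_cring.intro ring_hom_cring_axioms.intro UP.UP_cring fr.frac_cring fr.frac_embed_hom)
  have \<iota>_zero_iff: "\<iota> a = \<zero>\<^bsub>N\<^esub> \<longleftrightarrow> a = \<zero>\<^bsub>P\<^esub>" if "a \<in> carrier P" for a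
    unfolding \<iota>_def N_def by (rule fr.frac_embed_eq_zero[OF that])
  have \<iota>_der: "\<partial>\<^bsub>N\<^esub> (\<iota> a) = \<iota> (d a)" if "a \<in> carrier P" for a
    unfolding \<iota>_def N_def by (rule fr.frac_embed_der[OF that])
  define \<psi> where "\<psi> a = \<iota> (?m a 0)" for a
  define w where "w = \<iota> ?X"
  have X: "?X \<in> carrier P" by simp
  have wc: "w \<in> carrier N" by (simp add: w_def)
  have w0: "w \<noteq> \<zero>\<^bsub>N\<^esub>" using \<iota>_zero_iff[OF X] m_zero_iff[of \<one> 1] by (simp add: w_def)
  have mm: "?m (a \<otimes> b) 0 = ?m a 0 \<otimes>\<^bsub>P\<^esub> ?m b 0" if "a \<in> carrier K" "b \<in> carrier K" for a b
    using UP.monom_mult[OF that, of 0 0] by simp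
  interpret emb: differential_embedding K N "carrier K" \<psi>
  proof (intro differential_embedding.intro differential_embedding_axioms.intro)
    show "differential_subfield (carrier K) K"
      using carrier_is_subfield der_closed by (auto simp: differential_subfield_def)
    show "\<psi> (\<partial> x) = \<partial>\<^bsub>N\<^esub> (\<psi> x)" if "x \<in> carrier K" for x
      using that by (simp add: \<psi>_def \<iota>_der dm)
  qed (auto simp: \<psi>_def mm differential_field_axioms N.differential_field_axioms)
  define F where "F = \<psi> ` carrier K"
  have F: "differential_subfield F N" unfolding F_def by (rule emb.image_subfield[OF emb.S order.refl])
  note Ff = N.differential_subfieldD[OF F]
  have m_pow: "\<iota> (?m a n) = \<psi> a \<otimes>\<^bsub>N\<^esub> w [^]\<^bsub>N\<^esub> n" if "a \<in> carrier K" for a and n :: nat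
    using that
  proof (induction n)
    case 0
    then show ?case by (simp add: \<psi>_def)
  next
    case (Suc n)
    have "?m a (Suc n) = ?m a n \<otimes>\<^bsub>P\<^esub> ?X" using UP.monom_mult[OF Suc.prems one_closed, of n 1] Suc.prems by simp
    then have "\<iota> (?m a (Suc n)) = (\<psi> a \<otimes>\<^bsub>N\<^esub> w [^]\<^bsub>N\<^esub> n) \<otimes>\<^bsub>N\<^esub> w"
      using Suc by (simp add: w_def)
    then show ?case using wc emb.closed[OF Suc.prems] by (simp add: N.m_assoc)
  qed
  have dw: "\<partial>\<^bsub>N\<^esub> w = w \<otimes>\<^bsub>N\<^esub> \<ominus>\<^bsub>N\<^esub> (\<psi> f \<otimes>\<^bsub>N\<^esub> w)"
    unfolding w_def \<iota>_der[OF X] dX \<psi>_def using f(1) by simp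
  have tr: "N.transcendental F w"
  proof (rule N.transcendentalI[OF Ff(2) wc])
    fix p assume p: "set p \<subseteq> F" "N.eval p w = \<zero>\<^bsub>N\<^esub>"
    \<comment> \<open>The list \<open>p\<close> is read as a polynomial \<open>u\<close>. The bound
      on its degree keeps the next leading coefficient from being cancelled, so \<open>u = 0\<close>
      forces all entries to be zero; that \<open>\<iota>\<close> vanishes only at zero then settles
      transcendence.\<close>
    have "\<exists>u. u \<in> carrier P \<and> \<iota> u = N.eval p w \<and> (\<forall>n\<ge>length p. ?c u n = \<zero>) \<and> (u = \<zero>\<^bsub>P\<^esub> \<longrightarrow> set p \<subseteq> {\<zero>\<^bsub>N\<^esub>})"
      using p(1)
    proof (induction p)
      case Nil
      then show ?case by (intro exI[of _ "\<zero>\<^bsub>P\<^esub>"]) auto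
    next
      case (Cons a p)
      then obtain u where u: "u \<in> carrier P" "\<iota> u = N.eval p w" "\<forall>n\<ge>length p. ?c u n = \<zero>"
          "u = \<zero>\<^bsub>P\<^esub> \<longrightarrow> set p \<subseteq> {\<zero>\<^bsub>N\<^esub>}" by auto
      obtain b where b: "b \<in> carrier K" "a = \<psi> b" using Cons.prems by (auto simp: F_def)
      let ?v = "?m b (length p) \<oplus>\<^bsub>P\<^esub> u"
      have "\<iota> ?v = N.eval (a # p) w" using u b by (simp add: m_pow)
      moreover have "\<forall>n\<ge>length (a # p). ?c ?v n = \<zero>" using u b by simp
      moreover have "set (a # p) \<subseteq> {\<zero>\<^bsub>N\<^esub>}" if "?v = \<zero>\<^bsub>P\<^esub>"
      proof -
        have "?c ?v (length p) = \<zero>" using that by simp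
        then have "b = \<zero>" using u b by simp
        then show ?thesis using that u b emb.zero by simp
      qed
      ultimately show ?case using u b by (intro exI[of _ ?v]) auto
    qed
    then show "set p \<subseteq> {\<zero>\<^bsub>N\<^esub>}" using p(2) \<iota>_zero_iff by auto
  qed
  have \<psi>f: "\<psi> f \<in> carrier N" "\<psi> f \<in> F" using f emb.closed by (auto simp: F_def)
  have lst: "liouvillian_step N F w"
    unfolding liouvillian_step_def
  proof (intro conjI wc tr bexI)
    show "\<partial>\<^bsub>N\<^esub> w = w \<otimes>\<^bsub>N\<^esub> (\<zero>\<^bsub>N\<^esub> \<oplus>\<^bsub>N\<^esub> (\<ominus>\<^bsub>N\<^esub> \<psi> f) \<otimes>\<^bsub>N\<^esub> w)"
      unfolding dw using \<psi>f wc by (simp add: N.l_minus)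
  qed (use Ff \<psi>f in auto)
  define G where "G = generate_field N (insert w F)"
  note Gf = N.differential_subfieldD[OF N.liouvillian_step_subfield[OF F lst], folded G_def]
  have wFG: "w \<in> G" "F \<subseteq> G" by (auto simp: G_def intro: generate_field.incl)
  have \<iota>G: "\<iota> p \<in> G" if p: "p \<in> carrier P" for p
  proof -
    have mc: "?m (?c p i) i \<in> carrier P" for i using p by simp
    have "\<iota> p = \<iota> (\<Oplus>\<^bsub>P\<^esub>i\<in>{..deg K p}. ?m (?c p i) i)" using UP.up_repr[OF p] by simp
    also have "\<dots> = (\<Oplus>\<^bsub>N\<^esub>i\<in>{..deg K p}. \<iota> (?m (?c p i) i))"
      using mc by (subst \<iota>.hom_finsum) (auto simp: comp_def)
    also have "\<dots> \<in> G"
    proof -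
      have t: "\<iota> (?m (?c p i) i) \<in> G" for i
        using m_pow[of "?c p i" i] UP.coeff_closed[OF p, of i] wFG Gf(9,11) by (auto simp: F_def)
      have "(\<Oplus>\<^bsub>N\<^esub>i\<in>{..k}. \<iota> (?m (?c p i) i)) \<in> G" for k
        using t Gf(3) mc Gf(8) by (induction k) auto
      then show ?thesis .
    qed
    finally show ?thesis .
  qed
  \<comment> \<open>One step exhausts the fraction field, as every element is a quotient of
    polynomials in \<open>w\<close>.\<close>
  have G: "G = carrier N"
  proof
    show "G \<subseteq> carrier N" by (rule Gf(3))
    show "carrier N \<subseteq> G"
    proof
      fix x assume "x \<in> carrier N"
      then obtain a b where ab: "a \<in> carrier P" "b \<in> carrier P" "b \<noteq> \<zero>\<^bsub>P\<^esub>" "x = \<kappa> a b"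
        unfolding N_def by (auto elim: fr.fracE)
      have x: "x \<in> carrier N" by fact
      have "x \<otimes>\<^bsub>N\<^esub> \<iota> b = \<kappa> (a \<otimes>\<^bsub>P\<^esub> b) (b \<otimes>\<^bsub>P\<^esub> \<one>\<^bsub>P\<^esub>)"
        unfolding ab \<iota>_def N_def using ab by (intro fr.frac_mult) auto
      also have "\<dots> = \<iota> a" unfolding \<iota>_def using ab by (intro fr.\<kappa>_eqI) auto
      finally have "x = \<iota> a \<otimes>\<^bsub>N\<^esub> inv\<^bsub>N\<^esub> (\<iota> b)"
        using ab x \<iota>_zero_iff[of b] by (intro N.cross_mult_divide) auto
      moreover have "inv\<^bsub>N\<^esub> (\<iota> b) \<in> G" using \<iota>G[OF ab(2)] \<iota>_zero_iff[of b] ab Gf(10) by auto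
      ultimately show "x \<in> G" using \<iota>G[OF ab(1)] Gf(9) by auto
    qed
  qed
  obtain V where V: "differential_place N F V w"
    using N.place_of_special[OF F N.liouvillian_step_special[OF F lst]] by auto
  have const_F: "constants N \<subseteq> F"
  proof
    fix x assume "x \<in> constants N"
    then have x: "x \<in> generate_field N (insert w F)" "\<partial>\<^bsub>N\<^esub> x = \<zero>\<^bsub>N\<^esub>"
      using G by (auto simp: constants_def G_def)
    show "x \<in> F"
    proof (rule differential_place.constants_of_logarithmic[OF V \<psi>f(2) _ dw x])
      fix a assume "a \<in> F"
      then obtain b where b: "b \<in> carrier K" "a = \<psi> b" by (auto simp: F_def)
      show "\<partial>\<^bsub>N\<^esub> a \<noteq> \<psi> f"
      proof
        assume "\<partial>\<^bsub>N\<^esub> a = \<psi> f"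
        then have e: "\<psi> (\<partial> b) = \<psi> f" using emb.der b by simp
        have bc: "\<partial> b \<in> carrier K" using b der_closed by simp
        have "\<psi> (\<partial> b \<ominus> f) = \<psi> (\<partial> b) \<oplus>\<^bsub>N\<^esub> \<ominus>\<^bsub>N\<^esub> \<psi> f"
          unfolding minus_eq using emb.add[of "\<partial> b" "\<ominus> f"] emb.hom_a_inv[OF f(1)] bc f(1) by simp
        then have "\<partial> b \<ominus> f = \<zero>" using e \<psi>f N.r_neg emb.eq_zero_iff[of "\<partial> b \<ominus> f"] bc f(1) by simp
        then have "\<partial> b = f" using bc f by simp
        then show False using f(2)[OF b(1)] by simp
      qed
    qed
  qed
  have "differential_extension K N \<psi>"
  proof (intro differential_extension.intro differential_extension_axioms.intro)
    show "differential_field K" ..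
    show "differential_field N" ..
    show "\<psi> \<in> ring_hom K N"
      using emb.closed emb.mult emb.add emb.hom_one by (intro ring_hom_memI) auto
    show "\<psi> (\<partial> a) = \<partial>\<^bsub>N\<^esub> (\<psi> a)" if "a \<in> carrier K" for a using emb.der[OF that] .
    show "constants N = \<psi> ` constants K"
    proof
      show "\<psi> ` constants K \<subseteq> constants N"
        using emb.closed emb.der emb.zero by (auto simp: constants_def) (metis emb.der emb.zero)
      show "constants N \<subseteq> \<psi> ` constants K"
      proof
        fix x assume x: "x \<in> constants N"
        then obtain a where a: "a \<in> carrier K" "x = \<psi> a" using const_F by (auto simp: F_def)
        have "\<psi> (\<partial> a) = \<zero>\<^bsub>N\<^esub>" using x a emb.der by (simp add: constants_def)
        then have "\<partial> a = \<zero>" using emb.eq_zero_iff[of "\<partial> a"] a der_closed by simp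
        then show "x \<in> \<psi> ` constants K" using a by (auto simp: constants_def)
      qed
    qed
  qed
  moreover have "special_tower N (\<psi> ` carrier K) (carrier N)"
    using special_tower.step[OF special_tower.base lst] G unfolding G_def F_def by simp
  ultimately show ?thesis unfolding liouvillian_extension_def using wc w0 dw by blast
qed

end

section \<open>Solving the equation in a tower\<close>

text \<open>An integral already present is used as it is, so that adjunction only happens when
  \<open>f\<close> has no antiderivative. In that case \<open>y = 1 / w\<close>, whose derivative
  follows by differentiating \<open>w y = 1\<close>.\<close>

lemma ex_integral:
  fixes M :: "'b differential_ring"
  assumes M: "differential_field M" and f: "f \<in> carrier M"
  shows "\<exists>(N :: 'b differential_ring) \<psi> y. liouvillian_extension M N \<psi> \<and> y \<in> carrier N \<and> \<partial>\<^bsub>N\<^esub> y = \<psi> f"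
proof (cases "\<exists>a\<in>carrier M. \<partial>\<^bsub>M\<^esub> a = f")
  case True
  then obtain a where "a \<in> carrier M" "\<partial>\<^bsub>M\<^esub> a = f" by auto
  then show ?thesis using liouvillian_extension_refl[OF M] by (intro exI[of _ M] exI[of _ id] exI[of _ a]) auto
next
  case False
  then obtain N :: "'b differential_ring" and \<psi> w where N: "liouvillian_extension M N \<psi>"
    and w: "w \<in> carrier N" "w \<noteq> \<zero>\<^bsub>N\<^esub>" "\<partial>\<^bsub>N\<^esub> w = w \<otimes>\<^bsub>N\<^esub> \<ominus>\<^bsub>N\<^esub> (\<psi> f \<otimes>\<^bsub>N\<^esub> w)"
    using differential_field.ex_integral_extension[OF M f] by blast
  interpret differential_extension M N \<psi> using N by (simp add: liouvillian_extension_def)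
  define y where "y = inv\<^bsub>N\<^esub> w"
  note iw = E.inverse_facts[OF w(1,2), folded y_def]
  have c: "\<psi> f \<in> carrier N" "\<partial>\<^bsub>N\<^esub> y \<in> carrier N" using f iw E.der_closed by auto
  have "\<zero>\<^bsub>N\<^esub> = \<partial>\<^bsub>N\<^esub> w \<otimes>\<^bsub>N\<^esub> y \<oplus>\<^bsub>N\<^esub> w \<otimes>\<^bsub>N\<^esub> \<partial>\<^bsub>N\<^esub> y"
    using E.der_mult[OF w(1) iw(1)] iw(2) by (simp add: E.der_one)
  also have "\<partial>\<^bsub>N\<^esub> w \<otimes>\<^bsub>N\<^esub> y = \<ominus>\<^bsub>N\<^esub> (w \<otimes>\<^bsub>N\<^esub> \<psi> f)"
  proof -
    have "\<partial>\<^bsub>N\<^esub> w \<otimes>\<^bsub>N\<^esub> y = \<ominus>\<^bsub>N\<^esub> (w \<otimes>\<^bsub>N\<^esub> \<psi> f) \<otimes>\<^bsub>N\<^esub> (w \<otimes>\<^bsub>N\<^esub> y)"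
      unfolding w(3) using w(1) iw(1) c(1) by algebra
    then show ?thesis using iw(2) w(1) c by simp
  qed
  finally have "w \<otimes>\<^bsub>N\<^esub> \<partial>\<^bsub>N\<^esub> y = \<zero>\<^bsub>N\<^esub> \<ominus>\<^bsub>N\<^esub> \<ominus>\<^bsub>N\<^esub> (w \<otimes>\<^bsub>N\<^esub> \<psi> f)"
    using w c by (intro E.eq_add_imp) auto
  then have "w \<otimes>\<^bsub>N\<^esub> \<partial>\<^bsub>N\<^esub> y = w \<otimes>\<^bsub>N\<^esub> \<psi> f" using w c by (simp add: E.minus_eq)
  then have "\<partial>\<^bsub>N\<^esub> y = \<psi> f" using E.m_lcancel[OF w(2,1)] c by auto
  then show ?thesis using N iw(1) by blast
qed

section \<open>Transport of solutions and of their independence along extensions\<close>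

lemma (in differential_extension) hom_diffop_apply:
  assumes A: "A \<in> UNIV \<rightarrow> carrier K" "\<forall>i>m. A i = \<zero>\<^bsub>K\<^esub>" and y: "y \<in> carrier K"
  shows "diffop_apply E (\<phi> \<circ> A) (\<phi> y) = \<phi> (diffop_apply K A y)"
proof -
  have Ac: "A i \<in> carrier K" for i using A(1) by auto
  have yc: "(der K ^^ i) y \<in> carrier K" for i using K.der_funpow_closed[OF y] .
  have d: "(der E ^^ i) (\<phi> y) = \<phi> ((der K ^^ i) y)" for i
    by (induction i) (auto simp: hom_der yc)
  have "diffop_apply E (\<phi> \<circ> A) (\<phi> y) = (\<Oplus>\<^bsub>E\<^esub>i\<in>{..m}. (\<phi> \<circ> A) i \<otimes>\<^bsub>E\<^esub> (der E ^^ i) (\<phi> y))"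
    using A(2) y by (intro E.diffop_apply_eq hom_comp_closed[OF A(1)]) auto
  also have "\<dots> = (\<Oplus>\<^bsub>E\<^esub>i\<in>{..m}. \<phi> (A i \<otimes>\<^bsub>K\<^esub> (der K ^^ i) y))"
    using Ac yc by (intro E.finsum_cong') (auto simp: d)
  also have "\<dots> = \<phi> (diffop_apply K A y)"
    unfolding K.diffop_apply_eq[OF A y] using Ac yc by (subst hom.hom_finsum) (auto simp: comp_def)
  finally show ?thesis .
qed

lemma (in differential_extension) hom_Span:
  assumes "set us \<subseteq> carrier K" "C \<subseteq> carrier K"
  shows "E.Span (\<phi> ` C) (map \<phi> us) = \<phi> ` K.Span C us \<and> K.Span C us \<subseteq> carrier K"
  using assms
proof (induction us)
  case Nil
  then show ?case by simp
next
  case (Cons u us)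
  then have IH: "E.Span (\<phi> ` C) (map \<phi> us) = \<phi> ` K.Span C us" "K.Span C us \<subseteq> carrier K" by auto
  have u: "u \<in> carrier K" using Cons.prems by simp
  have c: "c \<in> carrier K" if "c \<in> C" for c using that Cons.prems(2) by auto
  have "v \<in> E.Span (\<phi> ` C) (map \<phi> (u # us)) \<longleftrightarrow> v \<in> \<phi> ` K.Span C (u # us)" for v
  proof -
    have "v \<in> E.Span (\<phi> ` C) (map \<phi> (u # us)) \<longleftrightarrow>
        (\<exists>k\<in>C. \<exists>x\<in>K.Span C us. v = \<phi> k \<otimes>\<^bsub>E\<^esub> \<phi> u \<oplus>\<^bsub>E\<^esub> \<phi> x)"
      using IH(1) by (auto simp: E.line_extension_mem_iff)
    also have "\<dots> \<longleftrightarrow> (\<exists>k\<in>C. \<exists>x\<in>K.Span C us. v = \<phi> (k \<otimes>\<^bsub>K\<^esub> u \<oplus>\<^bsub>K\<^esub> x))"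
      using c u IH(2) by (intro bex_cong refl) (auto simp: subset_iff)
    also have "\<dots> \<longleftrightarrow> v \<in> \<phi> ` K.Span C (u # us)"
      by (force simp: K.line_extension_mem_iff image_iff)
    finally show ?thesis .
  qed
  moreover have "K.Span C (u # us) \<subseteq> carrier K"
    using IH(2) u c by (auto simp: K.line_extension_mem_iff subset_iff)
  ultimately show ?case by blast
qed

text \<open>The constants of \<open>E\<close> are the images of those of \<open>K\<close>, so the
  span over them is the image of the old span, and \<open>\<phi>\<close> is injective.\<close>

lemma (in differential_extension) hom_independent:
  assumes "K.independent (constants K) us"
  shows "E.independent (constants E) (map \<phi> us)"
  using assms
proof (induction us rule: list.induct)
  case Nil
  then show ?case by simp
next
  case (Cons u us)
  note ind = K.independent_backwards[OF Cons.prems]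
  have us: "set us \<subseteq> carrier K" using K.independent_in_carrier[OF ind(2)] .
  note S = hom_Span[OF us K.constants_facts(1)]
  have "\<phi> u \<notin> E.Span (constants E) (map \<phi> us)"
  proof
    assume "\<phi> u \<in> E.Span (constants E) (map \<phi> us)"
    then have "\<phi> u \<in> \<phi> ` K.Span (constants K) us" unfolding no_new_constants using S by simp
    then obtain x where x: "x \<in> K.Span (constants K) us" "\<phi> u = \<phi> x" by blast
    then have "u = x" using S ind(3) by (intro inj_onD[OF hom_inj]) auto
    then show False using x ind(1) by simp
  qed
  then show ?case using Cons.IH[OF ind(2)] ind(3) by (auto intro: E.li_Cons)
qed

lemma (in differential_field) Span_apply_zero:
  assumes A: "A \<in> UNIV \<rightarrow> carrier K" "\<forall>i>m. A i = \<zero>" and us: "set us \<subseteq> carrier K"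
    "\<And>u. u \<in> set us \<Longrightarrow> diffop_apply K A u = \<zero>" and x: "x \<in> Span (constants K) us"
  shows "diffop_apply K A x = \<zero>"
  using us x
proof (induction us arbitrary: x)
  case Nil
  then have "x = \<zero>" by simp
  moreover have "(der K ^^ i) \<zero> = \<zero>" for i by (induction i) (auto simp: der_zero)
  moreover have "A i \<in> carrier K" for i using A(1) by auto
  ultimately show ?case by (subst diffop_apply_eq[OF A]) (auto intro!: add.finprod_one_eqI)
next
  case (Cons u us)
  then obtain c v where c: "c \<in> constants K" "v \<in> Span (constants K) us" "x = c \<otimes> u \<oplus> v"
    by (auto simp: line_extension_mem_iff)
  have "v \<in> carrier K" using c(2) Span_subgroup_props(1)[OF constants_subfield, of us] Cons.prems by auto
  then have "diffop_apply K A x = c \<otimes> diffop_apply K A u \<oplus> diffop_apply K A v"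
    unfolding c(3) using Cons.prems by (intro diffop_apply_linear[OF A c(1)]) auto
  then show ?case using Cons.IH[of v] Cons.prems c constants_facts(2)[OF c(1)] by simp
qed

text \<open>Variation of constants, peeling factors off from the left: a solution \<open>v\<close>
  of \<open>v' - p (Suc m) v = f\<close> becomes the right-hand side for the remaining
  \<open>m\<close> factors. Every integration may enlarge the field, so \<open>M\<close> and all
  data vary in the induction.\<close>

lemma ex_solution:
  fixes M :: "'b differential_ring"
  assumes "differential_field M" "f \<in> carrier M" "\<And>i. i \<in> {1..m} \<Longrightarrow> p i \<in> carrier M"
    "\<And>i. i \<in> {1..m} \<Longrightarrow> z i \<in> carrier M \<and> z i \<noteq> \<zero>\<^bsub>M\<^esub> \<and> \<partial>\<^bsub>M\<^esub> (z i) = p i \<otimes>\<^bsub>M\<^esub> z i"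
  shows "\<exists>(N :: 'b differential_ring) \<psi> u. liouvillian_extension M N \<psi> \<and> u \<in> carrier N \<and>
    diffop_apply N (D_minus_prod N (\<psi> \<circ> p) m) u = \<psi> f"
  using assms
proof (induction m arbitrary: M f p z)
  case 0
  then interpret M: differential_field M by simp
  have "diffop_apply M (D_minus_prod M (id \<circ> p) 0) f = id f" using M.diffop_apply_id 0(2) by simp
  then show ?case using liouvillian_extension_refl[OF 0(1)] 0(2) by blast
next
  case (Suc m)
  interpret M: differential_field M using Suc.prems by simp
  let ?p = "p (Suc m)" and ?z = "z (Suc m)"
  have z: "?z \<in> carrier M" "?z \<noteq> \<zero>\<^bsub>M\<^esub>" "\<partial>\<^bsub>M\<^esub> ?z = ?p \<otimes>\<^bsub>M\<^esub> ?z" "?p \<in> carrier M" using Suc.prems(3,4) by auto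
  note iz = M.inverse_facts[OF z(1,2)]
  define g where "g = f \<otimes>\<^bsub>M\<^esub> inv\<^bsub>M\<^esub> ?z"
  have g: "g \<in> carrier M" "?z \<otimes>\<^bsub>M\<^esub> g = f" using Suc.prems(2) iz z by (auto simp: g_def M.m_lcomm)
  obtain N1 :: "'b differential_ring" and \<psi>1 y where N1: "liouvillian_extension M N1 \<psi>1" "y \<in> carrier N1"
      "\<partial>\<^bsub>N1\<^esub> y = \<psi>1 g" using ex_integral[OF Suc.prems(1) g(1)] by blast
  interpret e1: differential_extension M N1 \<psi>1 using N1 by (simp add: liouvillian_extension_def)
  \<comment> \<open>With \<open>y' = f / z\<close>, where \<open>z\<close> solves the homogeneous
    equation, the product rule for \<open>z y\<close> yields \<open>v' = p v + f\<close>.\<close>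
  define v where "v = \<psi>1 ?z \<otimes>\<^bsub>N1\<^esub> y"
  have v: "v \<in> carrier N1" using N1 z by (simp add: v_def)
  have c1: "\<psi>1 ?z \<in> carrier N1" "\<psi>1 ?p \<in> carrier N1" "\<psi>1 g \<in> carrier N1" using z g by auto
  have "\<partial>\<^bsub>N1\<^esub> v = (\<psi>1 ?p \<otimes>\<^bsub>N1\<^esub> \<psi>1 ?z) \<otimes>\<^bsub>N1\<^esub> y \<oplus>\<^bsub>N1\<^esub> \<psi>1 ?z \<otimes>\<^bsub>N1\<^esub> \<psi>1 g"
    unfolding v_def using N1(2,3) c1 z e1.hom_der[OF z(1)] by (simp add: e1.E.der_mult)
  also have "\<psi>1 ?z \<otimes>\<^bsub>N1\<^esub> \<psi>1 g = \<psi>1 f" using e1.hom.hom_mult[OF z(1) g(1)] g(2) by simp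
  also have "(\<psi>1 ?p \<otimes>\<^bsub>N1\<^esub> \<psi>1 ?z) \<otimes>\<^bsub>N1\<^esub> y = \<psi>1 ?p \<otimes>\<^bsub>N1\<^esub> v" unfolding v_def using c1 N1(2) by (simp add: e1.E.m_assoc)
  finally have dv: "\<partial>\<^bsub>N1\<^esub> v = \<psi>1 ?p \<otimes>\<^bsub>N1\<^esub> v \<oplus>\<^bsub>N1\<^esub> \<psi>1 f" .
  have p1: "(\<psi>1 \<circ> p) i \<in> carrier N1" if "i \<in> {1..m}" for i using Suc.prems(3)[of i] that by simp
  have z1: "(\<psi>1 \<circ> z) i \<in> carrier N1 \<and> (\<psi>1 \<circ> z) i \<noteq> \<zero>\<^bsub>N1\<^esub> \<and>
      \<partial>\<^bsub>N1\<^esub> ((\<psi>1 \<circ> z) i) = (\<psi>1 \<circ> p) i \<otimes>\<^bsub>N1\<^esub> (\<psi>1 \<circ> z) i" if "i \<in> {1..m}" for i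
  proof -
    have "z i \<in> carrier M" "z i \<noteq> \<zero>\<^bsub>M\<^esub>" "\<partial>\<^bsub>M\<^esub> (z i) = p i \<otimes>\<^bsub>M\<^esub> z i" "p i \<in> carrier M"
      using Suc.prems(3,4)[of i] that by auto
    then show ?thesis using e1.hom_eq_zero_iff[of "z i"] e1.hom_der[of "z i"] by simp
  qed
  obtain N2 :: "'b differential_ring" and \<psi>2 u where N2: "liouvillian_extension N1 N2 \<psi>2" "u \<in> carrier N2"
      "diffop_apply N2 (D_minus_prod N2 (\<psi>2 \<circ> (\<psi>1 \<circ> p)) m) u = \<psi>2 v"
    using Suc.IH[where p="\<psi>1 \<circ> p" and z="\<psi>1 \<circ> z", OF e1.E.differential_field_axioms v p1 z1] by blast
  interpret e2: differential_extension N1 N2 \<psi>2 using N2 by (simp add: liouvillian_extension_def)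
  define p2 where "p2 = (\<psi>2 \<circ> \<psi>1) \<circ> p"
  have p2: "p2 i \<in> carrier N2" if "i \<in> {1..Suc m}" for i using Suc.prems(3)[of i] that by (simp add: p2_def)
  have e: "diffop_apply N2 (D_minus_prod N2 p2 m) u = \<psi>2 v" using N2(3) by (simp add: p2_def comp_assoc)
  have c2: "\<psi>2 v \<in> carrier N2" "\<psi>2 (\<psi>1 f) \<in> carrier N2" "\<psi>2 (\<psi>1 ?p) \<in> carrier N2"
    using v Suc.prems(2) z by auto
  have d2: "\<partial>\<^bsub>N2\<^esub> (\<psi>2 v) = \<psi>2 (\<psi>1 ?p) \<otimes>\<^bsub>N2\<^esub> \<psi>2 v \<oplus>\<^bsub>N2\<^esub> \<psi>2 (\<psi>1 f)"
    using e2.hom_der[OF v] dv v c1 Suc.prems(2) by simp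
  have "diffop_apply N2 (D_minus_prod N2 p2 (Suc m)) u = \<partial>\<^bsub>N2\<^esub> (\<psi>2 v) \<ominus>\<^bsub>N2\<^esub> p2 (Suc m) \<otimes>\<^bsub>N2\<^esub> \<psi>2 v"
    using e2.E.D_minus_prod_apply_Suc[where p=p2, OF p2 N2(2)] e by simp
  also have "\<dots> = \<psi>2 (\<psi>1 f)" unfolding d2 p2_def comp_apply using c2 by algebra
  finally have sol: "diffop_apply N2 (D_minus_prod N2 p2 (Suc m)) u = (\<psi>2 \<circ> \<psi>1) f" by simp
  show ?case
    by (rule exI[of _ N2], rule exI[of _ "\<psi>2 \<circ> \<psi>1"], rule exI[of _ u], intro conjI)
      (rule liouvillian_extension_trans[OF N1(1) N2(1)], rule N2(2), rule sol[unfolded p2_def])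
qed

text \<open>The new solution \<open>u\<close> is chosen so that the first \<open>m\<close> factors
  send it to \<open>z (Suc m)\<close>, which the next factor annihilates. It is independent of the
  old solutions, since these factors vanish on their span but not on \<open>u\<close>.\<close>

lemma ex_independent_solutions:
  fixes M :: "'b differential_ring"
  assumes M: "differential_field M" and p: "\<And>i. i \<in> {1..n} \<Longrightarrow> p i \<in> carrier M"
    and z: "\<And>i. i \<in> {1..n} \<Longrightarrow> z i \<in> carrier M \<and> z i \<noteq> \<zero>\<^bsub>M\<^esub> \<and> \<partial>\<^bsub>M\<^esub> (z i) = p i \<otimes>\<^bsub>M\<^esub> z i"
    and "m \<le> n"
  shows "\<exists>(N :: 'b differential_ring) \<psi> ys. liouvillian_extension M N \<psi> \<and> length ys = m \<and>
    ring.independent N (constants N) ys \<and>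
    (\<forall>y\<in>set ys. y \<in> carrier N \<and> diffop_apply N (D_minus_prod N (\<psi> \<circ> p) m) y = \<zero>\<^bsub>N\<^esub>)"
  using \<open>m \<le> n\<close>
proof (induction m)
  case 0
  interpret M: differential_field M by fact
  show ?case
    by (rule exI[of _ M], rule exI[of _ id], rule exI[of _ "[]"],
        intro conjI liouvillian_extension_refl[OF M] M.li_Nil) simp_all
next
  case (Suc m)
  obtain N :: "'b differential_ring" and \<psi> ys where N: "liouvillian_extension M N \<psi>" "length ys = m"
      "ring.independent N (constants N) ys"
      "\<forall>y\<in>set ys. y \<in> carrier N \<and> diffop_apply N (D_minus_prod N (\<psi> \<circ> p) m) y = \<zero>\<^bsub>N\<^esub>"
    using Suc.IH[OF Suc_leD[OF Suc.prems]] by blast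
  note N4 = bspec[OF N(4)]
  interpret e1: differential_extension M N \<psi> using N by (simp add: liouvillian_extension_def)
  let ?z = "z (Suc m)" and ?p = "p (Suc m)"
  have zS: "?z \<in> carrier M" "?z \<noteq> \<zero>\<^bsub>M\<^esub>" "\<partial>\<^bsub>M\<^esub> ?z = ?p \<otimes>\<^bsub>M\<^esub> ?z" "?p \<in> carrier M"
    using Suc.prems p z by auto
  have p1: "(\<psi> \<circ> p) i \<in> carrier N" if "i \<in> {1..m}" for i using p[of i] that Suc.prems by simp
  have z1: "(\<psi> \<circ> z) i \<in> carrier N \<and> (\<psi> \<circ> z) i \<noteq> \<zero>\<^bsub>N\<^esub> \<and>
      \<partial>\<^bsub>N\<^esub> ((\<psi> \<circ> z) i) = (\<psi> \<circ> p) i \<otimes>\<^bsub>N\<^esub> (\<psi> \<circ> z) i" if "i \<in> {1..m}" for i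
  proof -
    have "z i \<in> carrier M" "z i \<noteq> \<zero>\<^bsub>M\<^esub>" "\<partial>\<^bsub>M\<^esub> (z i) = p i \<otimes>\<^bsub>M\<^esub> z i" "p i \<in> carrier M"
      using p[of i] z[of i] that Suc.prems by auto
    then show ?thesis using e1.hom_eq_zero_iff[of "z i"] e1.hom_der[of "z i"] by simp
  qed
  have \<psi>z: "\<psi> ?z \<in> carrier N" using zS by simp
  obtain N2 :: "'b differential_ring" and \<chi> u where N2: "liouvillian_extension N N2 \<chi>" "u \<in> carrier N2"
      "diffop_apply N2 (D_minus_prod N2 (\<chi> \<circ> (\<psi> \<circ> p)) m) u = \<chi> (\<psi> ?z)"
    using ex_solution[where p="\<psi> \<circ> p" and z="\<psi> \<circ> z", OF e1.E.differential_field_axioms \<psi>z p1 z1] by blast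
  interpret e2: differential_extension N N2 \<chi> using N2 by (simp add: liouvillian_extension_def)
  define p2 where "p2 = (\<chi> \<circ> \<psi>) \<circ> p"
  have p2: "p2 i \<in> carrier N2" if "i \<in> {1..Suc m}" for i using p[of i] that Suc.prems by (simp add: p2_def)
  let ?B = "D_minus_prod N2 p2 m"
  have p2': "p2 i \<in> carrier N2" if "i \<in> {1..m}" for i using p2[of i] that by simp
  have B: "?B \<in> UNIV \<rightarrow> carrier N2" "\<forall>i>m. ?B i = \<zero>\<^bsub>N2\<^esub>"
    using e2.E.D_minus_prod_facts(1,2)[where p=p2, OF p2'] by blast+
  have A: "D_minus_prod N (\<psi> \<circ> p) m \<in> UNIV \<rightarrow> carrier N" "\<forall>i>m. D_minus_prod N (\<psi> \<circ> p) m i = \<zero>\<^bsub>N\<^esub>"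
    using e1.E.D_minus_prod_facts(1,2)[where p="\<psi> \<circ> p", OF p1] by blast+
  have AB: "\<chi> \<circ> D_minus_prod N (\<psi> \<circ> p) m = ?B"
    using e2.hom_D_minus_prod[where p="\<psi> \<circ> p", OF p1] by (simp add: p2_def comp_assoc)
  have Bu: "diffop_apply N2 ?B u = \<chi> (\<psi> ?z)" using N2(3) by (simp add: p2_def comp_assoc)
  have cz: "\<chi> (\<psi> ?z) \<in> carrier N2" "\<chi> (\<psi> ?z) \<noteq> \<zero>\<^bsub>N2\<^esub>"
    using zS e1.hom_eq_zero_iff e2.hom_eq_zero_iff by auto
  have dz: "\<partial>\<^bsub>N2\<^esub> (\<chi> (\<psi> ?z)) = p2 (Suc m) \<otimes>\<^bsub>N2\<^esub> \<chi> (\<psi> ?z)"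
  proof -
    have "\<partial>\<^bsub>N\<^esub> (\<psi> ?z) = \<psi> ?p \<otimes>\<^bsub>N\<^esub> \<psi> ?z" using zS e1.hom_der[OF zS(1)] by simp
    moreover have "\<psi> ?p \<in> carrier N" using zS by simp
    ultimately show ?thesis using e2.hom_der[OF \<psi>z] \<psi>z by (simp add: p2_def)
  qed
  have Sy: "diffop_apply N2 (D_minus_prod N2 p2 (Suc m)) y =
      \<partial>\<^bsub>N2\<^esub> (diffop_apply N2 ?B y) \<ominus>\<^bsub>N2\<^esub> p2 (Suc m) \<otimes>\<^bsub>N2\<^esub> diffop_apply N2 ?B y" if "y \<in> carrier N2" for y
    using e2.E.D_minus_prod_apply_Suc[where p=p2, OF p2 that] .
  have ysc: "set ys \<subseteq> carrier N" using N4 by auto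
  have By: "diffop_apply N2 ?B (\<chi> y) = \<zero>\<^bsub>N2\<^esub>" if "y \<in> set ys" for y
    using e2.hom_diffop_apply[OF A, of y] N4[OF that] unfolding AB by simp
  have ind: "e2.E.independent (constants N2) (u # map \<chi> ys)"
  proof (rule e2.E.li_Cons)
    show "u \<in> carrier N2" by fact
    show "e2.E.independent (constants N2) (map \<chi> ys)" by (rule e2.hom_independent[OF N(3)])
    show "u \<notin> e2.E.Span (constants N2) (map \<chi> ys)"
    proof
      assume u: "u \<in> e2.E.Span (constants N2) (map \<chi> ys)"
      have "set (map \<chi> ys) \<subseteq> carrier N2" using ysc by auto
      moreover have "diffop_apply N2 ?B y = \<zero>\<^bsub>N2\<^esub>" if "y \<in> set (map \<chi> ys)" for y
        using that By by auto
      ultimately have "diffop_apply N2 ?B u = \<zero>\<^bsub>N2\<^esub>"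
        using e2.E.Span_apply_zero[OF B _ _ u] by blast
      then show False using Bu cz by simp
    qed
  qed
  have pS: "p2 (Suc m) \<in> carrier N2" using p2 by simp
  have "y \<in> carrier N2 \<and> diffop_apply N2 (D_minus_prod N2 p2 (Suc m)) y = \<zero>\<^bsub>N2\<^esub>"
    if "y \<in> set (u # map \<chi> ys)" for y
  proof (cases "y = u")
    case True
    have "diffop_apply N2 (D_minus_prod N2 p2 (Suc m)) u = \<zero>\<^bsub>N2\<^esub>"
      unfolding Sy[OF N2(2)] Bu dz using cz pS by (simp add: e2.E.r_right_minus_eq)
    then show ?thesis using True N2(2) by simp
  next
    case False
    then obtain x where x: "x \<in> set ys" "y = \<chi> x" using \<open>y \<in> _\<close> by auto
    have yc: "y \<in> carrier N2" using x ysc by auto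
    have "diffop_apply N2 (D_minus_prod N2 p2 (Suc m)) y = \<zero>\<^bsub>N2\<^esub>"
      unfolding Sy[OF yc] using By[OF x(1)] x(2) pS by (simp add: e2.E.der_zero e2.E.minus_eq)
    then show ?thesis using yc by simp
  qed
  then have sol: "\<forall>y\<in>set (u # map \<chi> ys). y \<in> carrier N2 \<and>
      diffop_apply N2 (D_minus_prod N2 p2 (Suc m)) y = \<zero>\<^bsub>N2\<^esub>" by blast
  have len: "length (u # map \<chi> ys) = Suc m" using N(2) by simp
  show ?case
    by (rule exI[of _ N2], rule exI[of _ "\<chi> \<circ> \<psi>"], rule exI[of _ "u # map \<chi> ys"], intro conjI)
      (rule liouvillian_extension_trans[OF N(1) N2(1)], rule len, rule ind, rule sol[unfolded p2_def])
qed

section \<open>Free generators modulo a subgroup\<close>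

context comm_group
begin

definition monomial :: "('i \<Rightarrow> 'a) \<Rightarrow> ('i \<Rightarrow> int) \<Rightarrow> 'i set \<Rightarrow> 'a"
  where "monomial t e I = finprod G (\<lambda>i. t i [^] e i) I"

lemma monomial_closed: "t ` I \<subseteq> carrier G \<Longrightarrow> monomial t e I \<in> carrier G"
  unfolding monomial_def by (intro finprod_closed) auto

lemma monomial_insert:
  assumes "finite I" "i \<notin> I" "t ` insert i I \<subseteq> carrier G"
  shows "monomial t e (insert i I) = t i [^] e i \<otimes> monomial t e I"
  unfolding monomial_def using assms by (intro finprod_insert) auto

lemma monomial_cong:
  assumes "t ` I \<subseteq> carrier G" "\<And>i. i \<in> I \<Longrightarrow> t i = t' i" "\<And>i. i \<in> I \<Longrightarrow> e i = e' i"
  shows "monomial t e I = monomial t' e' I"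
proof -
  have "t' i \<in> carrier G" if "i \<in> I" for i using assms(1,2) that by (metis image_subset_iff)
  then show ?thesis unfolding monomial_def using assms by (intro finprod_cong') auto
qed

lemma monomial_mult:
  assumes "t ` I \<subseteq> carrier G"
  shows "monomial t (\<lambda>i. e i + e' i) I = monomial t e I \<otimes> monomial t e' I"
proof -
  have "monomial t (\<lambda>i. e i + e' i) I = finprod G (\<lambda>i. t i [^] e i \<otimes> t i [^] e' i) I"
    unfolding monomial_def using assms by (intro finprod_cong') (auto simp: int_pow_mult image_subset_iff)
  also have "\<dots> = monomial t e I \<otimes> monomial t e' I"
    unfolding monomial_def using assms by (intro finprod_multf) auto
  finally show ?thesis .
qed

lemma monomial_zero: "monomial t (\<lambda>_. 0) I = \<one>"
  by (simp add: monomial_def finprod_one)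

lemma monomial_single:
  assumes "finite I" "i \<in> I" "t ` I \<subseteq> carrier G"
  shows "monomial t (\<lambda>j. if j = i then m else 0) I = t i [^] (m::int)"
proof -
  have "monomial t (\<lambda>j. if j = i then m else 0) I = finprod G (\<lambda>j. if i = j then t j [^] m else \<one>) I"
    unfolding monomial_def using assms by (intro finprod_cong') auto
  also have "\<dots> = t i [^] m" using assms by (intro finprod_singleton) auto
  finally show ?thesis .
qed

lemma generate_monomial:
  assumes A: "subgroup A G" and I: "finite I" "t ` I \<subseteq> carrier G" and x: "x \<in> generate G (A \<union> t ` I)"
  shows "\<exists>a\<in>A. \<exists>e. x = a \<otimes> monomial t e I"
proof -
  interpret A: subgroup A G by fact
  note mc = monomial_closed[OF I(2)]
  have base: "\<exists>a\<in>A. \<exists>e. h = a \<otimes> monomial t e I" if "h \<in> A \<union> t ` I" for h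
  proof (cases "h \<in> A")
    case True
    then show ?thesis using monomial_zero[of t I] A.mem_carrier[OF True]
      by (intro bexI[of _ h] exI[of _ "\<lambda>_. 0"]) auto
  next
    case False
    then obtain i where i: "i \<in> I" "h = t i" using \<open>h \<in> _\<close> by auto
    then have "h = \<one> \<otimes> monomial t (\<lambda>j. if j = i then 1 else 0) I"
      using monomial_single[OF I(1) i(1) I(2), of 1] I(2) by auto
    then show ?thesis using A.one_closed by blast
  qed
  show ?thesis using x
  proof (induction rule: generate.induct)
    case one
    then show ?case using monomial_zero[of t I] A.one_closed
      by (intro bexI[of _ \<one>] exI[of _ "\<lambda>_. 0"]) auto
  next
    case (incl h)
    then show ?case by (rule base)
  next
    case (inv h)
    then obtain a e where a: "a \<in> A" "h = a \<otimes> monomial t e I" using base by blast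
    have "monomial t (\<lambda>i. - e i) I \<otimes> monomial t e I = \<one>"
      using monomial_mult[OF I(2), of "\<lambda>i. - e i" e] monomial_zero[of t I] by simp
    then have "inv (monomial t e I) = monomial t (\<lambda>i. - e i) I" using mc by (simp add: inv_equality)
    then have "inv h = inv a \<otimes> monomial t (\<lambda>i. - e i) I"
      using a mc A.mem_carrier by (simp add: inv_mult)
    then show ?case using A.m_inv_closed[OF a(1)] by blast
  next
    case (eng h1 h2)
    then obtain a e b f where ab: "a \<in> A" "h1 = a \<otimes> monomial t e I" "b \<in> A" "h2 = b \<otimes> monomial t f I" by blast
    have "h1 \<otimes> h2 = (a \<otimes> b) \<otimes> monomial t (\<lambda>i. e i + f i) I"
      unfolding ab monomial_mult[OF I(2)] using A.mem_carrier ab(1,3) mc by (simp add: m_ac)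
    then show ?case using A.m_closed[OF ab(1,3)] by blast
  qed
qed

lemma generate_mono_eq:
  assumes "B \<subseteq> carrier G" "C \<subseteq> carrier G" "B \<subseteq> generate G C" "C \<subseteq> generate G B"
  shows "generate G B = generate G C"
  using generate_subgroup_incl[OF assms(3) generate_is_subgroup[OF assms(2)]]
    generate_subgroup_incl[OF assms(4) generate_is_subgroup[OF assms(1)]] by auto

text \<open>If \<open>\<bar>e i\<bar> \<ge> \<bar>e j\<bar> > 0\<close>, replacing \<open>t j\<close> by \<open>t j (t i)\<^sup>s\<close> with a suitable sign \<open>s\<close> lowers
  \<open>\<bar>e i\<bar>\<close>. Eventually a single exponent remains, and its generator is superfluous.\<close>

lemma reduce_generators:
  assumes A: "subgroup A G"
    and I: "finite I" "t ` I \<subseteq> carrier G" and e: "i \<in> I" "e i \<noteq> 0" "monomial t e I \<in> A"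
    and tf: "\<And>x m. x \<in> generate G (A \<union> t ` I) \<Longrightarrow> 0 < (m::nat) \<Longrightarrow> x [^] m \<in> A \<Longrightarrow> x \<in> A"
  shows "\<exists>i t'. i \<in> I \<and> t' ` I \<subseteq> carrier G \<and> generate G (A \<union> t' ` (I - {i})) = generate G (A \<union> t ` I)"
  using I(2) e tf
proof (induction "\<Sum>i\<in>I. nat \<bar>e i\<bar>" arbitrary: t e i rule: less_induct)
  case less
  interpret A: subgroup A G by fact
  have Ac: "A \<subseteq> carrier G" by (rule A.subset)
  show ?case
  proof (cases "\<exists>j\<in>I. j \<noteq> i \<and> e j \<noteq> 0")
    case False
    have mi: "monomial t e I = t i [^] e i"
    proof -
      have "monomial t e I = monomial t (\<lambda>j. if j = i then e i else 0) I"
        using False less.prems by (intro monomial_cong) auto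
      then show ?thesis using monomial_single[OF I(1) less.prems(2,1)] by simp
    qed
    have ti: "t i \<in> carrier G" using less.prems by auto
    have tgen: "t i \<in> generate G (A \<union> t ` I)" using less.prems(2) by (auto intro: generate.incl)
    have "t i [^] nat \<bar>e i\<bar> \<in> A"
    proof (cases "e i \<ge> 0")
      case True
      then have "t i [^] nat \<bar>e i\<bar> = t i [^] e i" by (simp add: int_pow_int[symmetric])
      then show ?thesis using less.prems(4) mi by simp
    next
      case False
      then have "t i [^] nat \<bar>e i\<bar> = t i [^] (- e i)" by (simp add: int_pow_int[symmetric])
      also have "\<dots> = inv (t i [^] e i)" using ti by (rule int_pow_neg)
      finally show ?thesis using less.prems(4) mi A.m_inv_closed by simp
    qed
    then have tA: "t i \<in> A" using less.prems(5)[OF tgen, of "nat \<bar>e i\<bar>"] less.prems(3) by simp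
    have "generate G (A \<union> t ` (I - {i})) = generate G (A \<union> t ` I)"
    proof (rule generate_mono_eq)
      show "A \<union> t ` (I - {i}) \<subseteq> generate G (A \<union> t ` I)" by (auto intro: generate.incl)
      show "A \<union> t ` I \<subseteq> generate G (A \<union> t ` (I - {i}))" using tA by (auto intro: generate.incl)
    qed (use Ac less.prems(1) in auto)
    then show ?thesis using less.prems(1,2) by blast
  next
    case True
    then obtain j0 where j0: "j0 \<in> I" "j0 \<noteq> i" "e j0 \<noteq> 0" by auto
    have "\<exists>k l. k \<in> I \<and> l \<in> I \<and> k \<noteq> l \<and> e l \<noteq> 0 \<and> \<bar>e l\<bar> \<le> \<bar>e k\<bar>"
    proof (cases "\<bar>e j0\<bar> \<le> \<bar>e i\<bar>")
      case True
      then show ?thesis using j0 less.prems(2) by blast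
    next
      case False
      then have "\<bar>e i\<bar> \<le> \<bar>e j0\<bar>" by simp
      then show ?thesis using j0 less.prems(2,3) by metis
    qed
    then obtain k l where kl: "k \<in> I" "l \<in> I" "k \<noteq> l" "e l \<noteq> 0" "\<bar>e l\<bar> \<le> \<bar>e k\<bar>" by blast
    \<comment> \<open>The sign is chosen so that \<open>s * e l\<close> has the sign of
      \<open>e k\<close>; being nonzero and no larger in absolute value, it strictly shrinks
      \<open>e k\<close> when subtracted.\<close>
    define s where "s = sgn (e k) * sgn (e l)"
    define t' where "t' = t(l := t l \<otimes> t k [^] s)"
    \<comment> \<open>The power of \<open>t k\<close> that enters through \<open>t' l\<close> is
      taken out of the exponent at \<open>k\<close>, so the relation keeps its value.\<close>
    define e' where "e' = e(k := e k - s * e l)"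
    have tk: "t k \<in> carrier G" "t l \<in> carrier G" using less.prems(1) kl by auto
    have t'c: "t' ` I \<subseteq> carrier G" using less.prems(1) tk by (auto simp: t'_def)
    define J where "J = I - {k, l}"
    have J: "finite J" "k \<notin> insert l J" "l \<notin> J" "I = insert k (insert l J)" using kl I(1) by (auto simp: J_def)
    have abs: "\<bar>e k - s * e l\<bar> < \<bar>e k\<bar>"
      using kl(4,5) by (auto simp: s_def sgn_if)
    have "e k \<noteq> 0" using kl(4,5) by auto
    have smaller: "(\<Sum>i\<in>I. nat \<bar>e' i\<bar>) < (\<Sum>i\<in>I. nat \<bar>e i\<bar>)"
      using abs kl(1) I(1) \<open>e k \<noteq> 0\<close> by (intro sum_strict_mono_ex1) (auto simp: e'_def)
    have mon: "monomial t' e' I = monomial t e I"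
    proof -
      have Jt: "monomial t' e' J = monomial t e J"
        using J t'c by (intro monomial_cong) (auto simp: t'_def e'_def)
      have mJ: "monomial t e J \<in> carrier G" using less.prems(1) J(4) by (intro monomial_closed) auto
      have "monomial t' e' I = t k [^] (e k - s * e l) \<otimes> ((t l \<otimes> t k [^] s) [^] e l \<otimes> monomial t e J)"
        using J t'c kl(3) Jt by (simp add: monomial_insert t'_def e'_def)
      also have "(t l \<otimes> t k [^] s) [^] e l = t l [^] e l \<otimes> t k [^] (s * e l)"
        using tk by (simp add: int_pow_mult_distrib m_comm int_pow_pow)
      also have "t k [^] (e k - s * e l) \<otimes> (t l [^] e l \<otimes> t k [^] (s * e l) \<otimes> monomial t e J) =
          (t k [^] (e k - s * e l) \<otimes> t k [^] (s * e l)) \<otimes> (t l [^] e l \<otimes> monomial t e J)"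
        using tk mJ by (simp add: m_ac)
      also have "t k [^] (e k - s * e l) \<otimes> t k [^] (s * e l) = t k [^] e k"
        using tk by (simp add: int_pow_mult[symmetric])
      also have "t k [^] e k \<otimes> (t l [^] e l \<otimes> monomial t e J) = monomial t e I"
        using J less.prems(1) by (simp add: monomial_insert)
      finally show ?thesis .
    qed
    have gen: "generate G (A \<union> t' ` I) = generate G (A \<union> t ` I)"
    proof (rule generate_mono_eq)
      have gs: "subgroup (generate G (A \<union> t ` I)) G" "subgroup (generate G (A \<union> t' ` I)) G"
        by (rule generate_is_subgroup, use Ac less.prems(1) t'c in blast)+
      have 1: "t i \<in> generate G (A \<union> t ` I)" "t' i \<in> generate G (A \<union> t' ` I)" if "i \<in> I" for i
        using that by (auto intro: generate.incl)
      have p: "x [^] z \<in> H" if "subgroup H G" "x \<in> H" for H x and z :: int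
        using subgroup_int_pow_closed[OF that] .
      have "t l \<otimes> t k [^] s \<in> generate G (A \<union> t ` I)"
        by (intro subgroup.m_closed[OF gs(1)] p[OF gs(1)] 1(1) kl)
      then have "t' i \<in> generate G (A \<union> t ` I)" if "i \<in> I" for i
        using 1(1)[OF that] by (simp add: t'_def)
      then show "A \<union> t' ` I \<subseteq> generate G (A \<union> t ` I)" by (auto intro: generate.incl)
      have "t' k = t k" using kl(3) by (simp add: t'_def)
      then have "t k [^] (- s) \<in> generate G (A \<union> t' ` I)" using 1(2)[OF kl(1)] p[OF gs(2)] by metis
      then have "t' l \<otimes> t k [^] (- s) \<in> generate G (A \<union> t' ` I)"
        using subgroup.m_closed[OF gs(2) 1(2)[OF kl(2)]] by simp
      also have "t' l \<otimes> t k [^] (- s) = t l"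
        using tk by (simp add: t'_def m_assoc int_pow_mult[symmetric])
      finally have "t i \<in> generate G (A \<union> t' ` I)" if "i \<in> I" for i
        using 1(2)[OF that] by (cases "i = l") (auto simp: t'_def)
      then show "A \<union> t ` I \<subseteq> generate G (A \<union> t' ` I)" by (auto intro: generate.incl)
    qed (use Ac less.prems(1) t'c in auto)
    \<comment> \<open>The exponent at \<open>l\<close> is untouched, so \<open>l\<close> serves as
      the index with nonzero exponent for the induction hypothesis.\<close>
    have "e' l \<noteq> 0" using kl by (simp add: e'_def)
    then show ?thesis
      using less.hyps[OF smaller t'c kl(2)] mon less.prems(4,5) unfolding gen by simp
  qed
qed

lemma ex_free_generators:
  fixes t :: "'i \<Rightarrow> 'a"
  assumes A: "subgroup A G" and I: "finite I" "t ` I \<subseteq> carrier G"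
    and tf: "\<And>x m. x \<in> generate G (A \<union> t ` I) \<Longrightarrow> 0 < (m::nat) \<Longrightarrow> x [^] m \<in> A \<Longrightarrow> x \<in> A"
  shows "\<exists>J. \<exists>t' :: 'i \<Rightarrow> 'a. finite J \<and> t' ` J \<subseteq> carrier G \<and> generate G (A \<union> t' ` J) = generate G (A \<union> t ` I) \<and>
    (\<forall>e. monomial t' e J \<in> A \<longrightarrow> (\<forall>i\<in>J. e i = 0))"
  using I tf
proof (induction "card I" arbitrary: I t rule: less_induct)
  case less
  show ?case
  proof (cases "\<forall>e. monomial t e I \<in> A \<longrightarrow> (\<forall>i\<in>I. e i = 0)")
    case True
    show ?thesis
      by (rule exI[of _ I], rule exI[of _ t], intro conjI refl less.prems(1,2) True)
  next
    case False
    then obtain e i where "monomial t e I \<in> A" "i \<in> I" "e i \<noteq> 0" by auto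
    then obtain j t' where j: "j \<in> I" "t' ` I \<subseteq> carrier G"
        "generate G (A \<union> t' ` (I - {j})) = generate G (A \<union> t ` I)"
      using reduce_generators[OF A less.prems(1,2), of i e] less.prems(3) by metis
    have "card (I - {j}) < card I" using card_Diff1_less[OF less.prems(1) j(1)] .
    moreover have "t' ` (I - {j}) \<subseteq> carrier G" using j(2) by auto
    ultimately show ?thesis
      using less.hyps[of "I - {j}" t'] less.prems(1,3) unfolding j(3) by simp
  qed
qed

end

section \<open>Exponentials of integrals and algebraic independence\<close>

context differential_field
begin

text \<open>The coefficients of \<open>(\<partial> - s)\<close> applied to the polynomial \<open>p(t)\<close>, where \<open>t' = q t\<close>.\<close>

primrec exp_der :: "'a \<Rightarrow> 'a \<Rightarrow> 'a list \<Rightarrow> 'a list" where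
  "exp_der q s [] = []"
| "exp_der q s (a # p) = (\<partial> a \<oplus> (add_pow K (length p) q \<ominus> s) \<otimes> a) # exp_der q s p"

lemma length_exp_der: "length (exp_der q s p) = length p"
  by (induction p) auto

lemma exp_der_set:
  assumes "differential_subfield F K" "q \<in> F" "s \<in> F" "set p \<subseteq> F"
  shows "set (exp_der q s p) \<subseteq> F"
  using assms(4) differential_subfieldD[OF assms(1)] assms(2,3)
  by (induction p) (auto simp: minus_eq)

text \<open>The constant term has degree zero, so the multiple of \<open>q\<close> disappears and
  its entry is \<open>c' - s c\<close>. This is the one coefficient equation extracted from the
  minimal polynomial below.\<close>

lemma last_exp_der: "\<partial> c \<oplus> (\<zero> \<ominus> s) \<otimes> c \<in> set (exp_der q s (p @ [c]))"
  by (induction p) auto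

lemma eval_exp_der:
  assumes "set p \<subseteq> carrier K" "t \<in> carrier K" "q \<in> carrier K" "s \<in> carrier K" "\<partial> t = t \<otimes> q"
  shows "eval (exp_der q s p) t = \<partial> (eval p t) \<ominus> s \<otimes> eval p t"
  using assms(1)
proof (induction p)
  case Nil
  then show ?case using assms by (simp add: der_zero minus_eq)
next
  case (Cons a p)
  define x where "x = t [^] length p" define k where "k = add_pow K (length p) q"
  define v where "v = eval p t"
  have c: "a \<in> carrier K" "\<partial> a \<in> carrier K" "x \<in> carrier K" "k \<in> carrier K" "v \<in> carrier K" "\<partial> v \<in> carrier K"
    using Cons.prems assms eval_in_carrier[of p t] der_closed by (auto simp: x_def k_def v_def)
  have dx: "\<partial> x = x \<otimes> k" unfolding x_def k_def by (rule der_pow_log[OF assms(2,3,5)])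
  have IH: "eval (exp_der q s p) t = \<partial> v \<ominus> s \<otimes> v" using Cons by (simp add: v_def)
  have "eval (exp_der q s (a # p)) t = (\<partial> a \<oplus> (k \<ominus> s) \<otimes> a) \<otimes> x \<oplus> (\<partial> v \<ominus> s \<otimes> v)"
    using IH by (simp add: length_exp_der x_def k_def)
  also have "\<dots> = (\<partial> a \<otimes> x \<oplus> a \<otimes> (x \<otimes> k) \<oplus> \<partial> v) \<ominus> s \<otimes> (a \<otimes> x \<oplus> v)"
    using c assms(4) by algebra
  also have "\<dots> = \<partial> (a \<otimes> x \<oplus> v) \<ominus> s \<otimes> (a \<otimes> x \<oplus> v)"
    using c dx by (simp add: der_add der_mult)
  finally show ?case by (simp add: x_def v_def)
qed

lemma eval_smult:
  assumes "set p \<subseteq> carrier K" "t \<in> carrier K" "c \<in> carrier K"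
  shows "eval (map ((\<otimes>) c) p) t = c \<otimes> eval p t"
  using assms(1)
proof (induction p)
  case (Cons a p)
  then show ?case using assms eval_in_carrier[of p t] by (simp add: r_distr m_assoc)
qed (use assms in simp)

text \<open>Apply \<open>\<partial> - m q\<close> to the minimal polynomial \<open>t^m + \<dots> + c\<close> of \<open>t\<close>: the result has smaller degree, so
  that \<open>c' = m q c\<close>, and \<open>t^m / c\<close> is a constant.\<close>

lemma algebraic_exponential:
  assumes F: "differential_subfield F K" "constants K \<subseteq> F"
    and t: "t \<in> carrier K" "t \<noteq> \<zero>" "\<partial> t = t \<otimes> q" "q \<in> F" and alg: "\<not> transcendental F t"
  shows "\<exists>m>0. t [^] (m::nat) \<in> F"
proof -
  note Ff = differential_subfieldD[OF F(1)]
  have qc: "q \<in> carrier K" using t(4) Ff(3) by auto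
  \<comment> \<open>A shortest annihilating list that is not all zeros plays the role of the minimal
    polynomial.\<close>
  let ?Q = "\<lambda>p. set p \<subseteq> F \<and> eval p t = \<zero> \<and> \<not> set p \<subseteq> {\<zero>}"
  obtain p0 where "?Q p0" using transcendentalI[OF Ff(2) t(1)] alg by blast
  then obtain p where p: "?Q p" and min: "\<And>r. length r < length p \<Longrightarrow> \<not> ?Q r"
    using ex_has_least_nat[of ?Q p0 length] by (metis not_le)
  have pne: "p \<noteq> []" using p by auto
  then obtain a p' where ap: "p = a # p'" by (cases p) auto
  have pc: "set p \<subseteq> carrier K" using p Ff(3) by blast
  have ac: "a \<in> carrier K" "a \<in> F" "set p' \<subseteq> F" "set p' \<subseteq> carrier K" using p ap Ff(3) by auto
  have a0: "a \<noteq> \<zero>"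
  proof
    assume "a = \<zero>"
    then have "?Q p'" using p ap t(1) eval_in_carrier[OF ac(4) t(1)] by auto
    then show False using min[of p'] ap by simp
  qed
  have ia: "inv a \<in> F" "inv a \<in> carrier K" "inv a \<otimes> a = \<one>"
    using Ff(10)[OF ac(2) a0] inverse_facts[OF ac(1) a0] by auto
  define u where "u = map ((\<otimes>) (inv a)) p'"
  have u: "set u \<subseteq> F" "set u \<subseteq> carrier K" "length p = Suc (length u)"
    using ac ia Ff(9) Ff(3) ap by (auto simp: u_def)
  have "eval (\<one> # u) t = eval (map ((\<otimes>) (inv a)) p) t" using ia by (simp add: ap u_def)
  also have "\<dots> = \<zero>" using eval_smult[OF pc t(1) ia(2)] p ia by simp
  finally have ev: "eval (\<one> # u) t = \<zero>" .
  define m where "m = length u"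
  have m: "m > 0"
  proof (rule ccontr)
    assume "\<not> m > 0"
    then have "u = []" by (simp add: m_def)
    then show False using ev t by simp
  qed
  then obtain w c where wc: "u = w @ [c]" by (metis m_def length_greater_0_conv rev_exhaust)
  have c: "c \<in> F" "c \<in> carrier K" "set w \<subseteq> carrier K" "set w \<subseteq> F" using u wc by auto
  \<comment> \<open>The leading term \<open>t^m\<close> acquires the coefficient
    \<open>m q - s\<close>; this choice makes it vanish and lowers the degree.\<close>
  define s where "s = add_pow K m q"
  have s: "s \<in> F" "s \<in> carrier K" using Ff(12)[OF t(4), of m] qc by (auto simp: s_def)
  have uc: "eval (exp_der q s u) t \<in> carrier K"
    using exp_der_set[OF F(1) t(4) s(1) u(1)] Ff(3) t(1) by (intro eval_in_carrier) auto
  have "eval (exp_der q s (\<one> # u)) t = \<zero>"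
    using eval_exp_der[of "\<one> # u" t q s] u t(1,3) qc s ev by (simp add: der_zero minus_eq)
  moreover have "exp_der q s (\<one> # u) = \<zero> # exp_der q s u"
    using s by (simp add: der_one s_def m_def minus_eq r_neg)
  ultimately have "eval (exp_der q s u) t = \<zero>" using t(1) uc by simp
  then have "set (exp_der q s u) \<subseteq> {\<zero>}"
    using min[of "exp_der q s u"] u(3) exp_der_set[OF F(1) t(4) s(1) u(1)] by (auto simp: length_exp_der)
  then have "\<partial> c \<oplus> (\<zero> \<ominus> s) \<otimes> c = \<zero>" using last_exp_der[of c s q w] wc by auto
  then have dc: "\<partial> c = s \<otimes> c"
    using c s der_closed[OF c(2)] by (simp add: minus_eq l_minus) (metis m_closed minus_equality minus_minus a_comm a_inv_closed)
  \<comment> \<open>With a zero constant term the relation could be divided by \<open>t\<close>,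
    giving a shorter one.\<close>
  have c0: "c \<noteq> \<zero>"
  proof
    assume c0: "c = \<zero>"
    have set: "set (\<one> # w) \<subseteq> carrier K" using c by simp
    have "eval (\<one> # w) t \<otimes> t = \<zero>"
      using ev eval_append_aux[OF set c(2) t(1)] eval_in_carrier[OF set t(1)] t(1) unfolding wc c0 by simp
    then have "eval (\<one> # w) t = \<zero>" using integral eval_in_carrier[OF set t(1)] t by blast
    then have "?Q (\<one> # w)" using c Ff(6) by auto
    then show False using min[of "\<one> # w"] u(3) wc by simp
  qed
  have tm: "t [^] m \<in> carrier K" "\<partial> (t [^] m) = s \<otimes> t [^] m"
    using t(1) der_pow_log[OF t(1) qc t(3), of m] s m_comm by (auto simp: s_def)
  have "t [^] m \<otimes> inv c \<in> F"
    using der_quotient_zero[OF tm(1) c(2) s(2) c0 tm(2) dc] F(2) by auto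
  then have "(t [^] m \<otimes> inv c) \<otimes> c \<in> F" using c Ff(9) by auto
  moreover have "(t [^] m \<otimes> inv c) \<otimes> c = t [^] m"
    using inverse_facts[OF c(2) c0] tm c by (simp add: m_assoc)
  ultimately show ?thesis using m by auto
qed

lemma units_facts:
  "comm_group (units_of K)" "carrier (units_of K) = {x \<in> carrier K. x \<noteq> \<zero>}"
  "x \<otimes>\<^bsub>units_of K\<^esub> y = x \<otimes> y" "\<one>\<^bsub>units_of K\<^esub> = \<one>"
  "x \<in> carrier K \<Longrightarrow> x \<noteq> \<zero> \<Longrightarrow> inv\<^bsub>units_of K\<^esub> x = inv x"
  "x [^]\<^bsub>units_of K\<^esub> (n::nat) = x [^] n"
proof -
  show "comm_group (units_of K)" by (rule units_comm_group)
  show "carrier (units_of K) = {x \<in> carrier K. x \<noteq> \<zero>}" by (auto simp: units_of_carrier field_Units)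
  show "x \<otimes>\<^bsub>units_of K\<^esub> y = x \<otimes> y" "\<one>\<^bsub>units_of K\<^esub> = \<one>" by (simp_all add: units_of_mult units_of_one)
  show "inv\<^bsub>units_of K\<^esub> x = inv x" if "x \<in> carrier K" "x \<noteq> \<zero>"
    using units_of_inv[of x] that by (simp add: field_Units)
  show "x [^]\<^bsub>units_of K\<^esub> (n::nat) = x [^] n"
    by (induction n) (simp_all add: units_of_mult units_of_one nat_pow_def)
qed

lemma subfield_units_subgroup:
  assumes F: "differential_subfield F K"
  shows "subgroup (F - {\<zero>}) (units_of K)"
proof -
  interpret U: comm_group "units_of K" by (rule units_facts)
  note Ff = differential_subfieldD[OF F]
  have c: "x \<in> carrier K" if "x \<in> F" for x using that Ff(3) by auto
  show ?thesis
  proof (rule U.subgroupI)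
    show "F - {\<zero>} \<subseteq> carrier (units_of K)" using c by (auto simp: units_facts(2))
    show "F - {\<zero>} \<noteq> {}" using Ff(6) by auto
    show "inv\<^bsub>units_of K\<^esub> x \<in> F - {\<zero>}" if "x \<in> F - {\<zero>}" for x
      using that c Ff(10) inverse_facts[of x] by (simp add: units_facts(5))
    show "x \<otimes>\<^bsub>units_of K\<^esub> y \<in> F - {\<zero>}" if "x \<in> F - {\<zero>}" "y \<in> F - {\<zero>}" for x y
      using that c Ff(9) integral[of x y] by (auto simp: units_facts(3))
  qed
qed

text \<open>The Kolchin-Ostrowski theorem for exponentials of integrals.\<close>

lemma exponential_tower:
  fixes t :: "'i \<Rightarrow> 'a"
  assumes F: "differential_subfield F K" "constants K \<subseteq> F"
    and "finite I" "\<And>i. i \<in> I \<Longrightarrow> t i \<in> carrier K \<and> t i \<noteq> \<zero> \<and> (\<exists>q\<in>F. \<partial> (t i) = t i \<otimes> q)"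
    and "\<And>e. comm_group.monomial (units_of K) t e I \<in> F \<Longrightarrow> \<forall>i\<in>I. e i = 0"
  shows "\<exists>S. special_tower K F S \<and> t ` I \<subseteq> S \<and>
    (\<forall>x\<in>S. \<forall>p\<in>F. x \<noteq> \<zero> \<longrightarrow> \<partial> x = p \<otimes> x \<longrightarrow> x \<in> generate (units_of K) ((F - {\<zero>}) \<union> t ` I))"
  using assms(3-5)
proof (induction I rule: finite_induct)
  case empty
  have "x \<in> generate (units_of K) (F - {\<zero>})" if "x \<in> F" "x \<noteq> \<zero>" for x
    using that by (auto intro: generate.incl)
  then show ?case by (intro exI[of _ F]) (auto intro: special_tower.base)
next
  case (insert j I)
  let ?U = "units_of K" and ?A = "F - {\<zero>}"
  interpret U: comm_group ?U by (rule units_facts)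
  note Ff = differential_subfieldD[OF F(1)]
  have A: "subgroup ?A ?U" by (rule subfield_units_subgroup[OF F(1)])
  have tU: "t ` insert j I \<subseteq> carrier ?U" using insert.prems(1) by (auto simp: units_facts(2))
  have indep: "\<forall>i\<in>I. e i = 0" if "U.monomial t e I \<in> F" for e
  proof -
    let ?e = "e(j := 0)"
    have "U.monomial t ?e (insert j I) = t j [^]\<^bsub>?U\<^esub> ?e j \<otimes>\<^bsub>?U\<^esub> U.monomial t ?e I"
      using insert.hyps tU by (intro U.monomial_insert)
    also have "U.monomial t ?e I = U.monomial t e I"
      using insert.hyps tU by (intro U.monomial_cong) auto
    also have "t j [^]\<^bsub>?U\<^esub> ?e j \<otimes>\<^bsub>?U\<^esub> U.monomial t e I = U.monomial t e I"
      using U.monomial_closed[of t I e] tU by simp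
    finally have eq: "U.monomial t ?e (insert j I) = U.monomial t e I" .
    have "U.monomial t ?e (insert j I) \<in> F" unfolding eq by (rule that)
    then have "\<forall>i\<in>insert j I. ?e i = 0" by (rule insert.prems(2))
    then show ?thesis using insert.hyps by (auto split: if_splits)
  qed
  obtain S where S: "special_tower K F S" "t ` I \<subseteq> S"
    and exS: "\<forall>x\<in>S. \<forall>p\<in>F. x \<noteq> \<zero> \<longrightarrow> \<partial> x = p \<otimes> x \<longrightarrow> x \<in> generate ?U (?A \<union> t ` I)"
    using insert.IH[OF insert.prems(1)[OF insertI2] indep] by blast
  have ex: "x \<in> generate ?U (?A \<union> t ` I)" if "x \<in> S" "p \<in> F" "x \<noteq> \<zero>" "\<partial> x = p \<otimes> x" for x p
    using exS that by blast
  have dS: "differential_subfield S K" by (rule special_tower_subfield[OF S(1) F(1)])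
  note Sf = differential_subfieldD[OF dS]
  have FS: "F \<subseteq> S" by (rule special_tower_mono[OF S(1)])
  obtain q where tj: "t j \<in> carrier K" "t j \<noteq> \<zero>" "q \<in> F" "\<partial> (t j) = t j \<otimes> q" using insert.prems(1) by auto
  have qc: "q \<in> carrier K" using tj(3) Ff(3) by auto
  have tI: "t ` I \<subseteq> carrier ?U" using tU by auto
  \<comment> \<open>If \<open>t j\<close> were algebraic over \<open>S\<close>, some positive power
    of it would lie in \<open>S\<close>. Being an exponential of an integral over \<open>F\<close>,
    that power is by induction an element of \<open>F\<close> times a monomial in the other
    \<open>t i\<close>, and this relation has the forbidden exponent \<open>-m\<close> at
    \<open>j\<close>.\<close>
  have tr: "transcendental S (t j)"
  proof (rule ccontr)
    assume "\<not> transcendental S (t j)"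
    then obtain m where m: "m > 0" "t j [^] (m::nat) \<in> S"
      using algebraic_exponential[OF dS _ tj(1,2,4)] FS F(2) tj(3) by blast
    have "\<partial> (t j [^] m) = add_pow K m q \<otimes> t j [^] m"
      using der_pow_log[OF tj(1) qc tj(4), of m] tj(1) qc m_comm by simp
    then have "t j [^] m \<in> generate ?U (?A \<union> t ` I)"
      using ex[OF m(2)] Ff(12)[OF tj(3), of m] pow_nonzero[OF tj(1,2), of m] by blast
    then obtain a e where a: "a \<in> ?A" "t j [^] m = a \<otimes>\<^bsub>?U\<^esub> U.monomial t e I"
      using U.generate_monomial[OF A insert.hyps(1) tI] by blast
    have tjU: "t j \<in> carrier ?U" using tU by auto
    have aU: "a \<in> carrier ?U" using a(1) subgroup.mem_carrier[OF A] by auto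
    define e' where "e' = e(j := - int m)"
    note mc = U.monomial_closed[OF tI, of e]
    have tm: "t j [^]\<^bsub>?U\<^esub> (- int m) = inv\<^bsub>?U\<^esub> (a \<otimes>\<^bsub>?U\<^esub> U.monomial t e I)"
      using U.int_pow_neg_int[OF tjU, of m] a(2) units_facts(6)[of "t j" m] by simp
    have "U.monomial t e' (insert j I) = t j [^]\<^bsub>?U\<^esub> e' j \<otimes>\<^bsub>?U\<^esub> U.monomial t e' I"
      using insert.hyps tU by (intro U.monomial_insert)
    also have "U.monomial t e' I = U.monomial t e I"
      using insert.hyps tI by (intro U.monomial_cong) (auto simp: e'_def)
    also have "t j [^]\<^bsub>?U\<^esub> e' j \<otimes>\<^bsub>?U\<^esub> U.monomial t e I = inv\<^bsub>?U\<^esub> a"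
      unfolding e'_def fun_upd_same tm using aU mc by (simp add: U.inv_mult U.m_assoc)
    finally have "U.monomial t e' (insert j I) \<in> F" using subgroup.m_inv_closed[OF A a(1)] by simp
    then have "e' j = 0" using insert.prems(2) by blast
    then show False using m(1) by (simp add: e'_def)
  qed
  have lst: "liouvillian_step K S (t j)"
    unfolding liouvillian_step_def
  proof (intro conjI bexI tj(1) tr)
    show "\<partial> (t j) = t j \<otimes> (q \<oplus> \<zero> \<otimes> t j)" using tj qc by simp
  qed (use tj FS Sf in auto)
  let ?S = "generate_field K (insert (t j) S)"
  obtain V where V: "differential_place K S V (t j)"
    using place_of_special[OF dS liouvillian_step_special[OF dS lst]] by auto
  have mono: "generate ?U (?A \<union> t ` I) \<subseteq> generate ?U (?A \<union> t ` insert j I)"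
    by (intro U.mono_generate) auto
  have gsub: "subgroup (generate ?U (?A \<union> t ` insert j I)) ?U"
    using tU subgroup.subset[OF A] by (intro U.generate_is_subgroup) auto
  have tjg: "t j [^] (e::nat) \<in> generate ?U (?A \<union> t ` insert j I)" for e
  proof -
    have "t j \<in> generate ?U (?A \<union> t ` insert j I)" by (auto intro: generate.incl)
    then have "t j [^]\<^bsub>?U\<^esub> int e \<in> generate ?U (?A \<union> t ` insert j I)" by (rule U.subgroup_int_pow_closed[OF gsub])
    then show ?thesis by (simp add: int_pow_int units_facts(6))
  qed
  have "x \<in> generate ?U (?A \<union> t ` insert j I)"
    if x: "x \<in> ?S" "p \<in> F" "x \<noteq> \<zero>" "\<partial> x = p \<otimes> x" for x p
  proof -
    have xc: "x \<in> carrier K" using x(1) generate_field_in_carrier[of "insert (t j) S"] Sf(3) tj(1) by auto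
    have pc: "p \<in> carrier K" using x(2) Ff(3) by auto
    \<comment> \<open>By the place at \<open>t j = 0\<close>, \<open>x\<close> is an element
      \<open>a\<close> of \<open>S\<close> times a power of \<open>t j\<close> or of its inverse.
      Then \<open>a\<close> is again an exponential of an integral over \<open>F\<close>, so the
      induction hypothesis describes it; this description is what the transcendence argument for the
      next generator relies on.\<close>
    obtain a and e :: nat where a: "a \<in> S" "a \<noteq> \<zero>" "x = a \<otimes> t j [^] e \<or> x \<otimes> t j [^] e = a"
      using differential_place.exponential_in_extension[OF V x(1,3) _ x(4), of q] x(2) tj FS F(2) qc m_comm
      by (metis subset_iff)
    have ac: "a \<in> carrier K" using a(1) Sf(3) by auto
    define T where "T = t j [^] e"
    define k where "k = add_pow K e q"
    have k: "k \<in> F" "k \<in> carrier K" using Ff(12)[OF tj(3), of e] qc by (auto simp: k_def)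
    have T: "T \<in> carrier K" "T \<noteq> \<zero>" "\<partial> T = T \<otimes> k" "T \<in> generate ?U (?A \<union> t ` insert j I)"
      using tj(1) pow_nonzero[OF tj(1,2)] der_pow_log[OF tj(1) qc tj(4)] tjg by (auto simp: T_def k_def)
    have "\<exists>p'\<in>F. \<partial> a = p' \<otimes> a"
      using a(3) unfolding T_def[symmetric]
    proof
      assume e: "x = a \<otimes> T"
      have dac: "\<partial> a \<in> carrier K" using ac der_closed by simp
      have "p \<otimes> (a \<otimes> T) = a \<otimes> (T \<otimes> k) \<oplus> \<partial> a \<otimes> T"
        using x(4) unfolding e using ac T k dac by (simp add: der_mult a_comm)
      then have "\<partial> a \<otimes> T = p \<otimes> (a \<otimes> T) \<ominus> a \<otimes> (T \<otimes> k)"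
        using ac T k dac by (intro eq_add_imp) auto
      also have "\<dots> = ((p \<ominus> k) \<otimes> a) \<otimes> T" using ac T(1) k(2) pc by algebra
      finally have "\<partial> a = (p \<ominus> k) \<otimes> a" using m_rcancel[OF T(2,1)] dac pc k ac by auto
      then show ?thesis using x(2) k Ff(7,8) by (auto simp: minus_eq)
    next
      assume e: "x \<otimes> T = a"
      have "\<partial> a = (p \<otimes> x) \<otimes> T \<oplus> x \<otimes> (T \<otimes> k)"
        unfolding e[symmetric] using xc T x(4) by (simp add: der_mult)
      also have "\<dots> = (p \<oplus> k) \<otimes> (x \<otimes> T)" using xc T(1) k(2) pc by algebra
      finally have "\<partial> a = (p \<oplus> k) \<otimes> a" using e by simp
      then show ?thesis using x(2) k Ff(8) by auto
    qed
    then have ag: "a \<in> generate ?U (?A \<union> t ` insert j I)" using ex[OF a(1) _ a(2)] mono by blast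
    show ?thesis
      using a(3) unfolding T_def[symmetric]
    proof
      assume "x = a \<otimes> T"
      then show ?thesis using subgroup.m_closed[OF gsub ag T(4)] by (simp add: units_facts(3))
    next
      assume "x \<otimes> T = a"
      then have "x = a \<otimes> inv T" using cross_mult_divide[OF ac T(1) xc T(2)] by simp
      then show ?thesis
        using subgroup.m_closed[OF gsub ag subgroup.m_inv_closed[OF gsub T(4)]] T(1,2)
        by (simp add: units_facts(3,5))
    qed
  qed
  moreover have "special_tower K F ?S" by (rule special_tower.step[OF S(1) lst])
  moreover have "t ` insert j I \<subseteq> ?S" using S(2) by (auto intro: generate_field.incl)
  ultimately show ?case by (intro exI[of _ ?S]) auto
qed

end

section \<open>The theorem\<close>

context differential_extension
begin

lemma image_differential_subfield: "differential_subfield (\<phi> ` carrier K) E"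
  using differential_embedding.image_subfield[OF embedding]
    differential_embedding.S[OF embedding] by blast

lemma torsion_free_exponentials_iff:
  fixes Z defines "G \<equiv> subgroup_generated (units_of E) Z"
  assumes Z: "Z \<subseteq> carrier E - {\<zero>\<^bsub>E\<^esub>}"
  shows "torsion_free (G Mod (carrier G \<inter> \<phi> ` carrier K)) \<longleftrightarrow>
    (\<forall>g\<in>generate (units_of E) Z. \<forall>m::nat. 0 < m \<longrightarrow> g [^]\<^bsub>E\<^esub> m \<in> \<phi> ` carrier K \<longrightarrow> g \<in> \<phi> ` carrier K)"
proof -
  let ?U = "units_of E"
  interpret U: comm_group ?U by (rule E.units_facts)
  have ZU: "Z \<subseteq> carrier ?U" using Z by (auto simp: E.units_facts(2))
  have cG: "carrier G = generate ?U Z" unfolding G_def carrier_subgroup_generated using ZU by (simp add: Int_absorb1)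
  have comm: "comm_group G" unfolding G_def by (rule U.abelian_subgroup_generated[OF U.comm_group_axioms])
  have sub: "subgroup (generate ?U Z) ?U" by (rule U.generate_is_subgroup[OF ZU])
  have subA: "subgroup (\<phi> ` carrier K - {\<zero>\<^bsub>E\<^esub>}) ?U"
    by (rule E.subfield_units_subgroup[OF image_differential_subfield])
  have inter: "carrier G \<inter> \<phi> ` carrier K = generate ?U Z \<inter> (\<phi> ` carrier K - {\<zero>\<^bsub>E\<^esub>})"
    unfolding cG using subgroup.subset[OF sub] by (auto simp: E.units_facts(2))
  have "subgroup (generate ?U Z \<inter> (\<phi> ` carrier K - {\<zero>\<^bsub>E\<^esub>})) ?U"
    by (rule U.subgroups_Inter_pair[OF sub subA])
  then have H: "subgroup (carrier G \<inter> \<phi> ` carrier K) G"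
    unfolding inter unfolding G_def subgroup_generated_def using ZU sub
    by (intro U.subgroup_incl) (auto simp: Int_absorb1)
  have pow: "x [^]\<^bsub>G\<^esub> (m::nat) = x [^]\<^bsub>E\<^esub> m" for x m
    unfolding E.units_facts(6)[symmetric] by (simp add: G_def subgroup_generated_def nat_pow_def)
  have closed: "g [^]\<^bsub>E\<^esub> (m::nat) \<in> generate ?U Z" if "g \<in> generate ?U Z" for g m
    using U.subgroup_int_pow_closed[OF sub that, of "int m"] by (simp add: int_pow_int E.units_facts(6))
  show ?thesis
    unfolding torsion_free_quotient_iff[OF comm H] unfolding pow cG
  proof (rule ball_cong[OF refl])
    fix g assume g: "g \<in> generate ?U Z"
    show "(\<forall>m::nat. 0 < m \<longrightarrow> g [^]\<^bsub>E\<^esub> m \<in> generate ?U Z \<inter> \<phi> ` carrier K \<longrightarrow> g \<in> generate ?U Z \<inter> \<phi> ` carrier K) =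
        (\<forall>m::nat. 0 < m \<longrightarrow> g [^]\<^bsub>E\<^esub> m \<in> \<phi> ` carrier K \<longrightarrow> g \<in> \<phi> ` carrier K)"
      using closed[OF g] g by simp
  qed
qed

text \<open>Logarithmic derivatives add under products and change sign under inverses, and those of
  nonzero elements of the image of \<open>K\<close> stay in that image.\<close>

lemma generate_exponential:
  assumes Z: "Z \<subseteq> carrier E - {\<zero>\<^bsub>E\<^esub>}" "\<And>z. z \<in> Z \<Longrightarrow> \<exists>q\<in>\<phi> ` carrier K. \<partial>\<^bsub>E\<^esub> z = z \<otimes>\<^bsub>E\<^esub> q"
    and x: "x \<in> generate (units_of E) ((\<phi> ` carrier K - {\<zero>\<^bsub>E\<^esub>}) \<union> Z)"
  shows "x \<in> carrier E \<and> x \<noteq> \<zero>\<^bsub>E\<^esub> \<and> (\<exists>q\<in>\<phi> ` carrier K. \<partial>\<^bsub>E\<^esub> x = x \<otimes>\<^bsub>E\<^esub> q)"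
proof -
  let ?A = "\<phi> ` carrier K"
  note Af = E.differential_subfieldD[OF image_differential_subfield]
  have base: "h \<in> carrier E \<and> h \<noteq> \<zero>\<^bsub>E\<^esub> \<and> (\<exists>q\<in>?A. \<partial>\<^bsub>E\<^esub> h = h \<otimes>\<^bsub>E\<^esub> q)" if h: "h \<in> (?A - {\<zero>\<^bsub>E\<^esub>}) \<union> Z" for h
  proof (cases "h \<in> Z")
    case True
    then show ?thesis using Z by auto
  next
    case False
    then have hA: "h \<in> ?A" "h \<noteq> \<zero>\<^bsub>E\<^esub>" "h \<in> carrier E" using h Af(3) by auto
    note ih = E.inverse_facts[OF hA(3,2)]
    have "\<partial>\<^bsub>E\<^esub> h = h \<otimes>\<^bsub>E\<^esub> (inv\<^bsub>E\<^esub> h \<otimes>\<^bsub>E\<^esub> \<partial>\<^bsub>E\<^esub> h)"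
      using ih hA E.der_closed by (simp add: E.m_assoc[symmetric])
    moreover have "inv\<^bsub>E\<^esub> h \<otimes>\<^bsub>E\<^esub> \<partial>\<^bsub>E\<^esub> h \<in> ?A" using Af(4,9,10) hA by auto
    ultimately show ?thesis using hA by blast
  qed
  show ?thesis using x
  proof (induction rule: generate.induct)
    case one
    show ?case using Af(5) by (auto simp: E.units_facts(4) E.der_one)
  next
    case (incl h)
    then show ?case by (rule base)
  next
    case (inv h)
    then obtain q where h: "h \<in> carrier E" "h \<noteq> \<zero>\<^bsub>E\<^esub>" "q \<in> ?A" "\<partial>\<^bsub>E\<^esub> h = h \<otimes>\<^bsub>E\<^esub> q" using base by blast
    note ih = E.inverse_facts[OF h(1,2)]
    have qc: "q \<in> carrier E" using h Af(3) by auto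
    have d: "\<partial>\<^bsub>E\<^esub> (inv\<^bsub>E\<^esub> h) \<in> carrier E" using ih E.der_closed by simp
    have "\<zero>\<^bsub>E\<^esub> = inv\<^bsub>E\<^esub> h \<otimes>\<^bsub>E\<^esub> (h \<otimes>\<^bsub>E\<^esub> q) \<oplus>\<^bsub>E\<^esub> \<partial>\<^bsub>E\<^esub> (inv\<^bsub>E\<^esub> h) \<otimes>\<^bsub>E\<^esub> h"
      using E.der_mult[OF ih(1) h(1)] ih(1,3) h(1,4) qc d by (simp add: E.der_one E.a_comm)
    also have "inv\<^bsub>E\<^esub> h \<otimes>\<^bsub>E\<^esub> (h \<otimes>\<^bsub>E\<^esub> q) = q" using ih h qc by (simp add: E.m_assoc[symmetric])
    finally have "\<partial>\<^bsub>E\<^esub> (inv\<^bsub>E\<^esub> h) \<otimes>\<^bsub>E\<^esub> h = \<zero>\<^bsub>E\<^esub> \<ominus>\<^bsub>E\<^esub> q" using qc d h by (intro E.eq_add_imp) auto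
    then have "\<partial>\<^bsub>E\<^esub> (inv\<^bsub>E\<^esub> h) = \<ominus>\<^bsub>E\<^esub> q \<otimes>\<^bsub>E\<^esub> inv\<^bsub>E\<^esub> h"
      using qc d h by (intro E.cross_mult_divide) (auto simp: E.minus_eq)
    then have "\<partial>\<^bsub>E\<^esub> (inv\<^bsub>E\<^esub> h) = inv\<^bsub>E\<^esub> h \<otimes>\<^bsub>E\<^esub> \<ominus>\<^bsub>E\<^esub> q" using qc ih by (simp add: E.m_comm)
    then show ?case using ih Af(7)[OF h(3)] h(1,2) by (auto simp: E.units_facts(5))
  next
    case (eng h1 h2)
    then obtain q1 q2 where h: "h1 \<in> carrier E" "h1 \<noteq> \<zero>\<^bsub>E\<^esub>" "q1 \<in> ?A" "\<partial>\<^bsub>E\<^esub> h1 = h1 \<otimes>\<^bsub>E\<^esub> q1"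
        "h2 \<in> carrier E" "h2 \<noteq> \<zero>\<^bsub>E\<^esub>" "q2 \<in> ?A" "\<partial>\<^bsub>E\<^esub> h2 = h2 \<otimes>\<^bsub>E\<^esub> q2" by blast
    have qc: "q1 \<in> carrier E" "q2 \<in> carrier E" using h Af(3) by auto
    have "\<partial>\<^bsub>E\<^esub> (h1 \<otimes>\<^bsub>E\<^esub> h2) = (h1 \<otimes>\<^bsub>E\<^esub> q1) \<otimes>\<^bsub>E\<^esub> h2 \<oplus>\<^bsub>E\<^esub> h1 \<otimes>\<^bsub>E\<^esub> (h2 \<otimes>\<^bsub>E\<^esub> q2)"
      using h by (simp add: E.der_mult)
    also have "\<dots> = (h1 \<otimes>\<^bsub>E\<^esub> h2) \<otimes>\<^bsub>E\<^esub> (q1 \<oplus>\<^bsub>E\<^esub> q2)" using h(1,5) qc by algebra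
    finally show ?case
      using h Af(8)[OF h(3,7)] E.integral[of h1 h2] by (auto simp: E.units_facts(3))
  qed
qed

text \<open>Generators that are independent modulo the nonzero elements of \<open>K\<close> replace
  \<open>Z\<close>; they are exponentials of integrals again and can be adjoined one after another.
  The resulting field \<open>S\<close> need not be all of \<open>E\<close>, hence the restricted
  carrier.\<close>

lemma liouvillian_extension_of_exponentials:
  assumes Z: "finite Z" "Z \<subseteq> carrier E - {\<zero>\<^bsub>E\<^esub>}" "\<And>z. z \<in> Z \<Longrightarrow> \<exists>q\<in>\<phi> ` carrier K. \<partial>\<^bsub>E\<^esub> z = z \<otimes>\<^bsub>E\<^esub> q"
    and tf: "torsion_free (subgroup_generated (units_of E) Z Mod
      (carrier (subgroup_generated (units_of E) Z) \<inter> \<phi> ` carrier K))"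
  shows "\<exists>S. differential_subfield S E \<and> Z \<subseteq> S \<and> liouvillian_extension K (E\<lparr>carrier := S\<rparr>) \<phi>"
proof -
  let ?U = "units_of E" and ?F = "\<phi> ` carrier K" and ?A = "\<phi> ` carrier K - {\<zero>\<^bsub>E\<^esub>}"
  interpret U: comm_group ?U by (rule E.units_facts)
  note F = image_differential_subfield
  note Ff = E.differential_subfieldD[OF F]
  have A: "subgroup ?A ?U" by (rule E.subfield_units_subgroup[OF F])
  have ZU: "Z \<subseteq> carrier ?U" using Z(2) by (auto simp: E.units_facts(2))
  have tfZ: "g \<in> ?F" if "g \<in> generate ?U Z" "0 < (m::nat)" "g [^]\<^bsub>E\<^esub> m \<in> ?F" for g m
    using tf that unfolding torsion_free_exponentials_iff[OF Z(2)] by blast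
  \<comment> \<open>Torsion-freeness passes from the group of \<open>Z\<close> to the one generated
    also by the nonzero elements of \<open>K\<close>: in \<open>x = a g\<close> both
    \<open>x^m\<close> and \<open>a^m\<close> lie in \<open>K\<close>, hence so does
    \<open>g^m\<close>.\<close>
  have tfA: "x \<in> ?A" if x: "x \<in> generate ?U (?A \<union> id ` Z)" "0 < (m::nat)" "x [^]\<^bsub>?U\<^esub> m \<in> ?A" for x m
  proof -
    have "\<exists>a\<in>?A. \<exists>g\<in>generate ?U Z. x = a \<otimes>\<^bsub>?U\<^esub> g"
    proof -
      obtain a e where a: "a \<in> ?A" "x = a \<otimes>\<^bsub>?U\<^esub> U.monomial id e Z"
        using U.generate_monomial[OF A Z(1) _ x(1)] ZU by auto
      have sub: "subgroup (generate ?U Z) ?U" by (rule U.generate_is_subgroup[OF ZU])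
      have "U.monomial id e Y \<in> generate ?U Z" if "finite Y" "Y \<subseteq> Z" for Y
        using that
      proof (induction Y rule: finite_induct)
        case empty
        then show ?case by (simp add: U.monomial_def generate.one)
      next
        case (insert y Y)
        have "y [^]\<^bsub>?U\<^esub> e y \<in> generate ?U Z"
          using insert.prems by (intro U.subgroup_int_pow_closed[OF sub]) (auto intro: generate.incl)
        moreover have "U.monomial id e (insert y Y) = y [^]\<^bsub>?U\<^esub> e y \<otimes>\<^bsub>?U\<^esub> U.monomial id e Y"
          using insert.hyps insert.prems ZU U.monomial_insert[of Y y id e] by auto
        moreover have "U.monomial id e Y \<in> generate ?U Z" using insert.IH insert.prems by blast
        ultimately show ?case using subgroup.m_closed[OF sub] by metis
      qed
      then show ?thesis using a Z(1) by blast
    qed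
    then obtain a g where a: "a \<in> ?A" and g: "g \<in> generate ?U Z" and xag: "x = a \<otimes>\<^bsub>?U\<^esub> g" by auto
    have c: "a \<in> carrier ?U" "g \<in> carrier ?U"
      using a g subgroup.mem_carrier[OF A] U.generate_in_carrier[OF ZU] by auto
    have am: "a [^]\<^bsub>?U\<^esub> m \<in> ?A"
      using U.subgroup_int_pow_closed[OF A a, of "int m"] by (simp add: int_pow_int)
    have "x [^]\<^bsub>?U\<^esub> m = a [^]\<^bsub>?U\<^esub> m \<otimes>\<^bsub>?U\<^esub> g [^]\<^bsub>?U\<^esub> m"
      unfolding xag using c by (simp add: U.pow_mult_distrib U.m_comm)
    then have "g [^]\<^bsub>?U\<^esub> m = inv\<^bsub>?U\<^esub> (a [^]\<^bsub>?U\<^esub> m) \<otimes>\<^bsub>?U\<^esub> x [^]\<^bsub>?U\<^esub> m"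
      using c by (simp add: U.m_assoc[symmetric])
    then have "g [^]\<^bsub>?U\<^esub> m \<in> ?A"
      using subgroup.m_closed[OF A subgroup.m_inv_closed[OF A am] x(3)] by simp
    then have "g \<in> ?F" using tfZ[OF g x(2)] by (simp add: E.units_facts(6))
    then have "g \<in> ?A" using c by (auto simp: E.units_facts(2))
    then show ?thesis unfolding xag by (rule subgroup.m_closed[OF A a])
  qed
  have idZ: "id ` Z \<subseteq> carrier ?U" using ZU by simp
  have "\<exists>J. \<exists>t :: 'b \<Rightarrow> 'b. finite J \<and> t ` J \<subseteq> carrier ?U \<and>
      generate ?U (?A \<union> t ` J) = generate ?U (?A \<union> id ` Z) \<and>
      (\<forall>e. U.monomial t e J \<in> ?A \<longrightarrow> (\<forall>i\<in>J. e i = 0))"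
    by (rule U.ex_free_generators[OF A Z(1) idZ]) (erule (2) tfA)
  then obtain J and t :: "'b \<Rightarrow> 'b" where J0: "finite J \<and> t ` J \<subseteq> carrier ?U \<and>
      generate ?U (?A \<union> t ` J) = generate ?U (?A \<union> id ` Z) \<and>
      (\<forall>e. U.monomial t e J \<in> ?A \<longrightarrow> (\<forall>i\<in>J. e i = 0))"
    by (elim exE)
  note J = J0[THEN conjunct1] J0[THEN conjunct2, THEN conjunct1] J0[THEN conjunct2, THEN conjunct2, THEN conjunct1]
    J0[THEN conjunct2, THEN conjunct2, THEN conjunct2, rule_format]
  have gen: "x \<in> carrier E \<and> x \<noteq> \<zero>\<^bsub>E\<^esub> \<and> (\<exists>q\<in>?F. \<partial>\<^bsub>E\<^esub> x = x \<otimes>\<^bsub>E\<^esub> q)"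
    if "x \<in> generate ?U (?A \<union> Z)" for x
    using generate_exponential[OF Z(2,3) that] .
  have tJ: "t i \<in> carrier E \<and> t i \<noteq> \<zero>\<^bsub>E\<^esub> \<and> (\<exists>q\<in>?F. \<partial>\<^bsub>E\<^esub> (t i) = t i \<otimes>\<^bsub>E\<^esub> q)" if "i \<in> J" for i
  proof -
    have "t i \<in> generate ?U (?A \<union> t ` J)" using that by (auto intro: generate.incl)
    then show ?thesis using gen unfolding J(3) by simp
  qed
  have indep: "\<forall>i\<in>J. e i = 0" if "U.monomial t e J \<in> ?F" for e
  proof -
    have "U.monomial t e J \<noteq> \<zero>\<^bsub>E\<^esub>" using U.monomial_closed[OF J(2), of e] by (simp add: E.units_facts(2))
    then show ?thesis using J(4) that by blast
  qed
  obtain S where S: "special_tower E ?F S" "t ` J \<subseteq> S"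
    using E.exponential_tower[where t=t, OF F constants_in_image J(1) tJ indep] by blast
  have dS: "differential_subfield S E" by (rule E.special_tower_subfield[OF S(1) F])
  have FS: "?F \<subseteq> S" by (rule special_tower_mono[OF S(1)])
  have "generate ?U (?A \<union> t ` J) \<subseteq> S - {\<zero>\<^bsub>E\<^esub>}"
    using FS S(2) tJ by (intro U.generate_subgroup_incl E.subfield_units_subgroup[OF dS]) auto
  moreover have "Z \<subseteq> generate ?U (?A \<union> t ` J)" unfolding J(3) by (auto intro: generate.incl)
  ultimately have ZS: "Z \<subseteq> S" by auto
  interpret res: differential_embedding E "E\<lparr>carrier := S\<rparr>" S id by (rule E.restrict_differential_field[OF dS])
  have "special_tower (E\<lparr>carrier := S\<rparr>) ?F S"
    using res.image_special_tower[OF S(1) F order.refl] by simp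
  then show ?thesis
    using restrict_extension[OF dS FS] dS ZS by (auto simp: liouvillian_extension_def)
qed

end

theorem theorem11p1:
  fixes K :: "'a differential_ring"
    and n :: nat
    and L :: "nat \<Rightarrow> 'a"
    and emb :: "'a \<Rightarrow> 'b"
  assumes "differential_field K"
    and "n \<ge> 1"
    and "diffop_of_order K n L"
    and "inj_on emb (carrier K)"
  shows "(\<exists>(E :: 'b differential_ring) \<phi>.
            admissible_extension K E \<phi> \<and> contains_all_solutions E \<phi> n L)
     \<longleftrightarrow>
         (\<exists>(F :: 'b differential_ring) \<phi> z p.
            differential_extension K F \<phi> \<and>
            exponentials_of_integrals K F \<phi> n z p \<and>
            L = (\<lambda>k. L n \<otimes>\<^bsub>K\<^esub> D_minus_prod K p n k) \<and>
            (let G = subgroup_generated (units_of F) (z ` {1..n});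
                 G\<^sub>0 = carrier G \<inter> \<phi> ` carrier K
             in torsion_free (G Mod G\<^sub>0)))"
    (is "?solvable \<longleftrightarrow> ?factorizable")
proof
  assume ?solvable
  then obtain E :: "'b differential_ring" and \<phi> where E: "admissible_extension K E \<phi>"
      "contains_all_solutions E \<phi> n L" by blast
  interpret differential_extension K E \<phi> using E(1) by (simp add: admissible_extension_def)
  obtain r :: nat and F where F: "F 0 = \<phi> ` carrier K" "F r = carrier E"
      "\<forall>i\<le>r. differential_subfield (F i) E"
      "\<forall>i<r. \<exists>y. special_transcendental E (F i) y \<and> F (Suc i) = generate_field E (insert y (F i))"
    using E(1) unfolding admissible_extension_def by blast
  interpret chain: special_chain E F r
    by (intro special_chain.intro special_chain_axioms.intro E.differential_field_axioms) (use F in auto)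
  obtain z p where zp: "exponentials_of_integrals K E \<phi> n z p" "L = (\<lambda>k. L n \<otimes>\<^bsub>K\<^esub> D_minus_prod K p n k)"
    by (rule exponentials_of_solutions[OF chain.special_chain_axioms F(1,2) assms(3) E(2)])
  have Z: "z ` {1..n} \<subseteq> carrier E - {\<zero>\<^bsub>E\<^esub>}" using zp(1) by (auto simp: exponentials_of_integrals_def)
  interpret U: comm_group "units_of E" by (rule E.units_facts)
  have "torsion_free (subgroup_generated (units_of E) (z ` {1..n}) Mod
      (carrier (subgroup_generated (units_of E) (z ` {1..n})) \<inter> \<phi> ` carrier K))"
    unfolding torsion_free_exponentials_iff[OF Z]
  proof (intro ballI allI impI)
    fix g and m :: nat
    assume g: "g \<in> generate (units_of E) (z ` {1..n})" "0 < m" "g [^]\<^bsub>E\<^esub> m \<in> \<phi> ` carrier K"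
    have "z ` {1..n} \<subseteq> carrier (units_of E)" using Z by (auto simp: E.units_facts(2))
    then have "g \<in> carrier E" using U.generate_in_carrier[OF _ g(1)] by (simp add: E.units_facts(2))
    then show "g \<in> \<phi> ` carrier K"
      using chain.root_descent_chain[OF _ g(2)] g(3) F(1,2) constants_in_image by simp
  qed
  then show ?factorizable using differential_extension_axioms zp unfolding Let_def by blast
next
  assume ?factorizable
  then obtain F :: "'b differential_ring" and \<phi> z p where F: "differential_extension K F \<phi>"
    and zp: "exponentials_of_integrals K F \<phi> n z p"
    and L: "L = (\<lambda>k. L n \<otimes>\<^bsub>K\<^esub> D_minus_prod K p n k)"
    and tf: "torsion_free (subgroup_generated (units_of F) (z ` {1..n}) Mod
      (carrier (subgroup_generated (units_of F) (z ` {1..n})) \<inter> \<phi> ` carrier K))"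
    unfolding Let_def by blast
  interpret KF: differential_extension K F \<phi> by fact
  have z: "z i \<in> carrier F \<and> z i \<noteq> \<zero>\<^bsub>F\<^esub> \<and> p i \<in> carrier K \<and> \<partial>\<^bsub>F\<^esub> (z i) = \<phi> (p i) \<otimes>\<^bsub>F\<^esub> z i"
    if "i \<in> {1..n}" for i
    using zp that by (auto simp: exponentials_of_integrals_def)
  have Z: "z ` {1..n} \<subseteq> carrier F - {\<zero>\<^bsub>F\<^esub>}" using z by auto
  have Zq: "\<exists>q\<in>\<phi> ` carrier K. \<partial>\<^bsub>F\<^esub> x = x \<otimes>\<^bsub>F\<^esub> q" if "x \<in> z ` {1..n}" for x
  proof -
    obtain i where i: "i \<in> {1..n}" "x = z i" using \<open>x \<in> _\<close> by auto
    then have "\<partial>\<^bsub>F\<^esub> x = x \<otimes>\<^bsub>F\<^esub> \<phi> (p i)" using z[OF i(1)] KF.E.m_comm[of "z i" "\<phi> (p i)"] by simp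
    then show ?thesis using z[OF i(1)] by blast
  qed
  \<comment> \<open>The given \<open>F\<close> need not be admissible over \<open>K\<close>; the
    work moves to a subfield that contains all \<open>z i\<close> and is exhausted by a
    tower.\<close>
  obtain S where S: "differential_subfield S F" "z ` {1..n} \<subseteq> S" "liouvillian_extension K (F\<lparr>carrier := S\<rparr>) \<phi>"
    using KF.liouvillian_extension_of_exponentials[OF _ Z Zq tf] by blast
  define M where "M = F\<lparr>carrier := S\<rparr>"
  have KM: "liouvillian_extension K M \<phi>" using S(3) by (simp add: M_def)
  interpret KM: differential_extension K M \<phi> using KM by (simp add: liouvillian_extension_def)
  have pM: "(\<phi> \<circ> p) i \<in> carrier M" if "i \<in> {1..n}" for i using z[OF that] by simp
  have zM: "z i \<in> carrier M \<and> z i \<noteq> \<zero>\<^bsub>M\<^esub> \<and> \<partial>\<^bsub>M\<^esub> (z i) = (\<phi> \<circ> p) i \<otimes>\<^bsub>M\<^esub> z i" if "i \<in> {1..n}" for i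
    using z[OF that] S(2) that by (auto simp: M_def)
  obtain N :: "'b differential_ring" and \<psi> ys where N: "liouvillian_extension M N \<psi>" "length ys = n"
      "ring.independent N (constants N) ys"
      "\<forall>y\<in>set ys. y \<in> carrier N \<and> diffop_apply N (D_minus_prod N (\<psi> \<circ> (\<phi> \<circ> p)) n) y = \<zero>\<^bsub>N\<^esub>"
    using ex_independent_solutions[where p="\<phi> \<circ> p" and z=z, OF KM.E.differential_field_axioms pM zM order.refl]
    by blast
  have KN: "liouvillian_extension K N (\<psi> \<circ> \<phi>)" by (rule liouvillian_extension_trans[OF KM N(1)])
  interpret KN: differential_extension K N "\<psi> \<circ> \<phi>" using KN by (simp add: liouvillian_extension_def)
  have pK: "p i \<in> carrier K" if "i \<in> {1..n}" for i using z[OF that] by simp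
  let ?P = "D_minus_prod K p n"
  have P: "?P \<in> UNIV \<rightarrow> carrier K" "\<forall>i>n. ?P i = \<zero>\<^bsub>K\<^esub>"
    using KF.K.D_minus_prod_facts(1,2)[where p=p, OF pK] by blast+
  have Ln: "L n \<in> carrier K" using assms(3) by (simp add: diffop_of_order_def)
  have "diffop_apply N ((\<psi> \<circ> \<phi>) \<circ> L) y = \<zero>\<^bsub>N\<^esub>" if y: "y \<in> set ys" for y
  proof -
    have yc: "y \<in> carrier N" using N(4) y by blast
    let ?PN = "(\<psi> \<circ> \<phi>) \<circ> ?P" and ?l = "(\<psi> \<circ> \<phi>) (L n)"
    have PN: "?PN \<in> UNIV \<rightarrow> carrier N" "\<forall>i>n. ?PN i = \<zero>\<^bsub>N\<^esub>" using KN.hom_comp_closed[OF P(1)] P(2) KN.hom.hom_zero by auto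
    have PNc: "?PN i \<in> carrier N" for i using PN(1) by auto
    have lc: "?l \<in> carrier N" using KN.hom_carrier[OF Ln] .
    have eq: "(\<psi> \<circ> \<phi>) \<circ> L = (\<lambda>k. ?l \<otimes>\<^bsub>N\<^esub> ?PN k)"
    proof
      fix k
      have "?P k \<in> carrier K" using P(1) by auto
      then have "(\<psi> \<circ> \<phi>) (L n \<otimes>\<^bsub>K\<^esub> ?P k) = ?l \<otimes>\<^bsub>N\<^esub> ?PN k"
        using KN.hom.hom_mult[OF Ln] by simp
      then show "((\<psi> \<circ> \<phi>) \<circ> L) k = ?l \<otimes>\<^bsub>N\<^esub> ?PN k" using fun_cong[OF L, of k] by simp
    qed
    have dy: "(der N ^^ i) y \<in> carrier N" for i by (rule KN.E.der_funpow_closed[OF yc])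
    \<comment> \<open>The leading coefficient multiplies from the left, so it comes out of the sum
      without being differentiated.\<close>
    have "diffop_apply N (\<lambda>k. ?l \<otimes>\<^bsub>N\<^esub> ?PN k) y = (\<Oplus>\<^bsub>N\<^esub>i\<in>{..n}. (?l \<otimes>\<^bsub>N\<^esub> ?PN i) \<otimes>\<^bsub>N\<^esub> (der N ^^ i) y)"
      using PN(2) PNc lc yc by (intro KN.E.diffop_apply_eq) auto
    also have "\<dots> = (\<Oplus>\<^bsub>N\<^esub>i\<in>{..n}. ?l \<otimes>\<^bsub>N\<^esub> (?PN i \<otimes>\<^bsub>N\<^esub> (der N ^^ i) y))"
      using PNc lc dy by (intro KN.E.finsum_cong') (auto simp: KN.E.m_assoc)
    also have "\<dots> = ?l \<otimes>\<^bsub>N\<^esub> diffop_apply N ?PN y"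
      unfolding KN.E.diffop_apply_eq[OF PN yc] using PNc lc dy by (intro KN.E.finsum_rdistr[symmetric]) auto
    also have "diffop_apply N ?PN y = \<zero>\<^bsub>N\<^esub>"
    proof -
      have "?PN = D_minus_prod N (\<psi> \<circ> (\<phi> \<circ> p)) n"
        using KN.hom_D_minus_prod[where p=p, OF pK] by (simp add: comp_assoc)
      then show ?thesis using bspec[OF N(4) y] by simp
    qed
    finally show ?thesis unfolding eq using lc by simp
  qed
  then have "contains_all_solutions N (\<psi> \<circ> \<phi>) n L"
    unfolding contains_all_solutions_def using N(2-4) by blast
  then show ?solvable using liouvillian_extension_admissible[OF KN] by blast
qed

end
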